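(* Let $X=[-1,1]$ and consider a set of random samples $\{x_i\}_{i=1}^n\subset X$, where $x_i$, $i=1,\dots,n$, are i.i.d. with respect to a Jacobi weight function characterized by parameters $\alpha,\beta>-1$, i.e. drawn from the probability measure $\rho_X$ with $d\rho_X=w(x)\,dx$, $w(x)=c(1-x)^\alpha(1+x)^\beta$, $c=\left(\int_{-1}^1(1-x)^\alpha(1+x)^\beta\,dx\right)^{-1}$. Let $P_m^n$ be the discrete polynomial least squares projection onto $\mathbb{P}_m$ based on these samples. Assuming $\gamma:=\max\{\alpha,\beta\}>-1/2$, the sampling rate $$n\asymp m^{2(1+\gamma)}$$ is optimal for guaranteeing stability of $P_m^n$, disregarding both constant factors and factors of $\log n$. That is, up to a factor of $\log n$, $n\asymp m^{2(1+\gamma)}$ is both a sufficient and necessary condition for $\kappa_2(P_m^n)\lesssim 1$ with high probability.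
   Context: $\mathbb{P}_m$ is the space of univariate algebraic polynomials of degree at most $m$, and $m<n$. $\|f\|:=\left(\int_X|f(x)|^2\,d\rho_X(x)\right)^{1/2}$ is the $L^2(X,\rho_X)$ norm, and $\|f\|_{n,2}:=\left(\frac1n\sum_{i=1}^n|f(x_i)|^2\right)^{1/2}$ is the empirical semi-norm. The discrete least squares projection is $P_m^n(f):=\arg\min_{p\in\mathbb{P}_m}\|p-f\|_{n,2}$; for $m<n$ the minimizer is almost surely unique. Its condition number is $$\kappa_2(P_m^n):=\sup_{f:X\to\mathbb{R}}\ \lim_{\delta\to0^+}\ \sup_{h:X\to\mathbb{R},\ 0<\|h\|_{n,2}\le\delta}\frac{\|P_m^n(f+h)-P_m^n(f)\|}{\|h\|_{n,2}}=\sup_{h:X\to\mathbb{R},\ \|h\|_{n,2}\ne0}\frac{\|P_m^n(h)\|}{\|h\|_{n,2}}.$$ $P_m^n$ is called stable if $\kappa_2(P_m^n)$ can be bounded by constants independent of $m$ and $n$, with high probability. The notation $a_n\asymp b_n$ (as $n\to\infty$) means that there are positive constants $c_1,c_2$ with $c_1b_n\le a_n\le c_2b_n$ for all large $n$. $A\lesssim B$ means that there is a universal constant $c>0$ with $A\le cB$. An event holds with high probability if it occurs with probability at least $1-C/n^s$ for some positive constants $C$ and $s$. *)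

theory Defs
  imports "HOL-Probability.Probability" "HOL-Computational_Algebra.Polynomial"
begin

text \<open>
  The measure \<open>\<rho>\<^sub>X\<close> lives on \<open>X = [-1,1]\<close>, i.e. its space is the interval itself and not the whole
  real line. At an endpoint \<open>0 powr a = 0\<close> even for negative \<open>a\<close>; this affects the weight only on a
  null set.
\<close>

definition jacobi_const :: "real \<Rightarrow> real \<Rightarrow> real" where
  "jacobi_const \<alpha> \<beta> = inverse (LINT x:{-1..1}|lborel. (1 - x) powr \<alpha> * (1 + x) powr \<beta>)"

definition jacobi_weight :: "real \<Rightarrow> real \<Rightarrow> real \<Rightarrow> real" where
  "jacobi_weight \<alpha> \<beta> x = jacobi_const \<alpha> \<beta> * (1 - x) powr \<alpha> * (1 + x) powr \<beta>"

definition jacobi_measure :: "real \<Rightarrow> real \<Rightarrow> real measure" where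
  "jacobi_measure \<alpha> \<beta> =
     density (restrict_space lborel {-1..1}) (\<lambda>x. ennreal (jacobi_weight \<alpha> \<beta> x))"

text \<open>The law of \<open>n\<close> i.i.d. samples \<open>x 1, \<dots>, x n\<close>.\<close>

definition jacobi_samples :: "real \<Rightarrow> real \<Rightarrow> nat \<Rightarrow> (nat \<Rightarrow> real) measure" where
  "jacobi_samples \<alpha> \<beta> n = (\<Pi>\<^sub>M i\<in>{1..n}. jacobi_measure \<alpha> \<beta>)"

definition L2_norm :: "real measure \<Rightarrow> (real \<Rightarrow> real) \<Rightarrow> real" where
  "L2_norm M f = sqrt (LINT t|M. \<bar>f t\<bar>\<^sup>2)"

definition emp_norm :: "nat \<Rightarrow> (nat \<Rightarrow> real) \<Rightarrow> (real \<Rightarrow> real) \<Rightarrow> real" where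
  "emp_norm n x f = sqrt ((1 / real n) * (\<Sum>i=1..n. \<bar>f (x i)\<bar>\<^sup>2))"

text \<open>
  The minimizer is unique when at least \<open>m + 1\<close> of the samples are distinct, hence almost surely for
  \<open>m < n\<close>. On the remaining null set \<open>arg_min\<close> picks an arbitrary minimizer.
\<close>

definition ls_proj :: "nat \<Rightarrow> nat \<Rightarrow> (nat \<Rightarrow> real) \<Rightarrow> (real \<Rightarrow> real) \<Rightarrow> real poly" where
  "ls_proj m n x f = arg_min (\<lambda>p. emp_norm n x (\<lambda>t. poly p t - f t)) (\<lambda>p. degree p \<le> m)"

text \<open>
  Functions \<open>X \<rightarrow> \<real>\<close> are represented by total functions, whose values outside \<open>X\<close> play no role. The
  inner supremum is monotone in \<open>\<delta>\<close>, so the limit always exists in the extended reals.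
\<close>

definition cond_number :: "real measure \<Rightarrow> nat \<Rightarrow> nat \<Rightarrow> (nat \<Rightarrow> real) \<Rightarrow> ereal" where
  "cond_number M m n x =
     (SUP f. Lim (at_right (0::real)) (\<lambda>\<delta>.
        SUP h \<in> {h. 0 < emp_norm n x h \<and> emp_norm n x h \<le> \<delta>}.
          ereal (L2_norm M (\<lambda>t. poly (ls_proj m n x (\<lambda>u. f u + h u)) t - poly (ls_proj m n x f) t)
                 / emp_norm n x h)))"

text \<open>
  Stability along a sampling regime, i.e. a set \<open>R\<close> of admissible pairs \<open>(m, n)\<close>: the condition number
  is bounded by a constant independent of \<open>m\<close> and \<open>n\<close>, with probability at least \<open>1 - C / n\<^sup>s\<close>. As
  \<open>ls_proj\<close> is arbitrary on a null set, the set where the bound holds need not be measurable; it is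
  only required to contain an event of that probability.
\<close>

definition ls_stable :: "real \<Rightarrow> real \<Rightarrow> (nat \<times> nat) set \<Rightarrow> bool" where
  "ls_stable \<alpha> \<beta> R \<longleftrightarrow>
     (\<exists>K>0. \<exists>C>0. \<exists>s>0. \<forall>(m, n)\<in>R. \<exists>E \<in> sets (jacobi_samples \<alpha> \<beta> n).
        measure (jacobi_samples \<alpha> \<beta> n) E \<ge> 1 - C / real n powr s \<and>
        (\<forall>x\<in>E. cond_number (jacobi_measure \<alpha> \<beta>) m n x \<le> ereal K))"

end

theory Submission
  imports Defs "HOL-Real_Asymp.Real_Asymp"
begin

text \<open>
  Sufficiency. Cut \<open>[-1,1]\<close> into about \<open>N = D m\<close> zones of equal length in \<open>arccos\<close>. Bernstein's
  inequality in \<open>L\<^sup>2\<close>, with constant the largest eigenvalue of the Jacobi differential operator on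
  polynomials of degree \<open>m\<close>, shows that for large \<open>D\<close> the squared norm of such a polynomial is
  controlled by its values at arbitrary nodes, one per zone, weighted by the zone masses. Hence the
  projection is stable as soon as every zone contains a fixed fraction of the expected number of
  samples. The \<open>k\<close>-th zone from an endpoint has mass at least of order \<open>k\<^sup>\<tau> / N\<^sup>\<tau>\<^sup>+\<^sup>1\<close> with
  \<open>\<tau> = 2 \<gamma> + 1 > 0\<close>, so the Chernoff bounds \<open>n\<close> to the power \<open>- \<kappa> k\<^sup>\<tau>\<close> for the failure
  probabilities are summable over \<open>k\<close>. This is why every constant in front of the rate suffices,
  whereas a matrix Chernoff bound would need a large one.

  Necessity. A power of the Fejer kernel has most of its \<open>L\<^sup>2\<close> mass in a cap of size \<open>A / m\<^sup>2\<close> at the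
  endpoint with the larger exponent. If \<open>n\<close> is much smaller than \<open>m\<close> to the power \<open>2 (1 + \<gamma>)\<close>,
  then with probability greater than one half no sample falls into this cap and the empirical norm of
  the polynomial is too small for its \<open>L\<^sup>2\<close> norm.
\<close>

section \<open>Bernstein's inequality for Jacobi weights\<close>

text \<open>Both directions use that \<open>cond_number\<close> is the best constant K in
  \<open>L2_norm\<close> <= K * \<open>emp_norm\<close> on polynomials of degree at most m: an upper
  bound for every sample, since least squares does not increase the empirical norm, and a lower
  bound once the samples are distinct, since then polynomials are reproduced. A zone may hold many
  samples; keeping the one where p^2 is least turns their number into the weight of a single node,
  which is why the quadrature allows arbitrary nodes. The obstacle is the union bound: with about m
  zones, a failure probability n^(-kappa) per zone is useless for small kappa, and kappa shrinks
  with the constant in front of the rate. Half of the exponent (kappa / 4) k^tau is spent on a power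
  of n, the other half on summing over k, so the number of zones never enters. Bernstein's
  inequality is derived from one algebraic identity of the weight instead of explicit orthogonal
  polynomials. The reflection x -> -x exchanges alpha and beta, so endpoint estimates are made at 1
  only.\<close>

lemma poly_split_top:
  fixes p :: "real poly"
  assumes "degree p \<le> Suc m"
  obtains r where "degree r \<le> m" "p = smult (coeff p (Suc m)) (monom 1 (Suc m)) + r"
proof
  let ?r = "p - smult (coeff p (Suc m)) (monom 1 (Suc m))"
  show "degree ?r \<le> m"
  proof (rule degree_le, intro allI impI)
    fix i assume "m < i"
    thus "coeff ?r i = 0"
      using assms by (cases "i = Suc m") (auto intro!: coeff_eq_0)
  qed
  show "p = smult (coeff p (Suc m)) (monom 1 (Suc m)) + ?r" by simp
qed

text \<open>The form is only semidefinite, so that it covers both the L^2 product and the product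
  over the samples, where a nonzero polynomial may vanish at every sample.\<close>

locale poly_form =
  fixes B :: "real poly \<Rightarrow> real poly \<Rightarrow> real"
  assumes sym: "B p q = B q p"
    and add: "B (p + q) r = B p r + B q r"
    and scale: "B (smult c p) r = c * B p r"
    and nonneg: "B p p \<ge> 0"
begin

lemma add': "B r (p + q) = B r p + B r q" by (simp add: sym[of r] add)
lemma scale': "B r (smult c p) = c * B r p" by (simp add: sym[of r] scale)
lemma diff: "B (p - q) r = B p r - B q r"
  using add[of "p - q" q r] by simp
lemma diff': "B r (p - q) = B r p - B r q" by (simp add: sym[of r] diff)

text \<open>Moving q along a null vector r changes the square of q linearly, so a nonzero slope
  would make it negative; c is the point where the value is -1.\<close>

lemma null_orthogonal:
  assumes "B r r = 0"
  shows "B q r = 0"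
proof (rule ccontr)
  assume ne: "B q r \<noteq> 0"
  define c where "c = (B q q + 1) / (2 * B q r)"
  have "B (q - smult c r) (q - smult c r) = B q q - 2 * c * B q r"
    using assms by (simp add: diff diff' scale scale' sym[of r q] algebra_simps)
  also have "\<dots> = -1" using ne by (simp add: c_def field_simps)
  finally show False using nonneg[of "q - smult c r"] by simp
qed

text \<open>Gram-Schmidt by induction on the degree. The third assumption keeps the equation
  solvable when B is degenerate.\<close>

lemma riesz:
  fixes l :: "real poly \<Rightarrow> real"
  assumes "\<And>p q. l (p + q) = l p + l q" "\<And>c p. l (smult c p) = c * l p"
    and "\<And>r. B r r = 0 \<Longrightarrow> l r = 0"
  shows "\<exists>p. degree p \<le> m \<and> (\<forall>r. degree r \<le> m \<longrightarrow> B p r = l r)"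
  using assms
proof (induction m arbitrary: l)
  case 0
  note l = 0
  define p :: "real poly" where "p = smult (l 1 / B 1 1) 1"
  have "B p r = l r" if r: "degree r \<le> 0" for r
  proof -
    obtain c where c: "r = smult c 1"
      using r by (metis degree_eq_zeroE le_zero_eq mult.right_neutral smult_0_right smult_pCons one_pCons)
    have "B 1 1 = 0 \<Longrightarrow> l 1 = 0" by (rule l(3))
    thus ?thesis unfolding c p_def scale scale' l(2) by (cases "B 1 1 = 0") auto
  qed
  thus ?case by (intro exI[of _ p]) (auto simp: p_def)
next
  case (Suc m)
  note l = Suc.prems
  obtain p where p: "degree p \<le> m" "\<And>r. degree r \<le> m \<Longrightarrow> B p r = l r"
    using Suc.IH[of l] l by blast
  let ?x = "monom 1 (Suc m) :: real poly"
  \<comment> \<open>The induction hypothesis for the functional \<open>B ?x\<close>: q is the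
    projection of the new monomial to lower degree.\<close>
  have "\<exists>q. degree q \<le> m \<and> (\<forall>r. degree r \<le> m \<longrightarrow> B q r = B ?x r)"
    by (rule Suc.IH) (auto simp: add' scale' intro: null_orthogonal)
  then obtain q where q: "degree q \<le> m" "\<And>r. degree r \<le> m \<Longrightarrow> B q r = B ?x r"
    by blast
  define e where "e = ?x - q"
  have e0: "B e r = 0" if "degree r \<le> m" for r
    using q(2)[OF that] by (simp add: e_def diff)
  have dege: "degree e \<le> Suc m"
    unfolding e_def by (rule degree_diff_le) (use q(1) in \<open>auto simp: degree_monom_eq\<close>)
  \<comment> \<open>If B e e = 0, division by zero gives b = 0, which is right because l and B p
    then vanish on e.\<close>
  define b where "b = (l e - B p e) / B e e"
  have eb: "B (p + smult b e) e = l e"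
    using l(3)[of e] null_orthogonal[of e p] by (cases "B e e = 0") (auto simp: add scale b_def)
  have "B (p + smult b e) r = l r" if r: "degree r \<le> Suc m" for r
  proof -
    obtain r' where r': "degree r' \<le> m" "r = smult (coeff r (Suc m)) ?x + r'"
      using poly_split_top[OF r] by blast
    define c where "c = coeff r (Suc m)"
    define s where "s = smult c q + r'"
    have s: "degree s \<le> m" unfolding s_def
      by (rule degree_add_le) (use q(1) r' degree_smult_le[of c q] in auto)
    have rs: "r = smult c e + s"
      by (subst r'(2)) (simp add: s_def e_def c_def smult_diff_right)
    show ?thesis
      using s eb e0[OF s] p(2)[OF s] unfolding rs by (simp add: add' scale' l add scale)
  qed
  moreover have "degree (p + smult b e) \<le> Suc m"
    by (rule degree_add_le) (use p(1) dege degree_smult_le[of b e] in auto)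
  ultimately show ?case by blast
qed

end

text \<open>The Sturm-Liouville operator -((1 - x^2) w p')' / w of the Jacobi weight w, with the
  derivative expanded.\<close>

definition jacobi_op :: "real \<Rightarrow> real \<Rightarrow> real poly \<Rightarrow> real poly" where
  "jacobi_op \<alpha> \<beta> p = - ([:1, 0, -1:] * pderiv (pderiv p)) - [:\<beta> - \<alpha>, -(\<alpha> + \<beta> + 2):] * pderiv p"

text \<open>The operator is triangular in the monomials: it does not raise the degree, and the
  factor of \<open>coeff p k\<close> is the eigenvalue in degree k.\<close>

lemma coeff_jacobi_op:
  "coeff (jacobi_op \<alpha> \<beta> p) k =
     real k * (real k + \<alpha> + \<beta> + 1) * coeff p k
     - (\<beta> - \<alpha>) * (real k + 1) * coeff p (k + 1)
     - (real k + 1) * (real k + 2) * coeff p (k + 2)"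
  by (cases k; cases "k - 1")
     (auto simp: jacobi_op_def coeff_pderiv coeff_pCons algebra_simps split: nat.splits)

text \<open>\<open>pearson\<close> is the vanishing of the integral of ((1 - x^2) w g)', the one
  analytic fact about the weight from which Bernstein's inequality follows by algebra.\<close>

locale pearson_functional =
  fixes \<alpha> \<beta> :: real and \<mu> :: "real poly \<Rightarrow> real"
  assumes par: "\<alpha> > -1" "\<beta> > -1"
    and mu_add: "\<mu> (p + q) = \<mu> p + \<mu> q"
    and mu_smult: "\<mu> (smult c p) = c * \<mu> p"
    and mu_nonneg: "\<mu> (p * p) \<ge> 0"
    and pearson: "\<mu> ([:1, 0, -1:] * pderiv g + [:\<beta> - \<alpha>, -(\<alpha> + \<beta> + 2):] * g) = 0"
begin

sublocale poly_form "\<lambda>p q. \<mu> (p * q)"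
  by unfold_locales (auto simp: mu_add mu_smult mu_nonneg mult.commute distrib_right distrib_left)

definition en :: "real poly \<Rightarrow> real poly \<Rightarrow> real" where
  "en p q = \<mu> ([:1, 0, -1:] * (pderiv p * pderiv q))"

text \<open>Integration by parts: the two integrands differ by the expression in
  \<open>pearson\<close> for g = p' q.\<close>

lemma en_eq: "en p q = \<mu> (jacobi_op \<alpha> \<beta> p * q)"
proof -
  have *: "[:1, 0, -1:] * (pderiv p * pderiv q) =
     jacobi_op \<alpha> \<beta> p * q + ([:1, 0, -1:] * pderiv (pderiv p * q) + [:\<beta> - \<alpha>, -(\<alpha> + \<beta> + 2):] * (pderiv p * q))"
    unfolding jacobi_op_def pderiv_mult by algebra
  show ?thesis
    by (rule trans[OF _ add_0_right], subst pearson[of "pderiv p * q", symmetric])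
       (unfold en_def *, rule mu_add)
qed

lemma en_sym: "en p q = en q p" by (simp add: en_def mult.commute)

lemma en_add: "en (p + q) r = en p r + en q r"
  by (simp add: en_def pderiv_add distrib_left distrib_right mu_add)

lemma en_smult: "en (smult c p) r = c * en p r"
  by (simp add: en_def pderiv_smult mu_smult)

lemma en_add': "en r (p + q) = en r p + en r q"
  and en_smult': "en r (smult c p) = c * en r p"
  by (simp_all add: en_sym[of r] en_add en_smult)

text \<open>A Rayleigh quotient argument. Splitting off the component e of degree m + 1 that is
  orthogonal to all lower degrees separates both the energy and the square norm; e contributes the
  eigenvalue \<open>lam (Suc m)\<close>, the rest at most the smaller \<open>lam m\<close>.\<close>

lemma bernstein:
  assumes "degree p \<le> m"
  shows "en p p \<le> real m * (real m + \<alpha> + \<beta> + 1) * \<mu> (p * p)"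
  using assms
proof (induction m arbitrary: p)
  case 0
  hence "pderiv p = 0" by (simp add: pderiv_eq_0_iff)
  moreover have "\<mu> 0 = 0" using mu_smult[of 0 0] by simp
  ultimately show ?case by (simp add: en_def)
next
  case (Suc m)
  let ?x = "monom 1 (Suc m) :: real poly"
  define lam where "lam = (\<lambda>m. real m * (real m + \<alpha> + \<beta> + 1))"
  have "\<exists>q. degree q \<le> m \<and> (\<forall>r. degree r \<le> m \<longrightarrow> \<mu> (q * r) = \<mu> (?x * r))"
    by (rule riesz) (auto simp only: add' scale' intro: null_orthogonal)
  then obtain q where q: "degree q \<le> m" "\<And>r. degree r \<le> m \<Longrightarrow> \<mu> (q * r) = \<mu> (?x * r)"
    by blast
  define e where "e = ?x - q"
  have e0: "\<mu> (e * r) = 0" if "degree r \<le> m" for r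
    using q(2)[OF that] by (simp add: e_def diff)
  have dege: "degree e \<le> Suc m"
    unfolding e_def by (rule degree_diff_le) (use q(1) in \<open>auto simp: degree_monom_eq\<close>)
  obtain r' where r': "degree r' \<le> m" "p = smult (coeff p (Suc m)) ?x + r'"
    using poly_split_top[OF Suc.prems] by blast
  define c where "c = coeff p (Suc m)"
  define s where "s = smult c q + r'"
  have s: "degree s \<le> m" unfolding s_def
    by (rule degree_add_le) (use q(1) r' degree_smult_le[of c q] in auto)
  have ps: "p = smult c e + s"
    by (subst r'(2)) (simp add: s_def e_def c_def smult_diff_right)
  have dL: "degree (jacobi_op \<alpha> \<beta> s) \<le> m"
    by (rule degree_le) (use s in \<open>auto simp: coeff_jacobi_op coeff_eq_0\<close>)
  \<comment> \<open>Moving the operator to s keeps the degree at most m, and e is orthogonal to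
    that.\<close>
  have es: "en e s = 0"
    using e0[OF dL] by (subst en_sym, subst en_eq, subst mult.commute)
  \<comment> \<open>The leading coefficients cancel, so d has degree at most m and is orthogonal to
    e. This suffices for the energy of e.\<close>
  define d where "d = jacobi_op \<alpha> \<beta> e - smult (lam (Suc m)) e"
  have dd: "degree d \<le> m"
  proof (rule degree_le, intro allI impI)
    fix i assume i: "m < i"
    show "coeff d i = 0"
      using dege i by (cases "i = Suc m") (auto simp: d_def coeff_jacobi_op coeff_eq_0 lam_def)
  qed
  have "jacobi_op \<alpha> \<beta> e = smult (lam (Suc m)) e + d" by (simp add: d_def)
  hence ee: "en e e = lam (Suc m) * \<mu> (e * e)"
    using e0[OF dd] by (simp add: en_eq add scale mult.commute[of d e] distrib_right mu_add mu_smult)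
  have "en p p = c\<^sup>2 * en e e + en s s"
    unfolding ps using es en_sym[of s e]
    by (simp add: en_add en_smult en_add' en_smult' power2_eq_square)
  also have "\<dots> \<le> c\<^sup>2 * (lam (Suc m) * \<mu> (e * e)) + lam (Suc m) * \<mu> (s * s)"
  proof -
    have "en s s \<le> lam m * \<mu> (s * s)" using Suc.IH[OF s] by (simp add: lam_def)
    also have "\<dots> \<le> lam (Suc m) * \<mu> (s * s)"
    proof (rule mult_right_mono)
      have "lam (Suc m) - lam m = 2 * real m + 2 + \<alpha> + \<beta>"
        by (simp add: lam_def algebra_simps)
      thus "lam m \<le> lam (Suc m)" using par by linarith
    qed (rule mu_nonneg)
    finally show ?thesis by (simp add: ee)
  qed
  also have "\<dots> = lam (Suc m) * \<mu> (p * p)"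
  proof -
    have "\<mu> (p * p) = c\<^sup>2 * \<mu> (e * e) + \<mu> (s * s)"
      unfolding ps using e0[OF s]
      by (simp only: add add' scale scale' sym[of s e]) (simp add: power2_eq_square)
    thus ?thesis by (simp add: algebra_simps)
  qed
  finally show ?case by (simp add: lam_def)
qed

end

section \<open>A quadrature inequality for power weights on the unit interval\<close>

lemma powr_poly_integrable:
  fixes p :: "real poly"
  assumes "a > -1"
  shows "(\<lambda>t. t powr a * poly p t) integrable_on {0..1}"
proof -
  have "(\<lambda>t::real. t powr a) integrable_on {0..1}"
    using integrable_on_powr_from_0[of a 1] assms by simp
  hence 1: "(\<lambda>t::real. t powr a) absolutely_integrable_on {0..1}"
    by (intro nonnegative_absolutely_integrable_1) auto
  have "(\<lambda>t. poly p t * (t powr a)) absolutely_integrable_on {0..1}"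
  proof (rule absolutely_integrable_bounded_measurable_product_real[OF _ _ _ 1])
    show "poly p \<in> borel_measurable (lebesgue_on {0..1})"
      by (intro continuous_imp_measurable_on_sets_lebesgue continuous_intros) auto
    show "bounded (poly p ` {0..1})"
      by (intro compact_imp_bounded compact_continuous_image continuous_intros) auto
  qed auto
  thus ?thesis
    by (simp add: mult.commute set_lebesgue_integral_eq_integral(1))
qed

lemma powr_poly_integrable_sub:
  fixes p :: "real poly"
  assumes "a > -1" "0 \<le> u" "v \<le> 1"
  shows "(\<lambda>t. t powr a * poly p t) integrable_on {u..v}"
  by (rule integrable_on_subinterval[OF powr_poly_integrable[OF assms(1)]]) (use assms in auto)

lemma poly_square_variation:
  fixes q :: "real poly"
  assumes "s \<in> {u..v}" "y \<in> {u..v}"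
  shows "(poly q s)\<^sup>2 \<le> (poly q y)\<^sup>2 + integral {u..v} (\<lambda>t. 2 * \<bar>poly q t * poly (pderiv q) t\<bar>)"
proof -
  let ?d = "\<lambda>t. 2 * poly q t * poly (pderiv q) t"
  let ?e = "\<lambda>t. 2 * \<bar>poly q t * poly (pderiv q) t\<bar>"
  have ie: "?e integrable_on {c..d}" for c d
    by (intro integrable_continuous_interval continuous_intros)
  have id: "?d integrable_on {c..d}" for c d
    by (intro integrable_continuous_interval continuous_intros)
  have *: "\<bar>(poly q d)\<^sup>2 - (poly q c)\<^sup>2\<bar> \<le> integral {u..v} ?e" if "c \<le> d" "u \<le> c" "d \<le> v" for c d
  proof -
    have "(?d has_integral (poly q d)\<^sup>2 - (poly q c)\<^sup>2) {c..d}"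
      by (rule fundamental_theorem_of_calculus[OF \<open>c \<le> d\<close>])
         (auto intro!: derivative_eq_intros simp flip: has_real_derivative_iff_has_vector_derivative)
    hence "(poly q d)\<^sup>2 - (poly q c)\<^sup>2 = integral {c..d} ?d" by (simp add: integral_unique)
    also have "\<bar>\<dots>\<bar> \<le> integral {c..d} ?e"
      using integral_norm_bound_integral[OF id ie, of c d] by (auto simp: abs_mult)
    also have "\<dots> \<le> integral {u..v} ?e"
      by (rule integral_subset_le) (use that ie in auto)
    finally show ?thesis .
  qed
  show ?thesis
    using *[of s y] *[of y s] assms by (cases "s \<le> y") auto
qed

lemma integral_chain:
  fixes f :: "real \<Rightarrow> real" and \<tau> :: "nat \<Rightarrow> real"
  assumes "\<And>i. \<tau> i \<le> \<tau> (Suc i)" "f integrable_on {\<tau> j..\<tau> N}" "j \<le> N"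
  shows "integral {\<tau> j..\<tau> N} f = (\<Sum>k=j..<N. integral {\<tau> k..\<tau> (Suc k)} f)"
  using assms(3,2)
proof (induction N rule: dec_induct)
  case (step n)
  have mono: "\<tau> j \<le> \<tau> n" by (rule lift_Suc_mono_le[of \<tau>, OF assms(1) step.hyps(1)])
  have "f integrable_on {\<tau> j..\<tau> n}"
    by (rule integrable_on_subinterval[OF step.prems]) (use assms(1)[of n] in auto)
  moreover have "integral {\<tau> j..\<tau> n} f + integral {\<tau> n..\<tau> (Suc n)} f = integral {\<tau> j..\<tau> (Suc n)} f"
    by (rule Henstock_Kurzweil_Integration.integral_combine) (use mono assms(1) step.prems in auto)
  ultimately show ?case using step by simp
qed simp

text \<open>On a zone with k >= 1 the ratio of the endpoints is (k + 1)^2 / k^2 <= 4, so t^a is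
  constant there up to the factor 4^|a|, for a of either sign.\<close>

lemma powr_mult_ratio_le:
  fixes s t a :: real
  assumes "0 < s" "s \<le> t" "t \<le> 4 * s"
  shows "t powr a \<le> 4 powr \<bar>a\<bar> * s powr a" "s powr a \<le> 4 powr \<bar>a\<bar> * t powr a"
proof -
  have pos: "t > 0" using assms by simp
  have one: "1 \<le> (4::real) powr \<bar>a\<bar>" by (rule ge_one_powr_ge_zero) auto
  show "t powr a \<le> 4 powr \<bar>a\<bar> * s powr a"
  proof (cases "a \<ge> 0")
    case True
    have "t powr a \<le> (4 * s) powr a" using assms True by (intro powr_mono2) auto
    thus ?thesis using True assms by (simp add: powr_mult)
  next
    case False
    have "t powr a \<le> s powr a" using assms False by (intro powr_mono2') auto
    also have "\<dots> \<le> 4 powr \<bar>a\<bar> * s powr a" using one mult_right_mono[OF one, of "s powr a"] by simp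
    finally show ?thesis .
  qed
  show "s powr a \<le> 4 powr \<bar>a\<bar> * t powr a"
  proof (cases "a \<ge> 0")
    case True
    have "s powr a \<le> t powr a" using assms True by (intro powr_mono2) auto
    also have "\<dots> \<le> 4 powr \<bar>a\<bar> * t powr a" using one mult_right_mono[OF one, of "t powr a"] by simp
    finally show ?thesis .
  next
    case False
    have "(4 * s) powr a \<le> t powr a" using assms False pos by (intro powr_mono2') auto
    hence "4 powr a * s powr a \<le> t powr a" using assms by (simp add: powr_mult)
    hence "4 powr \<bar>a\<bar> * (4 powr a * s powr a) \<le> 4 powr \<bar>a\<bar> * t powr a"
      by (intro mult_left_mono) auto
    moreover have "(4::real) powr \<bar>a\<bar> * 4 powr a = 1" using False by (simp flip: powr_add)
    ultimately show ?thesis by (metis mult.assoc mult_1)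
  qed
qed

text \<open>The square of L |x| - sqrt t |y| is nonnegative. With x = q(t) and y = q'(t), the
  product sqrt t * y is of the order of the derivative in the arccos variable, and L, later m + 1,
  is its size relative to q.\<close>

lemma amgm_sqrt:
  fixes x y t L :: real
  assumes "L > 0" "t \<ge> 0"
  shows "2 * \<bar>x * y\<bar> * sqrt t \<le> L * (x\<^sup>2 + t * y\<^sup>2 / L\<^sup>2)"
proof -
  have "0 \<le> (L * \<bar>x\<bar> - sqrt t * \<bar>y\<bar>)\<^sup>2" by simp
  also have "\<dots> = L\<^sup>2 * x\<^sup>2 + t * y\<^sup>2 - L * (2 * \<bar>x * y\<bar> * sqrt t)"
    using assms by (simp add: power2_diff power_mult_distrib abs_mult)
  finally have "L * (2 * \<bar>x * y\<bar> * sqrt t) \<le> L * (L * (x\<^sup>2 + t * y\<^sup>2 / L\<^sup>2))"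
    using assms by (simp add: distrib_left power2_eq_square)
  thus ?thesis using assms by simp
qed

text \<open>
  In the variable \<open>t\<close>, the distance to an endpoint, the zones \<open>[(k/N)\<^sup>2, ((k+1)/N)\<^sup>2]\<close> are
  the images of an equidistant partition in \<open>arccos\<close>. The cell \<open>[0, 1/N\<^sup>2]\<close> at the endpoint carries
  no node: integrating the derivative of \<open>t\<^sup>a\<^sup>+\<^sup>1 q(t)\<^sup>2\<close> charges it to the next zone.
\<close>

lemma half_interval_quadrature:
  fixes a :: real
  assumes a: "a > -1"
  shows "\<exists>C>0. \<forall>(q::real poly) L N (y::nat \<Rightarrow> real). L > 0 \<longrightarrow> N \<ge> (2::nat) \<longrightarrow>
     (\<forall>k\<in>{1..<N}. y k \<in> {(real k / real N)\<^sup>2..(real (Suc k) / real N)\<^sup>2}) \<longrightarrow>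
     integral {0..1} (\<lambda>t. t powr a * (poly q t)\<^sup>2)
       \<le> C * (\<Sum>k=1..<N. (real k / real N) powr (2 * a + 1) / real N * (poly q (y k))\<^sup>2)
         + C * (L / real N) * (integral {0..1} (\<lambda>t. t powr a * (poly q t)\<^sup>2)
             + integral {0..1} (\<lambda>t. t powr (a + 1) * (poly (pderiv q) t)\<^sup>2) / L\<^sup>2)"
proof -
  define A where "A = (4::real) powr \<bar>a\<bar>"
  have A1: "A \<ge> 1" unfolding A_def by (rule ge_one_powr_ge_zero) auto
  \<comment> \<open>The first summand comes from the zones that carry nodes, the second from the
    cell at the endpoint.\<close>
  define C where "C = 3 * A\<^sup>2 + (1 + A) / (a + 1)"
  have Cpos: "C > 0" unfolding C_def using A1 a by (intro add_pos_nonneg) (auto)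
  show ?thesis
  proof (intro exI[of _ C] conjI Cpos allI impI)
    fix q :: "real poly" and L :: real and N :: nat and y :: "nat \<Rightarrow> real"
    assume L: "L > 0" and N: "N \<ge> 2"
      and y: "\<forall>k\<in>{1..<N}. y k \<in> {(real k / real N)\<^sup>2..(real (Suc k) / real N)\<^sup>2}"
    define \<tau> where "\<tau> = (\<lambda>k. (real k / real N)\<^sup>2)"
    \<comment> \<open>The order of the integral of t^a over zone k: the value (k/N)^(2a) times a
      length of order k / N^2.\<close>
    define \<sigma> where "\<sigma> = (\<lambda>k. (real k / real N) powr (2 * a + 1) / real N)"
    define g where "g = (\<lambda>t. t powr a * (poly q t)\<^sup>2)"
    define G where "G = (\<lambda>t. t powr a * ((poly q t)\<^sup>2 + t * (poly (pderiv q) t)\<^sup>2 / L\<^sup>2))"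
    define D where "D = (\<lambda>t. 2 * \<bar>poly q t * poly (pderiv q) t\<bar>)"
    have Npos: "real N > 0" using N by simp
    have tau_mono: "\<tau> i \<le> \<tau> (Suc i)" for i
      unfolding \<tau>_def using Npos by (intro power_mono divide_right_mono) auto
    have tau_le: "\<tau> i \<le> \<tau> j" if "i \<le> j" for i j
      using that tau_mono by (rule lift_Suc_mono_le[rotated])
    have tau0: "\<tau> 0 = 0" and tauN: "\<tau> N = 1" using Npos by (auto simp: \<tau>_def)
    have tau_ge0: "\<tau> i \<ge> 0" for i by (simp add: \<tau>_def)
    have G_eq: "G t = t powr a * poly (q\<^sup>2 + smult (1 / L\<^sup>2) ([:0,1:] * (pderiv q)\<^sup>2)) t" for t
      by (simp add: G_def poly_power)
    have g_eq: "g t = t powr a * poly (q\<^sup>2) t" for t by (simp add: g_def poly_power)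
    have iG: "G integrable_on {u..v}" and ig: "g integrable_on {u..v}" if "0 \<le> u" "v \<le> 1" for u v
      using powr_poly_integrable_sub[OF a that] unfolding G_eq[abs_def] g_eq[abs_def] by blast+
    have iD: "D integrable_on {u..v}" for u v
      unfolding D_def by (intro integrable_continuous_interval continuous_intros)
    have G0: "G t \<ge> 0" if "t \<ge> 0" for t
      unfolding G_def using that by (intro mult_nonneg_nonneg add_nonneg_nonneg divide_nonneg_nonneg) auto
    have DG: "t powr a * sqrt t * D t \<le> L * G t" if "t \<ge> 0" for t
      using mult_left_mono[OF amgm_sqrt[OF L that, of "poly q t" "poly (pderiv q) t"], of "t powr a"]
      by (simp add: D_def G_def algebra_simps)
    have sig0: "\<sigma> k \<ge> 0" for k by (simp add: \<sigma>_def)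
    have D0: "D t \<ge> 0" for t by (simp add: D_def)
    have var: "\<sigma> k * (poly q s)\<^sup>2 \<le> \<sigma> k * (poly q (y k))\<^sup>2 + A * (L / N) * integral {\<tau> k..\<tau> (Suc k)} G"
      and mass: "integral {\<tau> k..\<tau> (Suc k)} g
        \<le> 3 * A * (\<sigma> k * (poly q (y k))\<^sup>2 + A * (L / N) * integral {\<tau> k..\<tau> (Suc k)} G)"
      if k: "k \<in> {1..<N}" and s: "s \<in> {\<tau> k..\<tau> (Suc k)}" for k s
    proof -
      have kpos: "real k > 0" and k1: "real k \<ge> 1" using k by auto
      have tk: "\<tau> k > 0" using kpos Npos by (simp add: \<tau>_def)
      \<comment> \<open>This needs k >= 1; in the cell at 0 the ratio is unbounded.\<close>
      have t4: "\<tau> (Suc k) \<le> 4 * \<tau> k"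
      proof -
        have "real (Suc k) / N \<le> 2 * (real k / N)" using k1 Npos by (simp add: field_simps)
        hence "(real (Suc k) / N)\<^sup>2 \<le> (2 * (real k / N))\<^sup>2" using Npos by (intro power_mono) auto
        thus ?thesis by (simp add: \<tau>_def power_mult_distrib power_divide)
      qed
      have le1: "\<tau> (Suc k) \<le> 1" using tau_le[of "Suc k" N] k tauN by auto
      have yk: "y k \<in> {\<tau> k..\<tau> (Suc k)}" using y k by (auto simp: \<tau>_def)
      have sq: "sqrt (\<tau> k) = real k / N" using kpos Npos by (simp add: \<tau>_def)
      have tauk_powr: "\<tau> k powr a = (real k / N) powr (2 * a)"
        unfolding \<tau>_def using kpos Npos by (simp add: powr_power[symmetric] powr_powr flip: powr_numeral)
      have sig_eq: "\<sigma> k = \<tau> k powr a * (real k / N) / N"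
        unfolding \<sigma>_def tauk_powr using kpos Npos by (simp add: powr_add)
      \<comment> \<open>On the zone \<open>\<sigma> k\<close> is at most of order t^a sqrt t / N, so
        the variation of q^2 costs only the small factor L / N times G.\<close>
      have sD: "\<sigma> k * D t \<le> A * (L / N) * G t" if t: "t \<in> {\<tau> k..\<tau> (Suc k)}" for t
      proof -
        have t0: "t \<ge> 0" using t tk by auto
        have "\<tau> k powr a \<le> A * t powr a"
          unfolding A_def by (rule powr_mult_ratio_le) (use t t4 tk in auto)
        moreover have "real k / N \<le> sqrt t" using t unfolding sq[symmetric] by simp
        ultimately have "\<tau> k powr a * (real k / N) \<le> (A * t powr a) * sqrt t"
          using kpos Npos A1 by (intro mult_mono) auto
        hence "\<sigma> k \<le> (A * t powr a) * sqrt t / N"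
          unfolding sig_eq using Npos by (intro divide_right_mono) auto
        hence "\<sigma> k * D t \<le> (A * t powr a) * sqrt t / N * D t" using D0 by (intro mult_right_mono) auto
        also have "\<dots> = A / N * (t powr a * sqrt t * D t)" by simp
        also have "\<dots> \<le> A / N * (L * G t)" using DG[OF t0] A1 Npos by (intro mult_left_mono) auto
        finally show ?thesis by simp
      qed
      have intD: "\<sigma> k * integral {\<tau> k..\<tau> (Suc k)} D \<le> A * (L / N) * integral {\<tau> k..\<tau> (Suc k)} G"
        unfolding integral_mult_right[symmetric]
        by (rule integral_le; (intro integrable_on_mult_right iD iG tau_ge0 le1 sD)?)
      have v: "(poly q s)\<^sup>2 \<le> (poly q (y k))\<^sup>2 + integral {\<tau> k..\<tau> (Suc k)} D"
        if "s \<in> {\<tau> k..\<tau> (Suc k)}" for s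
        unfolding D_def by (rule poly_square_variation) (use that yk in auto)
      have V: "\<sigma> k * (poly q s)\<^sup>2 \<le> \<sigma> k * (poly q (y k))\<^sup>2 + A * (L / N) * integral {\<tau> k..\<tau> (Suc k)} G"
        if "s \<in> {\<tau> k..\<tau> (Suc k)}" for s
        using mult_left_mono[OF v[OF that] sig0[of k]] intD by (simp add: algebra_simps)
      show "\<sigma> k * (poly q s)\<^sup>2 \<le> \<sigma> k * (poly q (y k))\<^sup>2 + A * (L / N) * integral {\<tau> k..\<tau> (Suc k)} G"
        by (rule V[OF s])
      define W where "W = \<sigma> k * (poly q (y k))\<^sup>2 + A * (L / N) * integral {\<tau> k..\<tau> (Suc k)} G"
      have W0: "W \<ge> 0" using V[OF s] sig0[of k] unfolding W_def
        by (smt (verit) mult_nonneg_nonneg zero_le_power2)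
      \<comment> \<open>The factor A N^2 / k bounds t^a / \<open>\<sigma> k\<close>; multiplied by
        the zone length, at most 3 k / N^2, it leaves 3 A.\<close>
      have gW: "g t \<le> A * N / k * N * W" if t: "t \<in> {\<tau> k..\<tau> (Suc k)}" for t
      proof -
        have "t powr a \<le> A * \<tau> k powr a"
          unfolding A_def by (rule powr_mult_ratio_le) (use t t4 tk in auto)
        hence "g t \<le> A * \<tau> k powr a * (poly q t)\<^sup>2" unfolding g_def by (intro mult_right_mono) auto
        also have "\<dots> = A * N / k * N * (\<sigma> k * (poly q t)\<^sup>2)"
          unfolding sig_eq using kpos Npos by (simp add: field_simps)
        also have "\<dots> \<le> A * N / k * N * W" unfolding W_def using V[OF t] A1 kpos Npos
          by (intro mult_left_mono) auto
        finally show ?thesis .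
      qed
      have "integral {\<tau> k..\<tau> (Suc k)} g \<le> integral {\<tau> k..\<tau> (Suc k)} (\<lambda>t. A * N / k * N * W)"
        by (rule integral_le) (use ig[of "\<tau> k" "\<tau> (Suc k)"] tau_ge0 le1 gW in auto)
      also have "\<dots> = (\<tau> (Suc k) - \<tau> k) * (A * N / k * N * W)" using tau_mono[of k] by simp
      also have "\<dots> \<le> (3 * k / N\<^sup>2) * (A * N / k * N * W)"
      proof (intro mult_right_mono mult_nonneg_nonneg W0)
        have "\<tau> (Suc k) - \<tau> k = (2 * k + 1) / N\<^sup>2"
          by (simp add: \<tau>_def power_divide power2_eq_square distrib_left distrib_right flip: diff_divide_distrib)
        also have "\<dots> \<le> 3 * k / N\<^sup>2" using k1 by (intro divide_right_mono) auto
        finally show "\<tau> (Suc k) - \<tau> k \<le> 3 * k / N\<^sup>2" .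
      qed (use A1 Npos kpos in auto)
      also have "\<dots> = 3 * A * W" using kpos Npos by (simp add: field_simps power2_eq_square)
      finally show "integral {\<tau> k..\<tau> (Suc k)} g
        \<le> 3 * A * (\<sigma> k * (poly q (y k))\<^sup>2 + A * (L / N) * integral {\<tau> k..\<tau> (Suc k)} G)"
        unfolding W_def .
    qed
    define S where "S = (\<Sum>k=1..<N. \<sigma> k * (poly q (y k))\<^sup>2)"
    have t1: "\<tau> 1 = 1 / N\<^sup>2" "\<tau> 1 \<le> 1" using tau_le[of 1 N] N tauN by (auto simp: \<tau>_def power_divide)
    have G_tot: "integral {\<tau> 1..\<tau> N} G \<le> integral {0..1} G" "integral {0..\<tau> 1} G \<le> integral {0..1} G"
      by (rule integral_subset_le; use tau_ge0 tauN t1 iG G0 in auto)+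
    have Gzones: "integral {\<tau> 1..\<tau> N} G = (\<Sum>k=1..<N. integral {\<tau> k..\<tau> (Suc k)} G)"
      by (rule integral_chain[of \<tau>]) (use tau_mono N tau_ge0 tauN iG in auto)
    have gzones: "integral {\<tau> 1..\<tau> N} g = (\<Sum>k=1..<N. integral {\<tau> k..\<tau> (Suc k)} g)"
      by (rule integral_chain[of \<tau>]) (use tau_mono N tau_ge0 tauN ig in auto)
    have inner: "integral {\<tau> 1..\<tau> N} g \<le> 3 * A * (S + A * (L / N) * integral {0..1} G)"
    proof -
      have "integral {\<tau> 1..\<tau> N} g \<le> (\<Sum>k=1..<N. 3 * A * (\<sigma> k * (poly q (y k))\<^sup>2 + A * (L / N) * integral {\<tau> k..\<tau> (Suc k)} G))"
        unfolding gzones using tau_mono by (intro sum_mono mass) auto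
      also have "\<dots> = 3 * A * (S + A * (L / N) * integral {\<tau> 1..\<tau> N} G)"
        unfolding Gzones S_def by (simp only: sum.distrib sum_distrib_left distrib_left)
      also have "\<dots> \<le> 3 * A * (S + A * (L / N) * integral {0..1} G)"
        using G_tot A1 L Npos by (intro mult_left_mono add_left_mono) auto
      finally show ?thesis .
    qed
    have edge: "(a + 1) * integral {0..\<tau> 1} g \<le> S + (1 + A) * (L / N) * integral {0..1} G"
    proof -
      let ?e = "\<lambda>t. t powr (a + 1) * (2 * poly q t * poly (pderiv q) t)"
      have ie: "?e integrable_on {0..\<tau> 1}"
        using powr_poly_integrable_sub[of "a + 1" 0 "\<tau> 1" "smult 2 (q * pderiv q)"] a t1
        by (simp add: mult.assoc)
      \<comment> \<open>Since a + 1 > 0, the boundary term at 0 vanishes; the one at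
        \<open>\<tau> 1\<close> carries the weight \<open>\<sigma> 1\<close> and is controlled by
        the node of zone 1.\<close>
      have "((\<lambda>t. (a + 1) * g t + ?e t) has_integral
              (\<tau> 1 powr (a + 1) * (poly q (\<tau> 1))\<^sup>2 - 0 powr (a + 1) * (poly q 0)\<^sup>2)) {0..\<tau> 1}"
      proof (rule fundamental_theorem_of_calculus_interior)
        show "continuous_on {0..\<tau> 1} (\<lambda>t. t powr (a + 1) * (poly q t)\<^sup>2)"
          using a by (intro continuous_on_mult continuous_on_powr' continuous_intros) auto
        fix t assume t: "t \<in> {0<..<\<tau> 1}"
        have "((\<lambda>t. t powr (a + 1) * (poly q t)\<^sup>2) has_real_derivative (a + 1) * g t + ?e t) (at t)"
          using t by (auto intro!: derivative_eq_intros simp: g_def)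
        thus "((\<lambda>t. t powr (a + 1) * (poly q t)\<^sup>2) has_vector_derivative (a + 1) * g t + ?e t) (at t)"
          by (simp add: has_real_derivative_iff_has_vector_derivative)
      qed (rule tau_ge0)
      hence "integral {0..\<tau> 1} (\<lambda>t. (a + 1) * g t + ?e t) = \<tau> 1 powr (a + 1) * (poly q (\<tau> 1))\<^sup>2"
        using a by (simp add: integral_unique)
      moreover have "integral {0..\<tau> 1} (\<lambda>t. (a + 1) * g t + ?e t) = (a + 1) * integral {0..\<tau> 1} g + integral {0..\<tau> 1} ?e"
        using ig[of 0 "\<tau> 1"] t1 ie by (subst integral_add) (auto intro!: integrable_on_mult_right)
      moreover have "- integral {0..\<tau> 1} ?e \<le> L / N * integral {0..\<tau> 1} G"
      proof -
        have "integral {0..\<tau> 1} (\<lambda>t. - ?e t) \<le> integral {0..\<tau> 1} (\<lambda>t. L / N * G t)"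
        proof (rule integral_le)
          fix t assume t: "t \<in> {0..\<tau> 1}"
          \<comment> \<open>Here the bound 1 / N on sqrt t provides the small factor that
            \<open>\<sigma> k\<close> provides in the other zones.\<close>
          have st: "sqrt t \<le> 1 / N" using t Npos unfolding t1
            by (intro real_le_lsqrt) (auto simp: power_divide)
          have "- ?e t \<le> t powr (a + 1) * D t"
            using mult_left_mono[of "- (2 * poly q t * poly (pderiv q) t)" "D t" "t powr (a + 1)"]
            by (simp add: D_def mult.assoc)
          also have "\<dots> = sqrt t * (t powr a * sqrt t * D t)"
          proof (cases "t = 0")
            case False
            hence "t powr (a + 1) = t powr a * (sqrt t * sqrt t)" using t by (simp add: powr_add)
            thus ?thesis by simp
          qed simp
          also have "\<dots> \<le> 1 / N * (L * G t)"
            by (rule mult_mono) (use st t DG D0 in auto)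
          finally show "- ?e t \<le> L / N * G t" by simp
        qed (intro integrable_neg integrable_on_mult_right ie iG order_refl t1)+
        thus ?thesis by simp
      qed
      moreover have "\<tau> 1 powr (a + 1) * (poly q (\<tau> 1))\<^sup>2 \<le> S + A * (L / N) * integral {0..1} G"
      proof -
        have one: "(1::nat) \<in> {1..<N}" using N by auto
        have "\<tau> 1 powr (a + 1) = \<sigma> 1"
        proof -
          have "\<tau> 1 = (1 / N) powr 2" using Npos unfolding t1 by (simp add: power_divide)
          hence "\<tau> 1 powr (a + 1) = (1 / N) powr ((2 * a + 1) + 1)"
            by (simp only: powr_powr) (simp add: algebra_simps)
          thus ?thesis unfolding powr_add[of _ "2 * a + 1"] using Npos by (simp add: \<sigma>_def)
        qed
        moreover have "\<sigma> 1 * (poly q (\<tau> 1))\<^sup>2 \<le> \<sigma> 1 * (poly q (y 1))\<^sup>2 + A * (L / N) * integral {\<tau> 1..\<tau> (Suc 1)} G"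
          using var[OF one, of "\<tau> 1"] tau_mono[of 1] by auto
        moreover have "\<sigma> 1 * (poly q (y 1))\<^sup>2 \<le> S"
          unfolding S_def by (rule member_le_sum[OF one]) (use sig0 in auto)
        moreover have "integral {\<tau> 1..\<tau> (Suc 1)} G \<le> integral {0..1} G"
          by (rule integral_subset_le)
             (use tau_ge0 tau_le[of "Suc 1" N] N tauN iG G0 in auto)
        ultimately show ?thesis
          using mult_left_mono[of "integral {\<tau> 1..\<tau> (Suc 1)} G" "integral {0..1} G" "A * (L / N)"] A1 L by auto
      qed
      moreover have "L / N * integral {0..\<tau> 1} G \<le> L / N * integral {0..1} G"
        using G_tot L by (intro mult_left_mono) auto
      moreover have "(1 + A) * (L / N) * integral {0..1} G
          = L / N * integral {0..1} G + A * (L / N) * integral {0..1} G"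
        by (simp only: distrib_right mult_1_left)
      ultimately show ?thesis by linarith
    qed
    have S0: "S \<ge> 0" unfolding S_def by (intro sum_nonneg mult_nonneg_nonneg) (auto simp: sig0)
    have IG0: "integral {0..1} G \<ge> 0" by (rule integral_nonneg) (use iG G0 in auto)
    have "integral {0..1} g = integral {0..\<tau> 1} g + integral {\<tau> 1..\<tau> N} g"
      using ig[of 0 1] t1 tau_ge0[of 1] by (subst Henstock_Kurzweil_Integration.integral_combine) (auto simp: tauN)
    also have "\<dots> \<le> (S + (1 + A) * (L / N) * integral {0..1} G) / (a + 1) + 3 * A * (S + A * (L / N) * integral {0..1} G)"
      using edge inner a by (intro add_mono) (auto simp: pos_le_divide_eq mult.commute)
    also have "\<dots> = (3 * A + 1 / (a + 1)) * S + C * (L / N * integral {0..1} G)"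
      by (simp add: C_def power2_eq_square add_divide_distrib algebra_simps)
    also have "\<dots> \<le> C * S + C * (L / N * integral {0..1} G)"
    proof (intro add_right_mono mult_right_mono S0)
      have "A * 1 \<le> A * A" using A1 by (intro mult_left_mono) auto
      moreover have "1 / (a + 1) \<le> (1 + A) / (a + 1)" using A1 a by (intro divide_right_mono) auto
      ultimately show "3 * A + 1 / (a + 1) \<le> C" by (simp add: C_def power2_eq_square)
    qed
    also have "integral {0..1} G = integral {0..1} g + integral {0..1} (\<lambda>t. t powr (a + 1) * (poly (pderiv q) t)\<^sup>2) / L\<^sup>2"
    proof -
      have "integral {0..1} G = integral {0..1} (\<lambda>t. g t + t powr (a + 1) * (poly (pderiv q) t)\<^sup>2 / L\<^sup>2)"
        by (rule integral_cong) (auto simp: G_def g_def powr_add distrib_left powr_mult_base)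
      also have "\<dots> = integral {0..1} g + integral {0..1} (\<lambda>t. t powr (a + 1) * (poly (pderiv q) t)\<^sup>2 / L\<^sup>2)"
        using powr_poly_integrable[of "a + 1" "(pderiv q)\<^sup>2"] a
        by (intro integral_add ig integrable_on_divide) (auto simp: poly_power)
      finally show ?thesis by simp
    qed
    finally show "integral {0..1} (\<lambda>t. t powr a * (poly q t)\<^sup>2)
       \<le> C * (\<Sum>k=1..<N. (real k / real N) powr (2 * a + 1) / real N * (poly q (y k))\<^sup>2)
         + C * (L / real N) * (integral {0..1} (\<lambda>t. t powr a * (poly q t)\<^sup>2)
             + integral {0..1} (\<lambda>t. t powr (a + 1) * (poly (pderiv q) t)\<^sup>2) / L\<^sup>2)"
      by (simp add: g_def S_def \<sigma>_def mult.assoc)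
  qed
qed

section \<open>The Jacobi measure\<close>

locale jacobi =
  fixes \<alpha> \<beta> :: real
  assumes al: "\<alpha> > -1" and be: "\<beta> > -1"
begin

abbreviation M where "M \<equiv> jacobi_measure \<alpha> \<beta>"

definition w where "w x = (1 - x) powr \<alpha> * (1 + x) powr \<beta>"

lemma w_nonneg: "w x \<ge> 0" by (simp add: w_def)

lemma w_borel [measurable]: "w \<in> borel_measurable borel"
  unfolding w_def[abs_def] by measurable

text \<open>The map t = (1 + x) / 2 turns w, up to the factor 2^(alpha + beta), into the integrand
  of a Beta integral.\<close>

lemma w_integrable: "set_integrable lborel {-1..1} w"
proof -
  let ?f = "\<lambda>t. t powr \<beta> * (1 - t) powr \<alpha>"
  have "set_integrable lborel {0..1} ?f"
    using integrable_Beta[of "\<beta> + 1" "\<alpha> + 1"] al be by simp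
  hence "integrable lborel (\<lambda>x. indicator {0..1} (1/2 + 1/2 * x) *\<^sub>R ?f (1/2 + 1/2 * x))"
    unfolding set_integrable_def by (intro lborel_integrable_real_affine) auto
  hence "integrable lborel (\<lambda>x. 2 powr (\<alpha> + \<beta>) * (indicator {0..1} (1/2 + 1/2 * x) *\<^sub>R ?f (1/2 + 1/2 * x)))"
    by simp
  also have "(\<lambda>x. 2 powr (\<alpha> + \<beta>) * (indicator {0..1} (1/2 + 1/2 * x) *\<^sub>R ?f (1/2 + 1/2 * x)))
     = (\<lambda>x. indicator {-1..1} x *\<^sub>R w x)"
  proof
    fix x :: real
    show "2 powr (\<alpha> + \<beta>) * (indicator {0..1} (1/2 + 1/2 * x) *\<^sub>R ?f (1/2 + 1/2 * x)) = indicator {-1..1} x *\<^sub>R w x"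
    proof (cases "x \<in> {-1..1}")
      case True
      have e: "1/2 + 1/2 * x = (1 + x) / 2" "1 - (1/2 + 1/2 * x) = (1 - x) / 2"
        by (simp_all add: field_simps)
      have "?f (1/2 + 1/2 * x) = (1 + x) powr \<beta> / 2 powr \<beta> * ((1 - x) powr \<alpha> / 2 powr \<alpha>)"
        unfolding e(2) unfolding e(1) using True by (simp add: powr_divide)
      thus ?thesis using True by (simp add: w_def powr_add indicator_def)
    qed (auto simp: indicator_def)
  qed
  finally show ?thesis by (simp add: set_integrable_def)
qed

definition Z where "Z = (LINT x:{-1..1}|lborel. w x)"

text \<open>An integral 0 of the integrable w >= 0 would make w vanish almost everywhere, but on
  [-1,1] it vanishes only at the endpoints.\<close>

lemma Z_pos: "Z > 0"
proof (rule ccontr)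
  assume "\<not> Z > 0"
  moreover have "Z \<ge> 0" unfolding Z_def set_lebesgue_integral_def by (simp add: w_nonneg)
  ultimately have "Z = 0" by simp
  hence "AE x in lborel. indicator {-1..1} x *\<^sub>R w x = 0"
    using integral_nonneg_eq_0_iff_AE[OF w_integrable[unfolded set_integrable_def]] w_nonneg
    by (simp add: Z_def set_lebesgue_integral_def)
  moreover have "AE x in lborel. x \<noteq> 1" "AE x in lborel. x \<noteq> (-1::real)"
    by (rule AE_lborel_singleton)+
  ultimately have "AE x in lborel. x \<notin> {-1..1::real}"
  proof eventually_elim
    case (elim x)
    thus ?case by (auto simp: w_def indicator_def split: if_splits)
  qed
  hence "emeasure lborel {x. \<not> x \<notin> {-1..1::real}} = 0"
    by (subst (asm) AE_iff_measurable[OF _ refl]) auto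
  moreover have "{x. \<not> x \<notin> {-1..1::real}} = {-1..1}" by auto
  ultimately show False by simp
qed

lemma const_eq: "jacobi_const \<alpha> \<beta> = 1 / Z"
  by (simp add: jacobi_const_def Z_def w_def[abs_def] divide_inverse)

lemma weight_eq: "jacobi_weight \<alpha> \<beta> x = w x / Z"
  by (simp add: jacobi_weight_def const_eq w_def)

lemma weight_borel [measurable]: "(\<lambda>x. ennreal (w x / Z)) \<in> borel_measurable borel"
  by measurable

lemma M_eq: "M = density (restrict_space lborel {-1..1}) (\<lambda>x. ennreal (w x / Z))"
  by (simp add: jacobi_measure_def weight_eq)

lemma space_M: "space M = {-1..1}" by (simp add: M_eq)

lemma sets_M: "sets M = sets (restrict_space borel {-1..1})"
  by (simp add: M_eq sets_restrict_space)

lemma borel_M [measurable (raw)]: "f \<in> borel_measurable borel \<Longrightarrow> f \<in> borel_measurable M"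
  by (simp add: M_eq measurable_restrict_space1)

lemma id_M: "(\<lambda>x. x) \<in> M \<rightarrow>\<^sub>M borel" by (rule borel_M) auto

lemma sets_M_I: "A \<in> sets borel \<Longrightarrow> A \<inter> {-1..1} \<in> sets M"
  unfolding sets_M by (auto simp: sets_restrict_space)

lemma nn_M:
  assumes [measurable]: "f \<in> borel_measurable borel"
  shows "(\<integral>\<^sup>+x. f x \<partial>M) = (\<integral>\<^sup>+x. ennreal (w x / Z) * f x * indicator {-1..1} x \<partial>lborel)"
  unfolding M_eq
  by (subst nn_integral_density)
     (auto simp: nn_integral_restrict_space measurable_restrict_space1)

lemma prob_M: "prob_space M"
proof
  have "emeasure M (space M) = (\<integral>\<^sup>+x. 1 \<partial>M)" by simp
  also have "\<dots> = (\<integral>\<^sup>+x. ennreal (indicator {-1..1} x *\<^sub>R w x / Z) \<partial>lborel)"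
    by (subst nn_M) (auto intro!: nn_integral_cong simp: indicator_def)
  also have "\<dots> = ennreal (\<integral>x. indicator {-1..1} x *\<^sub>R w x / Z \<partial>lborel)"
    using w_integrable Z_pos w_nonneg unfolding set_integrable_def
    by (intro nn_integral_eq_integral) auto
  also have "(\<integral>x. indicator {-1..1} x *\<^sub>R w x / Z \<partial>lborel) = 1"
    using Z_pos by (simp add: Z_def set_lebesgue_integral_def)
  finally show "emeasure M (space M) = 1" by simp
qed

sublocale prob_space M by (rule prob_M)

lemma integrable_M:
  assumes "continuous_on UNIV (f :: real \<Rightarrow> real)"
  shows "integrable M f"
proof -
  have "bounded (f ` {-1..1})"
    by (intro compact_imp_bounded compact_continuous_image continuous_on_subset[OF assms]) auto
  then obtain B where "\<forall>x\<in>{-1..1}. norm (f x) \<le> B" by (auto simp: bounded_iff)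
  thus ?thesis
    using borel_measurable_continuous_onI[OF assms]
    by (intro integrable_const_bound[where B = B]) (auto simp: space_M)
qed

lemma integrable_poly: "integrable M (poly p)"
  by (rule integrable_M) (intro continuous_intros)

lemma w_integrable_mult:
  assumes "continuous_on UNIV (f :: real \<Rightarrow> real)" "{u..v} \<subseteq> {-1..1}"
  shows "set_integrable lborel {u..v} (\<lambda>x. w x * f x)"
proof -
  have "bounded (f ` {-1..1})"
    by (intro compact_imp_bounded compact_continuous_image continuous_on_subset[OF assms(1)]) auto
  then obtain B where B: "\<forall>x\<in>{-1..1}. norm (f x) \<le> B" by (auto simp: bounded_iff)
  have [measurable]: "f \<in> borel_measurable borel"
    using borel_measurable_continuous_onI[OF assms(1)] .
  have "set_integrable lborel {-1..1} (\<lambda>x. w x * f x)"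
    unfolding set_integrable_def
  proof (rule Bochner_Integration.integrable_bound)
    show "integrable lborel (\<lambda>x. B * (indicator {-1..1} x *\<^sub>R w x))"
      using w_integrable unfolding set_integrable_def by simp
    show "AE x in lborel. norm (indicator {-1..1} x *\<^sub>R (w x * f x)) \<le> norm (B * (indicator {-1..1} x *\<^sub>R w x))"
    proof (intro AE_I2)
      fix x :: real
      show "norm (indicator {-1..1} x *\<^sub>R (w x * f x)) \<le> norm (B * (indicator {-1..1} x *\<^sub>R w x))"
      proof (cases "x \<in> {-1..1}")
        case True
        hence "\<bar>f x\<bar> \<le> \<bar>B\<bar>" using B by force
        thus ?thesis using True mult_right_mono[of "\<bar>f x\<bar>" "\<bar>B\<bar>" "\<bar>w x\<bar>"] by (simp add: abs_mult mult.commute)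
      qed auto
    qed
  qed auto
  thus ?thesis by (rule set_integrable_subset) (use assms in auto)
qed

lemma integral_M:
  assumes "continuous_on UNIV (f :: real \<Rightarrow> real)"
  shows "(LINT x|M. f x) = (LINT x:{-1..1}|lborel. w x * f x) / Z"
proof -
  have [measurable]: "f \<in> borel_measurable borel"
    using borel_measurable_continuous_onI[OF assms] .
  have "(LINT x|M. f x) = (LINT x|restrict_space lborel {-1..1}. (w x / Z) *\<^sub>R f x)"
    unfolding M_eq using Z_pos
    by (intro integral_density) (auto simp: measurable_restrict_space1 w_nonneg)
  also have "\<dots> = (LINT x:{-1..1}|lborel. w x * f x / Z)"
    by (simp add: integral_restrict_space set_lebesgue_integral_def)
  finally show ?thesis by simp
qed

lemma integral_M_HK:
  assumes "continuous_on UNIV (f :: real \<Rightarrow> real)"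
  shows "(LINT x|M. f x) = integral {-1..1} (\<lambda>x. w x * f x) / Z"
  unfolding integral_M[OF assms] using w_integrable_mult[OF assms, of "-1" 1]
  by (simp add: set_borel_integral_eq_integral)

text \<open>The integrand times w is the derivative of (1 - x)^(alpha + 1) (1 + x)^(beta + 1) g,
  which vanishes at both endpoints because the exponents are positive.\<close>

lemma pearson:
  fixes g :: "real poly"
  shows "(LINT x|M. poly ([:1, 0, -1:] * pderiv g + [:\<beta> - \<alpha>, -(\<alpha> + \<beta> + 2):] * g) x) = 0"
proof -
  define h where "h = [:1, 0, -1:] * pderiv g + [:\<beta> - \<alpha>, -(\<alpha> + \<beta> + 2):] * g"
  let ?F = "\<lambda>x. (1 - x) powr (\<alpha> + 1) * (1 + x) powr (\<beta> + 1) * poly g x"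
  have "((\<lambda>x. w x * poly h x) has_integral (?F 1 - ?F (-1))) {-1..1}"
  \<comment> \<open>The interior form, since w may be unbounded at the endpoints.\<close>
  proof (rule fundamental_theorem_of_calculus_interior)
    show "continuous_on {-1..1} ?F"
      using al be by (intro continuous_on_mult continuous_on_powr' continuous_intros) auto
    fix x :: real assume x: "x \<in> {-1<..<1}"
    have e: "(1 - x) powr (\<alpha> + 1) = (1 - x) powr \<alpha> * (1 - x)" "(1 + x) powr (\<beta> + 1) = (1 + x) powr \<beta> * (1 + x)"
      using x by (auto simp: powr_add)
    have "(?F has_real_derivative
        (- ((\<alpha> + 1) * (1 - x) powr \<alpha> * (1 + x) powr (\<beta> + 1)) + (1 - x) powr (\<alpha> + 1) * ((\<beta> + 1) * (1 + x) powr \<beta>)) * poly g x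
        + (1 - x) powr (\<alpha> + 1) * (1 + x) powr (\<beta> + 1) * poly (pderiv g) x) (at x)"
      using x by (auto intro!: derivative_eq_intros)
    also have "(- ((\<alpha> + 1) * (1 - x) powr \<alpha> * (1 + x) powr (\<beta> + 1)) + (1 - x) powr (\<alpha> + 1) * ((\<beta> + 1) * (1 + x) powr \<beta>)) * poly g x
        + (1 - x) powr (\<alpha> + 1) * (1 + x) powr (\<beta> + 1) * poly (pderiv g) x = w x * poly h x"
      unfolding e by (simp add: w_def h_def algebra_simps)
    finally show "(?F has_vector_derivative w x * poly h x) (at x)"
      by (simp add: has_real_derivative_iff_has_vector_derivative)
  qed auto
  hence "integral {-1..1} (\<lambda>x. w x * poly h x) = 0" using al be by (simp add: integral_unique)
  thus ?thesis unfolding h_def[symmetric]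
    by (subst integral_M_HK) (auto intro!: continuous_intros)
qed

sublocale pf: pearson_functional \<alpha> \<beta> "\<lambda>p. LINT x|M. poly p x"
proof
  show "\<alpha> > -1" "\<beta> > -1" by (rule al be)+
qed (use pearson integrable_poly in auto)

lemma bernstein_M:
  assumes "degree p \<le> m"
  shows "(LINT x|M. (1 - x\<^sup>2) * (poly (pderiv p) x)\<^sup>2)
    \<le> real m * (real m + \<alpha> + \<beta> + 1) * (LINT x|M. (poly p x)\<^sup>2)"
proof -
  have "poly ([:1, 0, -1:] * (pderiv p * pderiv p)) x = (1 - x\<^sup>2) * (poly (pderiv p) x)\<^sup>2" for x
    by (simp add: power2_eq_square algebra_simps)
  moreover have "poly (p * p) x = (poly p x)\<^sup>2" for x by (simp add: power2_eq_square)
  ultimately show ?thesis using pf.bernstein[OF assms] unfolding pf.en_def by presburger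
qed

section \<open>Reflection x -> -x, exchanging alpha and beta\<close>

lemma reflect_w: "jacobi.w \<beta> \<alpha> x = w (-x)"
proof -
  interpret r: jacobi \<beta> \<alpha> using al be by unfold_locales
  show ?thesis by (simp add: w_def r.w_def mult.commute)
qed

lemma reflect_Z: "jacobi.Z \<beta> \<alpha> = Z"
proof -
  interpret r: jacobi \<beta> \<alpha> using al be by unfold_locales
  show ?thesis unfolding Z_def r.Z_def set_lebesgue_integral_def
    by (subst lborel_integral_real_affine[where c = "-1" and t = 0])
       (auto simp: reflect_w indicator_def intro!: Bochner_Integration.integral_cong)
qed

lemma reflect_nn:
  assumes [measurable]: "f \<in> borel_measurable borel"
  shows "(\<integral>\<^sup>+x. f x \<partial>jacobi_measure \<beta> \<alpha>) = (\<integral>\<^sup>+x. f (-x) \<partial>M)"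
proof -
  interpret r: jacobi \<beta> \<alpha> using al be by unfold_locales
  show ?thesis
    by (subst r.nn_M, simp, subst nn_M, simp, subst nn_integral_real_affine[where c = "-1" and t = 0])
       (auto simp: reflect_w reflect_Z indicator_def intro!: nn_integral_cong)
qed

lemma reflect_emeasure:
  assumes "A \<in> sets borel"
  shows "emeasure (jacobi_measure \<beta> \<alpha>) (A \<inter> {-1..1}) = emeasure M ((uminus -` A) \<inter> {-1..1})"
proof -
  interpret r: jacobi \<beta> \<alpha> using al be by unfold_locales
  have 1: "uminus -` A \<in> sets borel"
    using assms measurable_sets[of uminus borel borel A] by simp
  have "emeasure (jacobi_measure \<beta> \<alpha>) (A \<inter> {-1..1}) = (\<integral>\<^sup>+x. indicator (A \<inter> {-1..1}) x \<partial>jacobi_measure \<beta> \<alpha>)"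
    using r.sets_M_I[OF assms] by simp
  also have "\<dots> = (\<integral>\<^sup>+x. indicator (A \<inter> {-1..1}) (-x) \<partial>M)"
    using assms by (intro reflect_nn) auto
  also have "\<dots> = (\<integral>\<^sup>+x. indicator ((uminus -` A) \<inter> {-1..1}) x \<partial>M)"
    by (intro nn_integral_cong) (auto simp: indicator_def)
  also have "\<dots> = emeasure M ((uminus -` A) \<inter> {-1..1})"
    using sets_M_I[OF 1] by simp
  finally show ?thesis .
qed


text \<open>The half integral at the endpoint 1 in the variable t = 1 - x, without the factor (1 +
  x)^beta, which lies between 2^(-|beta|) and 2^|beta|; only the pure power t^alpha remains.\<close>

definition right_int where "right_int F = integral {0..1} (\<lambda>t. t powr \<alpha> * poly F (1 - t))"

lemma right_int_integrable:
  fixes F :: "real poly"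
  shows "(\<lambda>t. t powr \<alpha> * poly F (1 - t)) integrable_on {0..1}"
  using powr_poly_integrable[OF al, of "pcompose F [:1,-1:]"] by (simp add: poly_pcompose)

lemma w_right_bounds:
  assumes "x \<in> {0..1}"
  shows "2 powr (-\<bar>\<beta>\<bar>) * (1 - x) powr \<alpha> \<le> w x" "w x \<le> 2 powr \<bar>\<beta>\<bar> * (1 - x) powr \<alpha>"
proof -
  have x: "1 \<le> 1 + x" "1 + x \<le> 2" using assms by auto
  have "(1 + x) powr \<beta> \<le> (1 + x) powr \<bar>\<beta>\<bar>" using x by (intro powr_mono) auto
  also have "\<dots> \<le> 2 powr \<bar>\<beta>\<bar>" using x by (intro powr_mono2) auto
  finally show "w x \<le> 2 powr \<bar>\<beta>\<bar> * (1 - x) powr \<alpha>"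
    unfolding w_def by (subst mult.commute) (intro mult_right_mono, auto)
  have "2 powr (-\<bar>\<beta>\<bar>) \<le> (1 + x) powr (-\<bar>\<beta>\<bar>)" using x by (intro powr_mono2') auto
  also have "\<dots> \<le> (1 + x) powr \<beta>" using x by (intro powr_mono) auto
  finally show "2 powr (-\<bar>\<beta>\<bar>) * (1 - x) powr \<alpha> \<le> w x"
    unfolding w_def by (subst (2) mult.commute) (intro mult_right_mono, auto)
qed

lemma w_HK_integrable:
  fixes F :: "real poly"
  assumes "{u..v} \<subseteq> {-1..1}"
  shows "(\<lambda>x. w x * poly F x) integrable_on {u..v}"
  by (intro set_borel_integral_eq_integral(1) w_integrable_mult assms continuous_intros)

lemma right_half_bounds:
  fixes F :: "real poly"
  assumes F: "\<And>x. x \<in> {-1..1} \<Longrightarrow> poly F x \<ge> 0"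
  shows "2 powr (-\<bar>\<beta>\<bar>) * right_int F \<le> integral {0..1} (\<lambda>x. w x * poly F x)"
    and "integral {0..1} (\<lambda>x. w x * poly F x) \<le> 2 powr \<bar>\<beta>\<bar> * right_int F"
proof -
  let ?g = "\<lambda>x. (1 - x) powr \<alpha> * poly F x"
  have "((\<lambda>t. t powr \<alpha> * poly F (1 - t)) has_integral right_int F) (cbox 0 1)"
    using right_int_integrable[of F] by (simp add: right_int_def integrable_integral)
  from has_integral_affinity[OF this, of "-1" 1]
  have "(?g has_integral right_int F) ((\<lambda>x. 1 - x) ` {0..1})"
    by simp
  also have "(\<lambda>x. 1 - x) ` {0..1::real} = {0..1}"
    by (force simp: image_iff intro: bexI[of _ "1 - _"])
  finally have g: "(?g has_integral right_int F) {0..1}" .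
  have i: "((\<lambda>x. w x * poly F x) has_integral integral {0..1} (\<lambda>x. w x * poly F x)) {0..1}"
    by (intro integrable_integral w_HK_integrable) auto
  have "2 powr (-\<bar>\<beta>\<bar>) * ?g x \<le> w x * poly F x" if "x \<in> {0..1}" for x
    using mult_right_mono[OF w_right_bounds(1)[OF that], of "poly F x"] that F[of x] by (auto simp: mult.assoc)
  thus "2 powr (-\<bar>\<beta>\<bar>) * right_int F \<le> integral {0..1} (\<lambda>x. w x * poly F x)"
    by (rule has_integral_le[OF has_integral_mult_right[OF g] i])
  have "w x * poly F x \<le> 2 powr \<bar>\<beta>\<bar> * ?g x" if "x \<in> {0..1}" for x
    using mult_right_mono[OF w_right_bounds(2)[OF that], of "poly F x"] that F[of x] by (auto simp: mult.assoc)
  thus "integral {0..1} (\<lambda>x. w x * poly F x) \<le> 2 powr \<bar>\<beta>\<bar> * right_int F"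
    by (rule has_integral_le[OF i has_integral_mult_right[OF g]])
qed

lemma flip: "jacobi \<beta> \<alpha>"
  using al be by unfold_locales

text \<open>The left half is reflected onto [0,1], where it belongs to the exchanged parameters;
  one-sided estimates at 1 then cover both endpoints.\<close>

lemma integral_M_halves:
  fixes F :: "real poly"
  shows "(LINT x|M. poly F x) * Z = integral {0..1} (\<lambda>x. w x * poly F x)
    + integral {0..1} (\<lambda>x. jacobi.w \<beta> \<alpha> x * poly (pcompose F [:0,-1:]) x)"
proof -
  have "integral {0..1} (\<lambda>x. jacobi.w \<beta> \<alpha> x * poly (pcompose F [:0,-1:]) x)
      = integral {-0..-(-1::real)} (\<lambda>x. w (-x) * poly F (-x))"
    by (simp add: reflect_w poly_pcompose)
  also have "\<dots> = integral {-1..0} (\<lambda>x. w x * poly F x)"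
    by (rule Henstock_Kurzweil_Integration.integral_reflect_real)
  moreover have "integral {-1..0} (\<lambda>x. w x * poly F x) + integral {0..1} (\<lambda>x. w x * poly F x)
      = integral {-1..1} (\<lambda>x. w x * poly F x)"
    by (rule Henstock_Kurzweil_Integration.integral_combine) (auto intro: w_HK_integrable)
  ultimately show ?thesis
    using Z_pos by (subst integral_M_HK) (auto intro!: continuous_intros)
qed

lemma right_half_nonneg:
  fixes F :: "real poly"
  assumes "\<And>x. x \<in> {-1..1} \<Longrightarrow> poly F x \<ge> 0"
  shows "integral {0..1} (\<lambda>x. w x * poly F x) \<ge> 0"
  by (rule integral_nonneg) (use assms w_HK_integrable in \<open>auto simp: w_nonneg\<close>)

lemma right_int_le:
  fixes F :: "real poly"
  assumes F: "\<And>x. x \<in> {-1..1} \<Longrightarrow> poly F x \<ge> 0"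
  shows "right_int F \<le> 2 powr \<bar>\<beta>\<bar> * Z * (LINT x|M. poly F x)"
proof -
  interpret r: jacobi \<beta> \<alpha> by (rule flip)
  have "2 powr (-\<bar>\<beta>\<bar>) * right_int F \<le> Z * (LINT x|M. poly F x)"
    using right_half_bounds(1)[OF F] r.right_half_nonneg[of "pcompose F [:0,-1:]"] F
    unfolding mult.commute[of Z] integral_M_halves by (force simp: poly_pcompose)
  hence "2 powr \<bar>\<beta>\<bar> * (2 powr (-\<bar>\<beta>\<bar>) * right_int F) \<le> 2 powr \<bar>\<beta>\<bar> * (Z * (LINT x|M. poly F x))"
    by (intro mult_left_mono) auto
  thus ?thesis by (simp add: powr_minus field_simps)
qed

lemma right_int_nonneg:
  fixes F :: "real poly"
  assumes "\<And>x. x \<in> {-1..1} \<Longrightarrow> poly F x \<ge> 0"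
  shows "right_int F \<ge> 0"
  unfolding right_int_def by (rule integral_nonneg[OF right_int_integrable]) (use assms in auto)

lemma left_int_le:
  fixes F :: "real poly"
  assumes F: "\<And>x. x \<in> {-1..1} \<Longrightarrow> poly F x \<ge> 0"
  shows "jacobi.right_int \<beta> (pcompose F [:0,-1:]) \<le> 2 powr \<bar>\<alpha>\<bar> * Z * (LINT x|M. poly F x)"
proof -
  interpret r: jacobi \<beta> \<alpha> by (rule flip)
  have "(LINT x|r.M. poly (pcompose F [:0,-1:]) x) * r.Z = (LINT x|M. poly F x) * Z"
    unfolding r.integral_M_halves integral_M_halves by (simp add: poly_pcompose)
  moreover have "r.right_int (pcompose F [:0,-1:])
      \<le> 2 powr \<bar>\<alpha>\<bar> * ((LINT x|r.M. poly (pcompose F [:0,-1:]) x) * r.Z)"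
    using r.right_int_le[of "pcompose F [:0,-1:]"] F by (simp add: poly_pcompose mult_ac)
  ultimately show ?thesis by (simp only: mult_ac)
qed

lemma integral_M_le:
  fixes F :: "real poly"
  assumes F: "\<And>x. x \<in> {-1..1} \<Longrightarrow> poly F x \<ge> 0"
  shows "(LINT x|M. poly F x) * Z \<le> 2 powr \<bar>\<beta>\<bar> * right_int F
    + 2 powr \<bar>\<alpha>\<bar> * jacobi.right_int \<beta> (pcompose F [:0,-1:])"
proof -
  interpret r: jacobi \<beta> \<alpha> by (rule flip)
  show ?thesis
    unfolding integral_M_halves using F
    by (intro add_mono right_half_bounds(2) r.right_half_bounds(2)) (auto simp: poly_pcompose)
qed

lemma right_quadrature:
  shows "\<exists>C>0. \<forall>(p::real poly) L N (y::nat \<Rightarrow> real). L > 0 \<longrightarrow> N \<ge> (2::nat) \<longrightarrow>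
     (\<forall>k\<in>{1..<N}. 1 - y k \<in> {(real k / real N)\<^sup>2..(real (Suc k) / real N)\<^sup>2}) \<longrightarrow>
     right_int (p\<^sup>2)
       \<le> C * (\<Sum>k=1..<N. (real k / real N) powr (2 * \<alpha> + 1) / real N * (poly p (y k))\<^sup>2)
         + C * (L / real N) * (right_int (p\<^sup>2) + right_int ([:1,0,-1:] * (pderiv p)\<^sup>2) / L\<^sup>2)"
proof -
  obtain C where C: "C > 0" and H: "\<And>(q::real poly) L N (y::nat \<Rightarrow> real). L > 0 \<Longrightarrow> N \<ge> (2::nat) \<Longrightarrow>
     (\<forall>k\<in>{1..<N}. y k \<in> {(real k / real N)\<^sup>2..(real (Suc k) / real N)\<^sup>2}) \<Longrightarrow>
     integral {0..1} (\<lambda>t. t powr \<alpha> * (poly q t)\<^sup>2)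
       \<le> C * (\<Sum>k=1..<N. (real k / real N) powr (2 * \<alpha> + 1) / real N * (poly q (y k))\<^sup>2)
         + C * (L / real N) * (integral {0..1} (\<lambda>t. t powr \<alpha> * (poly q t)\<^sup>2)
             + integral {0..1} (\<lambda>t. t powr (\<alpha> + 1) * (poly (pderiv q) t)\<^sup>2) / L\<^sup>2)"
    using half_interval_quadrature[OF al] by blast
  show ?thesis
  proof (intro exI[of _ C] conjI C allI impI)
    fix p :: "real poly" and L :: real and N :: nat and y :: "nat \<Rightarrow> real"
    assume L: "L > 0" and N: "N \<ge> 2"
      and y: "\<forall>k\<in>{1..<N}. 1 - y k \<in> {(real k / real N)\<^sup>2..(real (Suc k) / real N)\<^sup>2}"
    let ?q = "pcompose p [:1,-1:]"
    have dq: "poly (pderiv ?q) t = - poly (pderiv p) (1 - t)" for t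
      by (simp add: pderiv_pcompose poly_pcompose pderiv_pCons)
    have q: "integral {0..1} (\<lambda>t. t powr \<alpha> * (poly ?q t)\<^sup>2) = right_int (p\<^sup>2)"
      by (simp add: right_int_def poly_pcompose poly_power)
    have "integral {0..1} (\<lambda>t. t powr (\<alpha> + 1) * (poly (pderiv ?q) t)\<^sup>2)
        \<le> right_int ([:1,0,-1:] * (pderiv p)\<^sup>2)"
      unfolding right_int_def
    proof (rule integral_le)
      show "(\<lambda>t. t powr (\<alpha> + 1) * (poly (pderiv ?q) t)\<^sup>2) integrable_on {0..1}"
        using powr_poly_integrable[of "\<alpha> + 1" "(pderiv ?q)\<^sup>2"] al by (simp add: poly_power)
      fix t :: real assume t: "t \<in> {0..1}"
      \<comment> \<open>With x = 1 - t, the factor t is at most t (2 - t) = 1 - x^2, the factor in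
        the Jacobi energy.\<close>
      have "t * 1 \<le> t * (2 - t)" using t by (intro mult_left_mono) auto
      hence "t * (poly (pderiv p) (1 - t))\<^sup>2 \<le> (t * (2 - t)) * (poly (pderiv p) (1 - t))\<^sup>2"
        by (intro mult_right_mono) auto
      hence "t powr \<alpha> * (t * (poly (pderiv p) (1 - t))\<^sup>2) \<le> t powr \<alpha> * ((t * (2 - t)) * (poly (pderiv p) (1 - t))\<^sup>2)"
        by (intro mult_left_mono) auto
      moreover have "poly ([:1,0,-1:] * (pderiv p)\<^sup>2) (1 - t) = (t * (2 - t)) * (poly (pderiv p) (1 - t))\<^sup>2"
        by (simp add: poly_power algebra_simps)
      moreover have "t powr (\<alpha> + 1) = t powr \<alpha> * t" using t by (simp add: powr_add powr_mult_base)
      ultimately show "t powr (\<alpha> + 1) * (poly (pderiv ?q) t)\<^sup>2 \<le> t powr \<alpha> * poly ([:1,0,-1:] * (pderiv p)\<^sup>2) (1 - t)"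
        unfolding dq by (simp add: mult.assoc)
    qed (rule right_int_integrable)
    hence "C * (L / N) * (right_int (p\<^sup>2) + integral {0..1} (\<lambda>t. t powr (\<alpha> + 1) * (poly (pderiv ?q) t)\<^sup>2) / L\<^sup>2)
      \<le> C * (L / N) * (right_int (p\<^sup>2) + right_int ([:1,0,-1:] * (pderiv p)\<^sup>2) / L\<^sup>2)"
      using C L by (intro mult_left_mono add_left_mono divide_right_mono) auto
    with H[OF L N y, of ?q] show "right_int (p\<^sup>2)
       \<le> C * (\<Sum>k=1..<N. (real k / real N) powr (2 * \<alpha> + 1) / real N * (poly p (y k))\<^sup>2)
         + C * (L / real N) * (right_int (p\<^sup>2) + right_int ([:1,0,-1:] * (pderiv p)\<^sup>2) / L\<^sup>2)"
      unfolding q by (simp add: poly_pcompose)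
  qed
qed

text \<open>A Marcinkiewicz--Zygmund inequality: the derivative term is absorbed by Bernstein's inequality.\<close>

lemma quadrature:
  "\<exists>C>0. \<exists>D>0. \<forall>(p::real poly) m N (y::nat \<Rightarrow> real) z. degree p \<le> m \<longrightarrow> N \<ge> (2::nat) \<longrightarrow>
     real N \<ge> D * (real m + 1) \<longrightarrow>
     (\<forall>k\<in>{1..<N}. 1 - y k \<in> {(real k / real N)\<^sup>2..(real (Suc k) / real N)\<^sup>2}) \<longrightarrow>
     (\<forall>k\<in>{1..<N}. 1 + z k \<in> {(real k / real N)\<^sup>2..(real (Suc k) / real N)\<^sup>2}) \<longrightarrow>
     (LINT x|M. (poly p x)\<^sup>2)
       \<le> C * ((\<Sum>k=1..<N. (real k / real N) powr (2 * \<alpha> + 1) / real N * (poly p (y k))\<^sup>2)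
            + (\<Sum>k=1..<N. (real k / real N) powr (2 * \<beta> + 1) / real N * (poly p (z k))\<^sup>2))"
proof -
  interpret r: jacobi \<beta> \<alpha> by (rule flip)
  obtain C1 where C1: "C1 > 0" and H1: "\<And>(p::real poly) L N (y::nat \<Rightarrow> real). L > 0 \<Longrightarrow> N \<ge> (2::nat) \<Longrightarrow>
     (\<forall>k\<in>{1..<N}. 1 - y k \<in> {(real k / real N)\<^sup>2..(real (Suc k) / real N)\<^sup>2}) \<Longrightarrow>
     right_int (p\<^sup>2)
       \<le> C1 * (\<Sum>k=1..<N. (real k / real N) powr (2 * \<alpha> + 1) / real N * (poly p (y k))\<^sup>2)
         + C1 * (L / real N) * (right_int (p\<^sup>2) + right_int ([:1,0,-1:] * (pderiv p)\<^sup>2) / L\<^sup>2)"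
    using right_quadrature by blast
  obtain C2 where C2: "C2 > 0" and H2: "\<And>(p::real poly) L N (y::nat \<Rightarrow> real). L > 0 \<Longrightarrow> N \<ge> (2::nat) \<Longrightarrow>
     (\<forall>k\<in>{1..<N}. 1 - y k \<in> {(real k / real N)\<^sup>2..(real (Suc k) / real N)\<^sup>2}) \<Longrightarrow>
     r.right_int (p\<^sup>2)
       \<le> C2 * (\<Sum>k=1..<N. (real k / real N) powr (2 * \<beta> + 1) / real N * (poly p (y k))\<^sup>2)
         + C2 * (L / real N) * (r.right_int (p\<^sup>2) + r.right_int ([:1,0,-1:] * (pderiv p)\<^sup>2) / L\<^sup>2)"
    using r.right_quadrature by blast
  define A where "A = 2 powr (\<bar>\<alpha>\<bar> + \<bar>\<beta>\<bar>)"
  have A: "A \<ge> 1" "2 powr \<bar>\<beta>\<bar> \<le> A" "2 powr \<bar>\<alpha>\<bar> \<le> A"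
    unfolding A_def by (auto intro!: powr_mono ge_one_powr_ge_zero)
  \<comment> \<open>The maximum guards against a negative alpha + beta + 1; Bernstein's factor is
    then at most Cb (m + 1)^2.\<close>
  define Cb where "Cb = 1 + max 0 (\<alpha> + \<beta> + 1)"
  have Cb: "Cb \<ge> 1" "\<alpha> + \<beta> + 1 \<le> Cb" by (auto simp: Cb_def)
  define E where "E = A * Z * (1 + Cb)"
  have E: "E > 0" unfolding E_def using A Z_pos Cb by (intro mult_pos_pos) auto
  \<comment> \<open>Chosen so that N >= D (m + 1) makes the error term at most Z / 2 times the
    squared norm, half of the left-hand side.\<close>
  define D where "D = 2 * A * (C1 + C2) * E / Z"
  have D: "D > 0" unfolding D_def using A Z_pos E C1 C2 by (intro divide_pos_pos mult_pos_pos) auto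
  define C where "C = 2 * A * (C1 + C2) / Z"
  have C: "C > 0" unfolding C_def using A Z_pos C1 C2 by (intro divide_pos_pos mult_pos_pos) auto
  show ?thesis
  proof (rule exI[of _ C], rule conjI[OF C], rule exI[of _ D], rule conjI[OF D], intro allI impI)
    fix p :: "real poly" and m N :: nat and y z :: "nat \<Rightarrow> real"
    assume p: "degree p \<le> m" and N: "N \<ge> 2" and ND: "real N \<ge> D * (real m + 1)"
      and y: "\<forall>k\<in>{1..<N}. 1 - y k \<in> {(real k / real N)\<^sup>2..(real (Suc k) / real N)\<^sup>2}"
      and z: "\<forall>k\<in>{1..<N}. 1 + z k \<in> {(real k / real N)\<^sup>2..(real (Suc k) / real N)\<^sup>2}"
    \<comment> \<open>m + 1 instead of m, to be positive for constants as well.\<close>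
    define L where "L = real m + 1"
    have L: "L > 0" by (simp add: L_def)
    define I where "I = (LINT x|M. (poly p x)\<^sup>2)"
    have I0: "I \<ge> 0" by (simp add: I_def)
    have Ip: "(LINT x|M. poly (p\<^sup>2) x) = I" by (simp add: I_def poly_power)
    let ?d = "[:1,0,-1:] * (pderiv p)\<^sup>2"
    have pd: "poly ?d x = (1 - x\<^sup>2) * (poly (pderiv p) x)\<^sup>2" for x
      by (simp add: poly_power power2_eq_square algebra_simps)
    have dpos: "poly ?d x \<ge> 0" if "x \<in> {-1..1}" for x
      unfolding pd using that by (intro mult_nonneg_nonneg) (auto simp: abs_square_le_1)
    have "(LINT x|M. poly ?d x) \<le> real m * (real m + \<alpha> + \<beta> + 1) * I"
      unfolding pd I_def by (rule bernstein_M[OF p])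
    also have "\<dots> \<le> (Cb * L\<^sup>2) * I"
    proof (rule mult_right_mono[OF _ I0])
      have "(real m + \<alpha> + \<beta> + 1) * real m \<le> (Cb * L) * L"
      proof (rule mult_mono)
        have "Cb * L = Cb * real m + Cb" by (simp add: L_def distrib_left)
        moreover have "1 * real m \<le> Cb * real m" using Cb by (intro mult_right_mono) auto
        ultimately show "real m + \<alpha> + \<beta> + 1 \<le> Cb * L" using Cb by linarith
      qed (use al be Cb in \<open>auto simp: L_def\<close>)
      thus "real m * (real m + \<alpha> + \<beta> + 1) \<le> Cb * L\<^sup>2" by (simp add: power2_eq_square mult_ac)
    qed
    finally have dI: "(LINT x|M. poly ?d x) / L\<^sup>2 \<le> Cb * I" using L by (simp add: divide_le_eq mult_ac)
    have err: "R / B \<le> Z * (1 + Cb) * I"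
      if "B > 0" "R = U + V / L\<^sup>2" "U \<le> B * Z * I" "V \<le> B * Z * (LINT x|M. poly ?d x)" for B R U V
    proof -
      have "V / L\<^sup>2 \<le> B * Z * (LINT x|M. poly ?d x) / L\<^sup>2" using that L by (intro divide_right_mono) auto
      also have "\<dots> = B * Z * ((LINT x|M. poly ?d x) / L\<^sup>2)" by simp
      also have "\<dots> \<le> B * Z * (Cb * I)" using that Z_pos dI by (intro mult_left_mono) auto
      finally have "R \<le> B * (Z * (1 + Cb) * I)" using that by (simp add: algebra_simps)
      thus ?thesis using that by (simp add: field_simps)
    qed
    define p' where "p' = pcompose p [:0,-1:]"
    have p'sq: "p'\<^sup>2 = pcompose (p\<^sup>2) [:0,-1:]" by (simp add: p'_def power2_eq_square pcompose_mult)
    have p'd: "[:1,0,-1:] * (pderiv p')\<^sup>2 = pcompose ?d [:0,-1:]"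
      by (rule poly_eq_poly_eq_iff[THEN iffD1], rule ext)
         (simp add: p'_def poly_pcompose pderiv_pcompose pderiv_pCons poly_power)
    define R1 where "R1 = right_int (p\<^sup>2) + right_int ?d / L\<^sup>2"
    define R2 where "R2 = r.right_int (p'\<^sup>2) + r.right_int ([:1,0,-1:] * (pderiv p')\<^sup>2) / L\<^sup>2"
    have "R1 / 2 powr \<bar>\<beta>\<bar> \<le> Z * (1 + Cb) * I"
      using right_int_le[of "p\<^sup>2"] unfolding Ip
      by (intro err[OF _ R1_def _ right_int_le[OF dpos]]) (auto simp: poly_power)
    hence R1: "R1 \<le> E * I"
      using mult_right_mono[OF A(2), of "Z * (1 + Cb) * I"] Z_pos Cb I0
      by (simp add: E_def divide_le_eq mult_ac)
    have "R2 / 2 powr \<bar>\<alpha>\<bar> \<le> Z * (1 + Cb) * I"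
      using left_int_le[of "p\<^sup>2"] unfolding Ip p'sq[symmetric]
      by (intro err[OF _ R2_def _ left_int_le[OF dpos, folded p'd]]) (auto simp: poly_power)
    hence R2: "R2 \<le> E * I"
      using mult_right_mono[OF A(3), of "Z * (1 + Cb) * I"] Z_pos Cb I0
      by (simp add: E_def divide_le_eq mult_ac)
    define S1 where "S1 = (\<Sum>k=1..<N. (real k / real N) powr (2 * \<alpha> + 1) / real N * (poly p (y k))\<^sup>2)"
    define S2 where "S2 = (\<Sum>k=1..<N. (real k / real N) powr (2 * \<beta> + 1) / real N * (poly p (z k))\<^sup>2)"
    have S: "S1 \<ge> 0" "S2 \<ge> 0" unfolding S1_def S2_def by (auto intro!: sum_nonneg)
    have Npos: "real N > 0" using N by simp
    have Q1: "right_int (p\<^sup>2) \<le> C1 * S1 + C1 * (L / N) * (E * I)"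
    proof -
      have "right_int (p\<^sup>2) \<le> C1 * S1 + C1 * (L / N) * R1"
        unfolding S1_def R1_def by (rule H1[OF L N y])
      also have "\<dots> \<le> C1 * S1 + C1 * (L / N) * (E * I)"
        using R1 C1 L by (intro add_left_mono mult_left_mono) auto
      finally show ?thesis .
    qed
    have Q2: "r.right_int (p'\<^sup>2) \<le> C2 * S2 + C2 * (L / N) * (E * I)"
    proof -
      have "r.right_int (p'\<^sup>2) \<le> C2 * S2 + C2 * (L / N) * R2"
        using H2[OF L N, of "\<lambda>k. - z k" p'] z by (simp add: S2_def R2_def p'_def poly_pcompose)
      also have "\<dots> \<le> C2 * S2 + C2 * (L / N) * (E * I)"
        using R2 C2 L by (intro add_left_mono mult_left_mono) auto
      finally show ?thesis .
    qed
    have "I * Z \<le> 2 powr \<bar>\<beta>\<bar> * right_int (p\<^sup>2) + 2 powr \<bar>\<alpha>\<bar> * r.right_int (p'\<^sup>2)"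
      using integral_M_le[of "p\<^sup>2"] unfolding Ip p'sq by (simp add: poly_power)
    also have "\<dots> \<le> A * (C1 * S1 + C1 * (L / N) * (E * I)) + A * (C2 * S2 + C2 * (L / N) * (E * I))"
      using Q1 Q2 A right_int_nonneg[of "p\<^sup>2"] r.right_int_nonneg[of "p'\<^sup>2"]
      by (intro add_mono mult_mono) (auto simp: poly_power)
    also have "\<dots> \<le> A * (C1 + C2) * (S1 + S2) + A * (C1 + C2) * (L / N) * (E * I)"
      using A C1 C2 S by (simp add: algebra_simps)
    also have "A * (C1 + C2) * (L / N) * (E * I) \<le> Z / 2 * I"
    proof -
      have "L / N \<le> 1 / D" using ND D Npos by (simp add: L_def field_simps)
      hence "A * (C1 + C2) * (L / N) * (E * I) \<le> A * (C1 + C2) * (1 / D) * (E * I)"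
        using A C1 C2 E I0 by (intro mult_right_mono mult_left_mono) auto
      also have "\<dots> = Z / 2 * I"
      proof -
        define B where "B = A * (C1 + C2)"
        have "B > 0" using A(1) C1 C2 by (simp add: B_def)
        moreover have "D = 2 * B * E / Z" by (simp add: D_def B_def)
        ultimately have "1 / D = Z / (2 * B * E)" by simp
        thus ?thesis using E \<open>B > 0\<close> unfolding B_def[symmetric] by (simp only:) simp
      qed
      finally show ?thesis .
    qed
    finally have "I * Z \<le> A * (C1 + C2) * (S1 + S2) + Z / 2 * I" by simp
    hence "I \<le> C * (S1 + S2)" using Z_pos by (simp add: C_def field_simps)
    thus "(LINT x|M. (poly p x)\<^sup>2) \<le> C * (
       (\<Sum>k=1..<N. (real k / real N) powr (2 * \<alpha> + 1) / real N * (poly p (y k))\<^sup>2)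
       + (\<Sum>k=1..<N. (real k / real N) powr (2 * \<beta> + 1) / real N * (poly p (z k))\<^sup>2))"
      unfolding I_def S1_def S2_def .
  qed
qed

text \<open>The density is at least of order (k/N)^(2 alpha) on the zone, whose length is (2 k + 1)
  / N^2. Half-open intervals make the zones of one half disjoint, so that no sample is counted twice
  there.\<close>

lemma zone_mass:
  "\<exists>c>0. \<forall>N k. 1 \<le> k \<longrightarrow> k < N \<longrightarrow>
     c * ((real k / real N) powr (2 * \<alpha> + 1) / real N)
       \<le> measure M ({1 - (real (Suc k) / real N)\<^sup>2<..1 - (real k / real N)\<^sup>2} \<inter> {-1..1})"
proof -
  define c where "c = 2 powr (-\<bar>\<beta>\<bar>) * 4 powr (-\<bar>\<alpha>\<bar>) / Z"
  have c: "c > 0" using Z_pos by (simp add: c_def)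
  show ?thesis
  proof (intro exI[of _ c] conjI c allI impI)
    fix N k :: nat assume k: "1 \<le> k" "k < N"
    define s where "s = (real k / real N)\<^sup>2"
    define t where "t = (real (Suc k) / real N)\<^sup>2"
    let ?A = "{1 - t<..1 - s} \<inter> {-1..1::real}"
    have Npos: "real N > 0" "real k > 0" using k by auto
    have t1: "t \<le> 1" using k Npos by (auto simp: t_def power_le_one_iff)
    have s0: "s > 0" using Npos by (simp add: s_def)
    have ts: "t - s = (2 * k + 1) / N\<^sup>2"
      using Npos by (simp add: s_def t_def power_divide power2_eq_square algebra_simps flip: diff_divide_distrib)
    have st: "s \<le> t" "t \<le> 4 * s"
    proof -
      have "0 \<le> t - s" unfolding ts by simp
      thus "s \<le> t" by simp
      have "real (Suc k) / N \<le> 2 * (real k / N)" using k Npos by (simp add: field_simps)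
      hence "(real (Suc k) / N)\<^sup>2 \<le> (2 * (real k / N))\<^sup>2" using Npos by (intro power_mono) auto
      thus "t \<le> 4 * s" unfolding s_def t_def by (simp only: power_mult_distrib) simp
    qed
    have Aeq: "?A = {1 - t<..1 - s}" using t1 s0 by auto
    let ?v = "c * s powr \<alpha>"
    have v0: "?v \<ge> 0" using c by simp
    have lb: "?v \<le> w x / Z" if x: "x \<in> {1 - t<..1 - s}" for x
    proof -
      have x01: "x \<in> {0..1}" using x t1 s0 by auto
      have "s powr \<alpha> \<le> 4 powr \<bar>\<alpha>\<bar> * (1 - x) powr \<alpha>"
        by (rule powr_mult_ratio_le) (use x s0 st in auto)
      hence "4 powr (-\<bar>\<alpha>\<bar>) * s powr \<alpha> \<le> (1 - x) powr \<alpha>"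
        by (simp add: powr_minus field_simps)
      hence "2 powr (-\<bar>\<beta>\<bar>) * (4 powr (-\<bar>\<alpha>\<bar>) * s powr \<alpha>) \<le> 2 powr (-\<bar>\<beta>\<bar>) * (1 - x) powr \<alpha>"
        by (intro mult_left_mono) auto
      also have "\<dots> \<le> w x" by (rule w_right_bounds(1)[OF x01])
      finally show ?thesis using Z_pos by (simp add: c_def divide_right_mono mult.assoc)
    qed
    have "ennreal (?v * (t - s)) = ennreal ?v * emeasure lborel {1 - t<..1 - s}"
      using v0 st by (simp add: ennreal_mult)
    also have "\<dots> = (\<integral>\<^sup>+x. ennreal ?v * indicator {1 - t<..1 - s} x \<partial>lborel)"
      by (subst nn_integral_cmult_indicator) auto
    also have "\<dots> \<le> (\<integral>\<^sup>+x. ennreal (w x / Z) * indicator ?A x * indicator {-1..1} x \<partial>lborel)"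
      using lb unfolding Aeq
      using t1 s0 by (intro nn_integral_mono) (auto simp: indicator_def intro!: ennreal_leI)
    also have "\<dots> = emeasure M ?A"
      using sets_M_I[of "{1 - t<..1 - s}"] by (subst nn_M[symmetric]) auto
    finally have "?v * (t - s) \<le> measure M ?A"
      unfolding emeasure_eq_measure by simp
    moreover have "c * ((real k / real N) powr (2 * \<alpha> + 1) / real N) \<le> ?v * (t - s)"
    proof -
      have "s = (real k / N) powr 2" using Npos by (simp add: s_def)
      hence "s powr \<alpha> = (real k / N) powr (2 * \<alpha>)" by (simp only: powr_powr)
      hence e: "(real k / real N) powr (2 * \<alpha> + 1) / real N = s powr \<alpha> * (k / N\<^sup>2)"
        using Npos by (simp add: powr_add power2_eq_square)
      have "k / N\<^sup>2 \<le> (2 * k + 1) / N\<^sup>2" by (intro divide_right_mono) auto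
      hence "(c * s powr \<alpha>) * (k / N\<^sup>2) \<le> (c * s powr \<alpha>) * ((2 * k + 1) / N\<^sup>2)"
        by (rule mult_left_mono) (use c in auto)
      thus ?thesis unfolding e ts by (simp only: mult.assoc)
    qed
    ultimately show "c * ((real k / real N) powr (2 * \<alpha> + 1) / real N) \<le> measure M ({1 - (real (Suc k) / real N)\<^sup>2<..1 - (real k / real N)\<^sup>2} \<inter> {-1..1})"
      unfolding s_def t_def by simp
  qed
qed

lemma zone_mass_left:
  "\<exists>c>0. \<forall>N k. 1 \<le> k \<longrightarrow> k < N \<longrightarrow>
     c * ((real k / real N) powr (2 * \<beta> + 1) / real N)
       \<le> measure M ({(real k / real N)\<^sup>2 - 1..<(real (Suc k) / real N)\<^sup>2 - 1} \<inter> {-1..1})"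
proof -
  interpret r: jacobi \<beta> \<alpha> by (rule flip)
  have "measure r.M ({1 - t<..1 - s} \<inter> {-1..1}) = measure M ({s - 1..<t - 1} \<inter> {-1..1})" for s t
  proof -
    have "uminus -` {1 - t<..1 - s} = {s - 1..<t - 1}" by auto
    thus ?thesis unfolding measure_def by (subst reflect_emeasure) auto
  qed
  thus ?thesis using r.zone_mass by simp
qed

end

section \<open>The condition number of the least squares projection\<close>

text \<open>For the \<open>Lim\<close> in \<open>cond_number\<close>, whose value is accessible only
  once convergence is known; the limit becomes an infimum over delta.\<close>

lemma mono_tendsto_at_right_Inf:
  fixes g :: "real \<Rightarrow> ereal"
  assumes "\<And>x y. a < x \<Longrightarrow> x \<le> y \<Longrightarrow> g x \<le> g y"
  shows "(g \<longlongrightarrow> (INF x\<in>{a<..}. g x)) (at_right a)"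
proof (rule order_tendstoI)
  fix y assume y: "y < (INF x\<in>{a<..}. g x)"
  have "y < g x" if "x \<in> {a<..}" for x
    by (rule less_le_trans[OF y]) (rule INF_lower[OF that])
  thus "eventually (\<lambda>x. y < g x) (at_right a)"
    by (auto simp: eventually_at_filter)
next
  fix y assume "(INF x\<in>{a<..}. g x) < y"
  then obtain z where z: "z > a" "g z < y" by (auto simp: INF_less_iff)
  have "eventually (\<lambda>x. x \<in> {a<..<z}) (at_right a)"
    by (rule eventually_at_right_real[OF z(1)])
  thus "eventually (\<lambda>x. g x < y) (at_right a)"
  proof eventually_elim
    case (elim x)
    thus ?case using assms[of x z] z by (auto intro: le_less_trans)
  qed
qed

section \<open>Empirical inner product and normal equations\<close>

definition emp_form :: "nat \<Rightarrow> (nat \<Rightarrow> real) \<Rightarrow> (real \<Rightarrow> real) \<Rightarrow> (real \<Rightarrow> real) \<Rightarrow> real" where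
  "emp_form n x f g = (1 / real n) * (\<Sum>i=1..n. f (x i) * g (x i))"

lemma emp_norm_eq: "emp_norm n x f = sqrt (emp_form n x f f)"
  by (simp add: emp_norm_def emp_form_def power2_eq_square)

lemma emp_form_nonneg: "emp_form n x f f \<ge> 0"
  by (simp add: emp_form_def sum_nonneg)

lemma emp_norm_sq: "(emp_norm n x f)\<^sup>2 = emp_form n x f f"
  by (simp add: emp_norm_eq emp_form_nonneg)

lemma emp_norm_nonneg: "emp_norm n x f \<ge> 0"
  by (simp add: emp_norm_eq emp_form_nonneg)

lemma emp_norm_le_iff: "emp_norm n x f \<le> emp_norm n x g \<longleftrightarrow> emp_form n x f f \<le> emp_form n x g g"
  by (simp add: emp_norm_eq)

lemma emp_form_add: "emp_form n x (\<lambda>t. f t + g t) h = emp_form n x f h + emp_form n x g h"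
  and emp_form_add': "emp_form n x h (\<lambda>t. f t + g t) = emp_form n x h f + emp_form n x h g"
  and emp_form_diff: "emp_form n x (\<lambda>t. f t - g t) h = emp_form n x f h - emp_form n x g h"
  and emp_form_scale: "emp_form n x (\<lambda>t. c * f t) h = c * emp_form n x f h"
  and emp_form_scale': "emp_form n x h (\<lambda>t. c * f t) = c * emp_form n x h f"
  by (simp_all add: emp_form_def algebra_simps sum.distrib sum_distrib_left sum_subtractf diff_divide_distrib add_divide_distrib)

lemma emp_form_sym: "emp_form n x f g = emp_form n x g f"
  by (simp add: emp_form_def mult.commute)

lemma emp_norm_zero_iff:
  assumes "n > 0"
  shows "emp_norm n x f = 0 \<longleftrightarrow> (\<forall>i\<in>{1..n}. f (x i) = 0)"
  using assms by (auto simp: emp_norm_def sum_nonneg_eq_0_iff)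

lemma emp_Cauchy_Schwarz:
  "emp_form n x f g \<le> emp_norm n x f * emp_norm n x g"
proof -
  have "(\<Sum>i=1..n. f (x i) * g (x i)) \<le> sqrt (\<Sum>i=1..n. (f (x i))\<^sup>2) * sqrt (\<Sum>i=1..n. (g (x i))\<^sup>2)"
    using L2_set_mult_ineq[of "\<lambda>i. f (x i)" "\<lambda>i. g (x i)" "{1..n}"]
    by (intro order_trans[OF _ L2_set_mult_ineq[unfolded L2_set_def]] sum_mono) (simp flip: abs_mult)
  hence "1 / real n * (\<Sum>i=1..n. f (x i) * g (x i))
      \<le> 1 / real n * (sqrt (\<Sum>i=1..n. (f (x i))\<^sup>2) * sqrt (\<Sum>i=1..n. (g (x i))\<^sup>2))"
    by (intro mult_left_mono) auto
  also have "\<dots> = emp_norm n x f * emp_norm n x g"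
    by (simp add: emp_norm_def real_sqrt_divide)
  finally show ?thesis by (simp add: emp_form_def)
qed

lemma emp_poly_form: "poly_form (\<lambda>p q. emp_form n x (poly p) (poly q))"
proof
  fix p q r :: "real poly" and c :: real
  show "emp_form n x (poly p) (poly q) = emp_form n x (poly q) (poly p)" by (rule emp_form_sym)
  show "emp_form n x (poly (p + q)) (poly r) = emp_form n x (poly p) (poly r) + emp_form n x (poly q) (poly r)"
    by (simp add: emp_form_def algebra_simps sum.distrib add_divide_distrib)
  show "emp_form n x (poly (smult c p)) (poly r) = c * emp_form n x (poly p) (poly r)"
    by (simp add: emp_form_def mult.assoc flip: sum_distrib_left)
qed (rule emp_form_nonneg)

text \<open>\<open>riesz\<close> applies although the empirical form is degenerate: a polynomial of
  zero empirical norm vanishes at all samples, hence so does its product with f. For n = 0 the form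
  is identically 0.\<close>

lemma ls_normal_exists:
  "\<exists>p. degree p \<le> m \<and> (\<forall>r. degree r \<le> m \<longrightarrow> emp_form n x (\<lambda>t. poly p t - f t) (poly r) = 0)"
proof -
  interpret poly_form "\<lambda>p q. emp_form n x (poly p) (poly q)" by (rule emp_poly_form)
  have "\<exists>p. degree p \<le> m \<and> (\<forall>r. degree r \<le> m \<longrightarrow> emp_form n x (poly p) (poly r) = emp_form n x f (poly r))"
  proof (rule riesz)
    fix r assume r: "emp_form n x (poly r) (poly r) = 0"
    show "emp_form n x f (poly r) = 0"
    proof (cases "n = 0")
      case False
      hence "\<forall>i\<in>{1..n}. poly r (x i) = 0"
        using emp_norm_zero_iff[of n x "poly r"] r by (simp add: emp_norm_eq)
      thus ?thesis by (simp add: emp_form_def)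
    qed (simp add: emp_form_def)
  qed (simp_all add: emp_form_def algebra_simps sum.distrib add_divide_distrib sum_distrib_left)
  thus ?thesis by (simp add: emp_form_diff)
qed

lemma emp_pythagoras:
  assumes "emp_form n x (\<lambda>t. poly p t - f t) (poly (q - p)) = 0"
  shows "emp_form n x (\<lambda>t. poly q t - f t) (\<lambda>t. poly q t - f t)
    = emp_form n x (\<lambda>t. poly p t - f t) (\<lambda>t. poly p t - f t) + emp_form n x (poly (q - p)) (poly (q - p))"
proof -
  let ?u = "\<lambda>t. poly p t - f t" and ?d = "\<lambda>t. poly (q - p) t"
  have "(\<lambda>t. poly q t - f t) = (\<lambda>t. ?u t + ?d t)" by auto
  thus ?thesis using assms emp_form_sym[of n x ?d ?u]
    by (simp only: emp_form_add emp_form_add')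
qed

text \<open>\<open>arg_min\<close> is a choice, so nothing is known about \<open>ls_proj\<close>
  before some minimizer exists; by Pythagoras, a solution of the normal equations is one.\<close>

lemma ls_proj_minimizer: "is_arg_min (\<lambda>p. emp_norm n x (\<lambda>t. poly p t - f t)) (\<lambda>p. degree p \<le> m) (ls_proj m n x f)"
proof -
  obtain p where p: "degree p \<le> m" "\<And>r. degree r \<le> m \<Longrightarrow> emp_form n x (\<lambda>t. poly p t - f t) (poly r) = 0"
    using ls_normal_exists by blast
  have "is_arg_min (\<lambda>p. emp_norm n x (\<lambda>t. poly p t - f t)) (\<lambda>p. degree p \<le> m) p"
    unfolding is_arg_min_linorder
  proof (intro conjI p(1) allI impI)
    fix q :: "real poly" assume q: "degree q \<le> m"
    have "degree (q - p) \<le> m" by (rule degree_diff_le[OF q p(1)])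
    from emp_pythagoras[OF p(2)[OF this]]
    show "emp_norm n x (\<lambda>t. poly p t - f t) \<le> emp_norm n x (\<lambda>t. poly q t - f t)"
      by (simp add: emp_norm_le_iff emp_form_nonneg)
  qed
  thus ?thesis unfolding ls_proj_def arg_min_def by (rule someI)
qed

lemma degree_ls_proj: "degree (ls_proj m n x f) \<le> m"
  using ls_proj_minimizer by (simp add: is_arg_min_linorder)

text \<open>Any minimizer differs from a solution of the normal equations by a polynomial of zero
  empirical norm, which is orthogonal to everything. Hence the equations hold even for samples where
  \<open>ls_proj\<close> is an arbitrary choice.\<close>

lemma ls_proj_normal:
  assumes r: "degree r \<le> m"
  shows "emp_form n x (\<lambda>t. poly (ls_proj m n x f) t - f t) (poly r) = 0"
proof -
  interpret poly_form "\<lambda>p q. emp_form n x (poly p) (poly q)" by (rule emp_poly_form)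
  obtain p where p: "degree p \<le> m" "\<And>r. degree r \<le> m \<Longrightarrow> emp_form n x (\<lambda>t. poly p t - f t) (poly r) = 0"
    using ls_normal_exists by blast
  let ?q = "ls_proj m n x f"
  have d: "degree (?q - p) \<le> m" by (rule degree_diff_le[OF degree_ls_proj p(1)])
  have "emp_norm n x (\<lambda>t. poly ?q t - f t) \<le> emp_norm n x (\<lambda>t. poly p t - f t)"
    using ls_proj_minimizer[of n x f m] p(1) by (simp add: is_arg_min_linorder)
  hence "emp_form n x (poly (?q - p)) (poly (?q - p)) = 0"
    using emp_pythagoras[OF p(2)[OF d]] emp_form_nonneg[of n x "poly (?q - p)"]
    by (simp add: emp_norm_le_iff)
  hence "emp_form n x (poly r) (poly (?q - p)) = 0" by (rule null_orthogonal)
  hence "emp_form n x (poly (?q - p)) (poly r) = 0" by (simp add: emp_form_sym)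
  moreover have "(\<lambda>t. poly ?q t - f t) = (\<lambda>t. (poly p t - f t) + poly (?q - p) t)" by auto
  ultimately show ?thesis using p(2)[OF r] by (simp only: emp_form_add)
qed

text \<open>Both residuals are orthogonal to the difference d of the projections, so the form of d
  with itself equals that of h with d, and Cauchy-Schwarz applies. This replaces linearity, which an
  arbitrary choice of minimizer may violate.\<close>

lemma ls_proj_nonexpansive:
  "emp_norm n x (poly (ls_proj m n x (\<lambda>t. f t + h t) - ls_proj m n x f)) \<le> emp_norm n x h"
proof -
  let ?p = "ls_proj m n x (\<lambda>t. f t + h t)" and ?q = "ls_proj m n x f"
  let ?d = "?p - ?q"
  have d: "degree ?d \<le> m" by (rule degree_diff_le) (rule degree_ls_proj)+
  have "poly ?d = (\<lambda>t. ((poly ?p t - (f t + h t)) - (poly ?q t - f t)) + h t)" by auto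
  hence "emp_form n x (poly ?d) (poly ?d)
      = emp_form n x (\<lambda>t. ((poly ?p t - (f t + h t)) - (poly ?q t - f t)) + h t) (poly ?d)"
    by (rule arg_cong)
  also have "\<dots> = emp_form n x h (poly ?d)"
    unfolding emp_form_add emp_form_diff[of _ _ "\<lambda>t. poly ?p t - (f t + h t)" "\<lambda>t. poly ?q t - f t"]
    using ls_proj_normal[OF d, of n x "\<lambda>t. f t + h t"] ls_proj_normal[OF d, of n x f] by simp
  also have "\<dots> \<le> emp_norm n x h * emp_norm n x (poly ?d)" by (rule emp_Cauchy_Schwarz)
  finally have "emp_norm n x (poly ?d) * emp_norm n x (poly ?d) \<le> emp_norm n x h * emp_norm n x (poly ?d)"
    by (simp add: emp_norm_sq[symmetric] power2_eq_square)
  thus ?thesis using emp_norm_nonneg[of n x "poly ?d"] emp_norm_nonneg[of n x h]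
    by (cases "emp_norm n x (poly ?d) = 0") auto
qed

text \<open>A difference of two projections is a polynomial of degree at most m, so
  \<open>ls_proj_nonexpansive\<close> bounds the quotient for every h; the infimum over delta is
  compared with its value at delta = 1.\<close>

lemma cond_number_le:
  assumes K: "K \<ge> 0"
    and le: "\<And>p. degree p \<le> m \<Longrightarrow> L2_norm M (poly p) \<le> K * emp_norm n x (poly p)"
  shows "cond_number M m n x \<le> ereal K"
  unfolding cond_number_def
proof (rule SUP_least)
  fix f :: "real \<Rightarrow> real"
  define g where "g = (\<lambda>\<delta>. SUP h \<in> {h. 0 < emp_norm n x h \<and> emp_norm n x h \<le> \<delta>}.
          ereal (L2_norm M (\<lambda>t. poly (ls_proj m n x (\<lambda>u. f u + h u)) t - poly (ls_proj m n x f) t)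
                 / emp_norm n x h))"
  have "(g \<longlongrightarrow> (INF \<delta>\<in>{0<..}. g \<delta>)) (at_right 0)"
    unfolding g_def by (intro mono_tendsto_at_right_Inf SUP_subset_mono) auto
  hence "Lim (at_right 0) g = (INF \<delta>\<in>{0<..}. g \<delta>)" by (intro tendsto_Lim) auto
  also have "\<dots> \<le> g 1" by (rule INF_lower) auto
  also have "g 1 \<le> ereal K"
    unfolding g_def
  proof (rule SUP_least)
    fix h :: "real \<Rightarrow> real" assume h: "h \<in> {h. 0 < emp_norm n x h \<and> emp_norm n x h \<le> 1}"
    let ?d = "ls_proj m n x (\<lambda>u. f u + h u) - ls_proj m n x f"
    have "degree ?d \<le> m" by (rule degree_diff_le) (rule degree_ls_proj)+
    hence "L2_norm M (poly ?d) \<le> K * emp_norm n x (poly ?d)" by (rule le)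
    also have "\<dots> \<le> K * emp_norm n x h" by (intro mult_left_mono K ls_proj_nonexpansive)
    finally show "ereal (L2_norm M (\<lambda>t. poly (ls_proj m n x (\<lambda>u. f u + h u)) t - poly (ls_proj m n x f) t)
                 / emp_norm n x h) \<le> ereal K"
      using h by (simp add: divide_le_eq poly_diff[abs_def])
  qed
  finally show "Lim (at_right (0::real)) (\<lambda>\<delta>.
        SUP h \<in> {h. 0 < emp_norm n x h \<and> emp_norm n x h \<le> \<delta>}.
          ereal (L2_norm M (\<lambda>t. poly (ls_proj m n x (\<lambda>u. f u + h u)) t - poly (ls_proj m n x f) t)
                 / emp_norm n x h)) \<le> ereal K"
    unfolding g_def .
qed

lemma emp_norm_poly_eq_0:
  assumes "inj_on x {1..n}" "m < n" "degree p \<le> m" "emp_norm n x (poly p) = 0"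
  shows "p = 0"
proof (rule ccontr)
  assume p: "p \<noteq> 0"
  have "x ` {1..n} \<subseteq> {t. poly p t = 0}"
    using assms emp_norm_zero_iff[of n x "poly p"] by auto
  hence "card (x ` {1..n}) \<le> card {t. poly p t = 0}" using poly_roots_finite[OF p] by (intro card_mono)
  also have "\<dots> \<le> degree p" using p by (rule card_poly_roots_bound)
  finally show False using assms by (simp add: card_image)
qed

lemma ls_proj_poly:
  assumes "inj_on x {1..n}" "m < n" "degree p \<le> m"
  shows "ls_proj m n x (poly p) = p"
proof -
  let ?d = "ls_proj m n x (poly p) - p"
  have d: "degree ?d \<le> m" by (rule degree_diff_le[OF degree_ls_proj assms(3)])
  have "emp_form n x (poly ?d) (poly ?d) = 0"
    using ls_proj_normal[OF d, of n x "poly p"] by (simp add: poly_diff[abs_def] fun_diff_def)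
  hence "?d = 0" using assms d by (intro emp_norm_poly_eq_0[of x n m]) (auto simp: emp_norm_eq)
  thus ?thesis by simp
qed

lemma L2_norm_scale: "c \<ge> 0 \<Longrightarrow> L2_norm M (\<lambda>t. c * f t) = c * L2_norm M f"
  by (simp add: L2_norm_def power_mult_distrib real_sqrt_mult)

lemma emp_norm_scale: "c \<ge> 0 \<Longrightarrow> emp_norm n x (\<lambda>t. c * f t) = c * emp_norm n x f"
  by (simp add: emp_norm_eq emp_form_scale emp_form_scale' real_sqrt_mult)

text \<open>The zero function is perturbed by multiples of p: distinct samples make the projection
  reproduce them, and the quotient does not change under scaling, so it survives the limit in
  delta.\<close>

lemma cond_number_ge:
  assumes "inj_on x {1..n}" "m < n" "degree p \<le> m" "p \<noteq> 0"
  shows "ereal (L2_norm M (poly p) / emp_norm n x (poly p)) \<le> cond_number M m n x"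
proof -
  define e where "e = emp_norm n x (poly p)"
  have e: "e > 0"
    using emp_norm_poly_eq_0[of x n m p] assms emp_norm_nonneg[of n x "poly p"]
    by (auto simp: e_def less_le)
  define f where "f = (\<lambda>t::real. 0::real)"
  define g where "g = (\<lambda>\<delta>. SUP h \<in> {h. 0 < emp_norm n x h \<and> emp_norm n x h \<le> \<delta>}.
          ereal (L2_norm M (\<lambda>t. poly (ls_proj m n x (\<lambda>u. f u + h u)) t - poly (ls_proj m n x f) t)
                 / emp_norm n x h))"
  have "(g \<longlongrightarrow> (INF \<delta>\<in>{0<..}. g \<delta>)) (at_right 0)"
    unfolding g_def by (intro mono_tendsto_at_right_Inf SUP_subset_mono) auto
  hence L: "Lim (at_right 0) g = (INF \<delta>\<in>{0<..}. g \<delta>)" by (intro tendsto_Lim) auto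
  have f0: "ls_proj m n x f = 0"
    using ls_proj_poly[OF assms(1,2), of 0] by (simp add: f_def poly_0[abs_def])
  have "ereal (L2_norm M (poly p) / e) \<le> (INF \<delta>\<in>{0<..}. g \<delta>)"
  proof (rule INF_greatest)
    fix \<delta> :: real assume "\<delta> \<in> {0<..}"
    hence \<delta>: "\<delta> > 0" by simp
    let ?q = "smult (\<delta> / e) p"
    have q: "poly ?q = (\<lambda>t. \<delta> / e * poly p t)" by auto
    have en: "emp_norm n x (poly ?q) = \<delta>"
      unfolding q using e \<delta> by (subst emp_norm_scale) (auto simp: e_def)
    have pr: "ls_proj m n x (poly ?q) = ?q"
      using assms by (intro ls_proj_poly) (auto intro: order_trans[OF degree_smult_le])
    have "L2_norm M (poly p) / e = L2_norm M (poly ?q) / \<delta>"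
      unfolding q using e \<delta> by (subst L2_norm_scale) auto
    also have "ereal \<dots> \<le> g \<delta>"
      unfolding g_def
    proof (rule SUP_upper2[of "poly ?q"])
      show "poly ?q \<in> {h. 0 < emp_norm n x h \<and> emp_norm n x h \<le> \<delta>}" using en \<delta> by auto
      have "(\<lambda>u. f u + poly ?q u) = poly ?q" by (simp add: f_def fun_eq_iff)
      hence "L2_norm M (\<lambda>t. poly (ls_proj m n x (\<lambda>u. f u + poly ?q u)) t - poly (ls_proj m n x f) t)
          / emp_norm n x (poly ?q) = L2_norm M (poly ?q) / \<delta>"
        by (simp only: pr f0 en poly_0 diff_zero)
      thus "ereal (L2_norm M (poly ?q) / \<delta>) \<le>
          ereal (L2_norm M (\<lambda>t. poly (ls_proj m n x (\<lambda>u. f u + poly ?q u)) t - poly (ls_proj m n x f) t)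
          / emp_norm n x (poly ?q))" by (simp only: order_refl)
    qed
    finally show "ereal (L2_norm M (poly p) / e) \<le> g \<delta>" .
  qed
  also have "\<dots> \<le> cond_number M m n x"
  proof -
    have "Lim (at_right 0) g \<le> cond_number M m n x"
      unfolding cond_number_def g_def by (rule SUP_upper) (rule UNIV_I)
    thus ?thesis unfolding L .
  qed
  finally show ?thesis by (simp add: e_def)
qed

section \<open>Sufficiency of the sampling rate\<close>

text \<open>As y k serves the sample in zone k at which f is least: the number of samples there
  times f (y k) is at most the sum of f over them. This turns sample counts into the nodes of
  \<open>quadrature\<close>.\<close>

lemma disjoint_zones_nodes:
  fixes f :: "real \<Rightarrow> real" and x :: "nat \<Rightarrow> real"
  assumes fin: "finite I" "finite K" and disj: "disjoint_family_on A K"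
    and v: "\<And>k. k \<in> K \<Longrightarrow> v k \<le> b * real (card {i\<in>I. x i \<in> A k})"
    and ne: "\<And>k. k \<in> K \<Longrightarrow> {i\<in>I. x i \<in> A k} \<noteq> {}"
    and f: "\<And>t. f t \<ge> 0" and b: "b \<ge> 0"
  shows "\<exists>y. (\<forall>k\<in>K. y k \<in> A k) \<and> (\<Sum>k\<in>K. v k * f (y k)) \<le> b * (\<Sum>i\<in>I. f (x i))"
proof -
  define S where "S = (\<lambda>k. {i\<in>I. x i \<in> A k})"
  have "\<exists>t. t \<in> x ` S k \<and> (\<forall>i\<in>S k. f t \<le> f (x i))" if "k \<in> K" for k
  proof -
    have "finite (f ` x ` S k)" "f ` x ` S k \<noteq> {}" using fin ne[OF that] by (auto simp: S_def)
    hence "Min (f ` x ` S k) \<in> f ` x ` S k" "\<forall>i\<in>S k. Min (f ` x ` S k) \<le> f (x i)"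
      by (rule Min_in) (use \<open>finite (f ` x ` S k)\<close> in auto)
    thus ?thesis by force
  qed
  then obtain y where y: "\<And>k. k \<in> K \<Longrightarrow> y k \<in> x ` S k" "\<And>k i. k \<in> K \<Longrightarrow> i \<in> S k \<Longrightarrow> f (y k) \<le> f (x i)"
    by metis
  have "v k * f (y k) \<le> b * (\<Sum>i\<in>S k. f (x i))" if k: "k \<in> K" for k
  proof -
    have "v k * f (y k) \<le> (b * real (card (S k))) * f (y k)"
      using v[OF k] f by (intro mult_right_mono) (auto simp: S_def)
    also have "\<dots> = b * (\<Sum>i\<in>S k. f (y k))" by simp
    also have "\<dots> \<le> b * (\<Sum>i\<in>S k. f (x i))" using y(2)[OF k] b by (intro mult_left_mono sum_mono) auto
    finally show ?thesis .
  qed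
  hence "(\<Sum>k\<in>K. v k * f (y k)) \<le> (\<Sum>k\<in>K. b * (\<Sum>i\<in>S k. f (x i)))" by (rule sum_mono)
  also have "\<dots> = b * (\<Sum>k\<in>K. \<Sum>i\<in>S k. f (x i))" by (simp add: sum_distrib_left)
  also have "(\<Sum>k\<in>K. \<Sum>i\<in>S k. f (x i)) = (\<Sum>i\<in>(\<Union>k\<in>K. S k). f (x i))"
    using fin disj by (subst sum.UNION_disjoint) (auto simp: S_def disjoint_family_on_def)
  also have "b * \<dots> \<le> b * (\<Sum>i\<in>I. f (x i))"
    using b f fin by (intro mult_left_mono sum_mono2) (auto simp: S_def)
  finally show ?thesis using y(1) by (intro exI[of _ y]) (fastforce simp: S_def)
qed

text \<open>Chernoff's bound with parameter 1: for p = \<open>prob A\<close>, the expectation of exp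
  (- indicator) is at most 1 - p/2 <= exp (- p/2), and Markov's inequality at the threshold n p / 4
  leaves exp (n p / 4 - n p / 2).\<close>

lemma (in prob_space) binomial_lower_tail:
  fixes A :: "'a set" and n :: nat
  assumes A: "A \<in> sets M"
  shows "measure (\<Pi>\<^sub>M i\<in>{1..n}. M) {x \<in> space (\<Pi>\<^sub>M i\<in>{1..n}. M). (\<Sum>i=1..n. indicator A (x i)) \<le> real n * prob A / 4}
    \<le> exp (- (real n * prob A / 4))"
proof -
  interpret P: product_prob_space "\<lambda>_::nat. M" "{1..n}" by unfold_locales
  let ?P = "\<Pi>\<^sub>M i\<in>{1..n}. M"
  define g where "g = (\<lambda>t. exp (- indicator A t) :: real)"
  have [measurable]: "A \<in> sets M" by (rule A)
  have [measurable]: "g \<in> borel_measurable M" unfolding g_def by measurable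
  have g: "g t = 1 - (1 - exp (-1)) * indicator A t" for t
    by (auto simp: g_def indicator_def)
  have e: "exp (-1 :: real) \<le> 1/2"
    using exp_ge_add_one_self[of "1::real"] by (simp add: exp_minus field_simps)
  have [simp]: "integrable M (indicat_real A)"
    using A by (simp add: integrable_indicator_iff emeasure_eq_measure)
  have "(\<integral>t. g t \<partial>M) = 1 - (1 - exp (-1)) * prob A"
    unfolding g using A by (subst Bochner_Integration.integral_diff) (auto simp: prob_space)
  also have "\<dots> \<le> 1 - 1/2 * prob A" using mult_right_mono[of "1/2" "1 - exp (-1)" "prob A"] e by simp
  also have "\<dots> \<le> exp (- (prob A / 2))" using exp_ge_add_one_self[of "- (prob A / 2)"] by simp
  finally have Ig: "(\<integral>t. g t \<partial>M) \<le> exp (- (prob A / 2))" .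
  have ig: "integrable M g" unfolding g by (intro Bochner_Integration.integrable_diff) (use A in auto)
  have nng: "(\<integral>\<^sup>+t. ennreal (g t) \<partial>M) \<le> ennreal (exp (- (prob A / 2)))"
    by (subst nn_integral_eq_integral[OF ig]) (use Ig in \<open>auto simp: g_def intro!: ennreal_leI\<close>)
  let ?c = "exp (real n * prob A / 4)"
  let ?B = "{x \<in> space ?P. (\<Sum>i=1..n. indicator A (x i)) \<le> real n * prob A / 4}"
  have "emeasure ?P ?B \<le> emeasure ?P {x \<in> space ?P. 1 \<le> ennreal ?c * (\<Prod>i=1..n. ennreal (g (x i)))}"
  proof (rule emeasure_mono)
    show "?B \<subseteq> {x \<in> space ?P. 1 \<le> ennreal ?c * (\<Prod>i=1..n. ennreal (g (x i)))}"
    proof (intro subsetI CollectI conjI)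
      fix x assume x: "x \<in> ?B"
      have "(\<Prod>i=1..n. ennreal (g (x i))) = ennreal (\<Prod>i=1..n. g (x i))"
        by (subst prod_ennreal) (auto simp: g_def)
      also have "(\<Prod>i=1..n. g (x i)) = exp (- (\<Sum>i=1..n. indicator A (x i)))"
        unfolding g_def by (subst exp_sum[symmetric]) (auto simp: sum_negf)
      finally have "ennreal ?c * (\<Prod>i=1..n. ennreal (g (x i))) = ennreal (exp (real n * prob A / 4 - (\<Sum>i=1..n. indicator A (x i))))"
        by (simp add: ennreal_mult[symmetric] exp_add[symmetric])
      moreover have "1 \<le> exp (real n * prob A / 4 - (\<Sum>i=1..n. indicator A (x i)))" using x by simp
      ultimately show "1 \<le> ennreal ?c * (\<Prod>i=1..n. ennreal (g (x i)))" by simp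
    qed auto
    show "{x \<in> space ?P. 1 \<le> ennreal ?c * (\<Prod>i=1..n. ennreal (g (x i)))} \<in> sets ?P" by measurable
  qed
  also have "\<dots> \<le> ennreal ?c * (\<integral>\<^sup>+x. (\<Prod>i=1..n. ennreal (g (x i))) * indicator (space ?P) x \<partial>?P)"
    by (rule nn_integral_Markov_inequality) auto
  also have "(\<integral>\<^sup>+x. (\<Prod>i=1..n. ennreal (g (x i))) * indicator (space ?P) x \<partial>?P) = (\<integral>\<^sup>+x. (\<Prod>i=1..n. ennreal (g (x i))) \<partial>?P)"
    by (intro nn_integral_cong) auto
  also have "\<dots> = (\<Prod>i=1..n. (\<integral>\<^sup>+t. ennreal (g t) \<partial>M))"
    by (rule P.product_nn_integral_prod) auto
  also have "ennreal ?c * \<dots> \<le> ennreal ?c * (\<Prod>i=1..n. ennreal (exp (- (prob A / 2))))"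
    unfolding prod_constant by (intro mult_left_mono power_mono nng) auto
  also have "\<dots> = ennreal (?c * exp (- (prob A / 2)) ^ n)"
    by (simp add: ennreal_power ennreal_mult[symmetric])
  also have "?c * exp (- (prob A / 2)) ^ n = exp (- (real n * prob A / 4))"
    by (simp add: exp_of_nat_mult[symmetric] exp_add[symmetric])
  finally show ?thesis unfolding P.emeasure_eq_measure by (subst (asm) ennreal_le_iff) auto
qed

section \<open>Stability for samples that fill every zone\<close>

context jacobi
begin

abbreviation P where "P n \<equiv> jacobi_samples \<alpha> \<beta> n"

lemma P_eq: "P n = (\<Pi>\<^sub>M i\<in>{1..n}. M)" by (simp add: jacobi_samples_def)

lemma prob_P: "prob_space (P n)"
proof -
  interpret P: product_prob_space "\<lambda>_::nat. M" "{1..n}" by unfold_locales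
  show ?thesis unfolding P_eq by unfold_locales
qed

text \<open>The deterministic half of the sufficiency: a quarter of the expected count in every
  zone, together with \<open>zone_mass\<close> and \<open>zone_mass_left\<close>, lets the sample
  average of p^2 dominate the quadrature sums.\<close>

lemma good_samples_cond_number_le:
  "\<exists>K>0. \<exists>D>0. \<forall>m n N x. m < n \<longrightarrow> N \<ge> 2 \<longrightarrow> real N \<ge> D * (real m + 1) \<longrightarrow> x \<in> space (P n) \<longrightarrow>
    (\<forall>k\<in>{1..<N}. real n * prob ({1 - (real (Suc k) / real N)\<^sup>2<..1 - (real k / real N)\<^sup>2} \<inter> {-1..1}) / 4
       < (\<Sum>i=1..n. indicator ({1 - (real (Suc k) / real N)\<^sup>2<..1 - (real k / real N)\<^sup>2} \<inter> {-1..1}) (x i))) \<longrightarrow>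
    (\<forall>k\<in>{1..<N}. real n * prob ({(real k / real N)\<^sup>2 - 1..<(real (Suc k) / real N)\<^sup>2 - 1} \<inter> {-1..1}) / 4
       < (\<Sum>i=1..n. indicator ({(real k / real N)\<^sup>2 - 1..<(real (Suc k) / real N)\<^sup>2 - 1} \<inter> {-1..1}) (x i))) \<longrightarrow>
    cond_number M m n x \<le> ereal K"
proof -
  obtain C D where C: "C > 0" and D: "D > 0" and quad: "\<forall>(p::real poly) m N (y::nat \<Rightarrow> real) z. degree p \<le> m \<longrightarrow> N \<ge> (2::nat) \<longrightarrow>
     real N \<ge> D * (real m + 1) \<longrightarrow>
     (\<forall>k\<in>{1..<N}. 1 - y k \<in> {(real k / real N)\<^sup>2..(real (Suc k) / real N)\<^sup>2}) \<longrightarrow>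
     (\<forall>k\<in>{1..<N}. 1 + z k \<in> {(real k / real N)\<^sup>2..(real (Suc k) / real N)\<^sup>2}) \<longrightarrow>
     (LINT x|M. (poly p x)\<^sup>2)
       \<le> C * ((\<Sum>k=1..<N. (real k / real N) powr (2 * \<alpha> + 1) / real N * (poly p (y k))\<^sup>2)
            + (\<Sum>k=1..<N. (real k / real N) powr (2 * \<beta> + 1) / real N * (poly p (z k))\<^sup>2))"
    using quadrature by (elim exE conjE) (rule that)
  obtain c1 where c1: "c1 > 0" and z1: "\<And>N k. 1 \<le> k \<Longrightarrow> k < N \<Longrightarrow>
     c1 * ((real k / real N) powr (2 * \<alpha> + 1) / real N)
       \<le> prob ({1 - (real (Suc k) / real N)\<^sup>2<..1 - (real k / real N)\<^sup>2} \<inter> {-1..1})"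
    using zone_mass by blast
  obtain c2 where c2: "c2 > 0" and z2: "\<And>N k. 1 \<le> k \<Longrightarrow> k < N \<Longrightarrow>
     c2 * ((real k / real N) powr (2 * \<beta> + 1) / real N)
       \<le> prob ({(real k / real N)\<^sup>2 - 1..<(real (Suc k) / real N)\<^sup>2 - 1} \<inter> {-1..1})"
    using zone_mass_left by blast
  define K where "K = sqrt (C * (4 / c1 + 4 / c2))"
  have K: "K > 0" unfolding K_def using C c1 c2 by (simp add: add_pos_pos)
  show ?thesis
  proof (rule exI[of _ K], rule conjI[OF K], rule exI[of _ D], rule conjI[OF D], intro allI impI)
    fix m n N x
    define A1 where "A1 k = {1 - (real (Suc k) / real N)\<^sup>2<..1 - (real k / real N)\<^sup>2} \<inter> {-1..1}" for k
    define A2 where "A2 k = {(real k / real N)\<^sup>2 - 1..<(real (Suc k) / real N)\<^sup>2 - 1} \<inter> {-1..1}" for k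
    assume mn: "m < n" and N: "N \<ge> 2" and ND: "real N \<ge> D * (real m + 1)" and x: "x \<in> space (P n)"
      and "\<forall>k\<in>{1..<N}. real n * prob ({1 - (real (Suc k) / real N)\<^sup>2<..1 - (real k / real N)\<^sup>2} \<inter> {-1..1}) / 4
       < (\<Sum>i=1..n. indicator ({1 - (real (Suc k) / real N)\<^sup>2<..1 - (real k / real N)\<^sup>2} \<inter> {-1..1}) (x i))"
      and "\<forall>k\<in>{1..<N}. real n * prob ({(real k / real N)\<^sup>2 - 1..<(real (Suc k) / real N)\<^sup>2 - 1} \<inter> {-1..1}) / 4
       < (\<Sum>i=1..n. indicator ({(real k / real N)\<^sup>2 - 1..<(real (Suc k) / real N)\<^sup>2 - 1} \<inter> {-1..1}) (x i))"
    hence cnt1: "\<And>k. k \<in> {1..<N} \<Longrightarrow> real n * prob (A1 k) / 4 < (\<Sum>i=1..n. indicator (A1 k) (x i))"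
      and cnt2: "\<And>k. k \<in> {1..<N} \<Longrightarrow> real n * prob (A2 k) / 4 < (\<Sum>i=1..n. indicator (A2 k) (x i))"
      by (auto simp: A1_def A2_def)
    have n: "real n > 0" using mn by simp
    have sum_card: "(\<Sum>i=1..n. indicator A (x i)) = real (card {i\<in>{1..n}. x i \<in> A})" for A :: "real set"
      by (simp add: indicator_def sum.If_cases Int_def)
    define \<tau> where "\<tau> k = (real k / real N)\<^sup>2" for k
    have mono: "\<tau> k \<le> \<tau> l" if "k \<le> l" for k l
      unfolding \<tau>_def using that by (intro power_mono divide_right_mono) auto
    have disj1: "disjoint_family_on A1 {1..<N}"
      unfolding disjoint_family_on_def
    proof (intro ballI impI)
      fix k l :: nat assume "k \<noteq> l"
      thus "A1 k \<inter> A1 l = {}" unfolding A1_def \<tau>_def[symmetric]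
        using mono[of "Suc k" l] mono[of "Suc l" k] by (cases k l rule: linorder_cases) auto
    qed
    have disj2: "disjoint_family_on A2 {1..<N}"
      unfolding disjoint_family_on_def
    proof (intro ballI impI)
      fix k l :: nat assume "k \<noteq> l"
      thus "A2 k \<inter> A2 l = {}" unfolding A2_def \<tau>_def[symmetric]
        using mono[of "Suc k" l] mono[of "Suc l" k] by (cases k l rule: linorder_cases) auto
    qed
    have v1: "(real k / real N) powr (2 * \<alpha> + 1) / real N \<le> 4 / (c1 * n) * real (card {i\<in>{1..n}. x i \<in> A1 k})"
      and ne1: "{i\<in>{1..n}. x i \<in> A1 k} \<noteq> {}" if k: "k \<in> {1..<N}" for k
    proof -
      have 1: "real n * prob (A1 k) / 4 < real (card {i\<in>{1..n}. x i \<in> A1 k})"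
        using cnt1[OF k] unfolding sum_card .
      have "real n * (c1 * ((real k / real N) powr (2 * \<alpha> + 1) / real N)) \<le> real n * prob (A1 k)"
        using z1[of k N] k n unfolding A1_def by (intro mult_left_mono) auto
      with 1 have "real n * c1 * ((real k / real N) powr (2 * \<alpha> + 1) / real N)
          \<le> 4 * real (card {i\<in>{1..n}. x i \<in> A1 k})" unfolding mult.assoc by linarith
      thus "(real k / real N) powr (2 * \<alpha> + 1) / real N \<le> 4 / (c1 * n) * real (card {i\<in>{1..n}. x i \<in> A1 k})"
        using n c1 by (simp add: pos_le_divide_eq mult_ac)
      \<comment> \<open>The strict inequality in the counts guarantees a sample in the zone.\<close>
      have "0 \<le> real n * prob (A1 k) / 4" by simp
      with 1 have "card {i\<in>{1..n}. x i \<in> A1 k} \<noteq> 0" by linarith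
      thus "{i\<in>{1..n}. x i \<in> A1 k} \<noteq> {}" by (metis card.empty)
    qed
    have v2: "(real k / real N) powr (2 * \<beta> + 1) / real N \<le> 4 / (c2 * n) * real (card {i\<in>{1..n}. x i \<in> A2 k})"
      and ne2: "{i\<in>{1..n}. x i \<in> A2 k} \<noteq> {}" if k: "k \<in> {1..<N}" for k
    proof -
      have 1: "real n * prob (A2 k) / 4 < real (card {i\<in>{1..n}. x i \<in> A2 k})"
        using cnt2[OF k] unfolding sum_card .
      have "real n * (c2 * ((real k / real N) powr (2 * \<beta> + 1) / real N)) \<le> real n * prob (A2 k)"
        using z2[of k N] k n unfolding A2_def by (intro mult_left_mono) auto
      with 1 have "real n * c2 * ((real k / real N) powr (2 * \<beta> + 1) / real N)
          \<le> 4 * real (card {i\<in>{1..n}. x i \<in> A2 k})" unfolding mult.assoc by linarith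
      thus "(real k / real N) powr (2 * \<beta> + 1) / real N \<le> 4 / (c2 * n) * real (card {i\<in>{1..n}. x i \<in> A2 k})"
        using n c2 by (simp add: pos_le_divide_eq mult_ac)
      have "0 \<le> real n * prob (A2 k) / 4" by simp
      with 1 have "card {i\<in>{1..n}. x i \<in> A2 k} \<noteq> 0" by linarith
      thus "{i\<in>{1..n}. x i \<in> A2 k} \<noteq> {}" by (metis card.empty)
    qed
    show "cond_number M m n x \<le> ereal K"
    proof (rule cond_number_le)
      fix p :: "real poly" assume p: "degree p \<le> m"
      define S where "S = (\<Sum>i=1..n. (poly p (x i))\<^sup>2)"
      obtain y where y: "\<forall>k\<in>{1..<N}. y k \<in> A1 k"
        "(\<Sum>k=1..<N. (real k / real N) powr (2 * \<alpha> + 1) / real N * (poly p (y k))\<^sup>2) \<le> 4 / (c1 * n) * S"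
        using disjoint_zones_nodes[OF _ _ disj1 v1 ne1, of "\<lambda>t. (poly p t)\<^sup>2"] c1 n
        unfolding S_def by auto
      obtain z where z: "\<forall>k\<in>{1..<N}. z k \<in> A2 k"
        "(\<Sum>k=1..<N. (real k / real N) powr (2 * \<beta> + 1) / real N * (poly p (z k))\<^sup>2) \<le> 4 / (c2 * n) * S"
        using disjoint_zones_nodes[OF _ _ disj2 v2 ne2, of "\<lambda>t. (poly p t)\<^sup>2"] c2 n
        unfolding S_def by auto
      have "(LINT x|M. (poly p x)\<^sup>2) \<le> C * ((\<Sum>k=1..<N. (real k / real N) powr (2 * \<alpha> + 1) / real N * (poly p (y k))\<^sup>2)
            + (\<Sum>k=1..<N. (real k / real N) powr (2 * \<beta> + 1) / real N * (poly p (z k))\<^sup>2))"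
      proof (intro quad[rule_format, OF p N ND] ballI)
        fix k assume "k \<in> {1..<N}"
        hence "y k \<in> A1 k" "z k \<in> A2 k" using y(1) z(1) by blast+
        thus "1 - y k \<in> {(real k / real N)\<^sup>2..(real (Suc k) / real N)\<^sup>2}"
          "1 + z k \<in> {(real k / real N)\<^sup>2..(real (Suc k) / real N)\<^sup>2}"
          unfolding A1_def A2_def by (simp_all only: Int_iff greaterThanAtMost_iff atLeastLessThan_iff atLeastAtMost_iff) linarith+
      qed
      also have "\<dots> \<le> C * (4 / (c1 * n) * S + 4 / (c2 * n) * S)"
        using y(2) z(2) C by (intro mult_left_mono add_mono) auto
      also have "\<dots> = (C * (4 / c1 + 4 / c2)) * ((1 / n) * S)"
        using n by (simp add: algebra_simps)
      finally have "sqrt (LINT x|M. (poly p x)\<^sup>2) \<le> sqrt ((C * (4 / c1 + 4 / c2)) * ((1 / n) * S))"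
        by (rule real_sqrt_le_mono)
      thus "L2_norm M (poly p) \<le> K * emp_norm n x (poly p)"
        unfolding real_sqrt_mult[of "C * (4 / c1 + 4 / c2)"] by (simp add: L2_norm_def emp_norm_def K_def S_def)
    qed (use K in simp)
  qed
qed

end

text \<open>The exponent may be below 1, so the terms are compared with 1 / k^2 and not with a
  geometric series.\<close>

lemma summable_exp_powr:
  fixes a \<tau> :: real
  assumes "a > 0" "\<tau> > 0"
  shows "summable (\<lambda>k::nat. exp (- a * real k powr \<tau>))"
proof (rule summable_comparison_test_bigo)
  show "summable (\<lambda>k::nat. norm (1 / real k ^ 2))"
    using inverse_power_summable[of 2] by (simp add: divide_inverse)
  show "(\<lambda>k::nat. exp (- a * real k powr \<tau>)) \<in> O(\<lambda>k. 1 / real k ^ 2)"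
    using assms by real_asymp
qed

context jacobi
begin

lemma sampling_rate_sufficient:
  assumes gam: "\<gamma> = max \<alpha> \<beta>" "\<gamma> > -1/2" and c: "c > 0"
  shows "ls_stable \<alpha> \<beta> {(m, n). m < n \<and> real n \<ge> c * real m powr (2 * (1 + \<gamma>)) * ln (real n)}"
proof -
  define A1 where "A1 N k = {1 - (real (Suc k) / real N)\<^sup>2<..1 - (real k / real N)\<^sup>2} \<inter> {-1..1}" for N k :: nat
  define A2 where "A2 N k = {(real k / real N)\<^sup>2 - 1..<(real (Suc k) / real N)\<^sup>2 - 1} \<inter> {-1..1}" for N k :: nat
  define B where "B n A = {x \<in> space (P n). (\<Sum>i=1..n. indicator A (x i)) \<le> real n * prob A / 4}" for n A
  obtain K D where K: "K > 0" and D: "D > 0" and cond: "\<forall>m n N x. m < n \<longrightarrow> N \<ge> 2 \<longrightarrow> real N \<ge> D * (real m + 1) \<longrightarrow> x \<in> space (P n) \<longrightarrow>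
    (\<forall>k\<in>{1..<N}. real n * prob (A1 N k) / 4 < (\<Sum>i=1..n. indicator (A1 N k) (x i))) \<longrightarrow>
    (\<forall>k\<in>{1..<N}. real n * prob (A2 N k) / 4 < (\<Sum>i=1..n. indicator (A2 N k) (x i))) \<longrightarrow>
    cond_number M m n x \<le> ereal K"
    using good_samples_cond_number_le[folded A1_def A2_def] by (elim exE conjE) (rule that)
  obtain c1 where c1: "c1 > 0" and z1: "\<And>N k. 1 \<le> k \<Longrightarrow> k < N \<Longrightarrow>
     c1 * ((real k / real N) powr (2 * \<alpha> + 1) / real N) \<le> prob (A1 N k)"
    using zone_mass unfolding A1_def by blast
  obtain c2 where c2: "c2 > 0" and z2: "\<And>N k. 1 \<le> k \<Longrightarrow> k < N \<Longrightarrow>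
     c2 * ((real k / real N) powr (2 * \<beta> + 1) / real N) \<le> prob (A2 N k)"
    using zone_mass_left unfolding A2_def by blast
  define c3 where "c3 = min c1 c2"
  have c3: "c3 > 0" "c3 \<le> c1" "c3 \<le> c2" using c1 c2 by (auto simp: c3_def)
  define \<tau> where "\<tau> = 2 * \<gamma> + 1"
  have tau: "\<tau> > 0" using gam by (simp add: \<tau>_def)
  have tau2: "2 * (1 + \<gamma>) = \<tau> + 1" by (simp add: \<tau>_def)
  \<comment> \<open>2^(tau + 1) pays for replacing m by m + 1 <= 2 m. The bound 1 serves m = 0,
    where the hypothesis on n is void and ln n <= n is used.\<close>
  define c0 where "c0 = min 1 (c / 2 powr (\<tau> + 1))"
  have c0: "c0 > 0" "c0 \<le> 1" "c0 * 2 powr (\<tau> + 1) \<le> c"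
    using c by (auto simp: c0_def min_def field_simps)
  \<comment> \<open>Chosen so that zone k expects at least kappa k^tau ln n samples; D + 3 comes
    from N <= (D + 3) (m + 1).\<close>
  define \<kappa> where "\<kappa> = c3 * c0 / (D + 3) powr (\<tau> + 1)"
  have kap: "\<kappa> > 0" unfolding \<kappa>_def using c3 c0 D by simp
  define S where "S = (\<Sum>k. exp (- (\<kappa> / 8 * ln 2) * real k powr \<tau>))"
  have summ: "summable (\<lambda>k::nat. exp (- (\<kappa> / 8 * ln 2) * real k powr \<tau>))"
    using kap tau by (intro summable_exp_powr) auto
  have S0: "S \<ge> 0" unfolding S_def by (intro suminf_nonneg summ) auto
  have main: "\<exists>E \<in> sets (P n). measure (P n) E \<ge> 1 - (2 * S + 1) / real n powr (\<kappa> / 8) \<and>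
        (\<forall>x\<in>E. cond_number M m n x \<le> ereal K)"
    if mn: "m < n" and nc: "real n \<ge> c * real m powr (2 * (1 + \<gamma>)) * ln (real n)" for m n
  \<comment> \<open>ln 1 = 0 makes the rate void, but then the demanded probability 1 - (2 S + 1) is
    not positive and the empty event will do.\<close>
  proof (cases "n = 1")
    case True
    thus ?thesis using S0 by (intro bexI[of _ "{}"]) auto
  next
    case False
    hence n2: "n \<ge> 2" using mn by simp
    interpret P: prob_space "P n" by (rule prob_P)
    have ln_n: "ln (real n) \<ge> ln 2" using n2 by simp
    have ln2: "ln (2::real) > 0" by simp
    define L where "L = real m + 1"
    have L: "L \<ge> 1" by (simp add: L_def)
    define N where "N = nat \<lceil>D * L\<rceil> + 2"
    have N2: "N \<ge> 2" by (simp add: N_def)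
    have ND: "real N \<ge> D * (real m + 1)" unfolding N_def L_def[symmetric] by linarith
    have NU: "real N \<le> (D + 3) * L"
    proof -
      have "D * L \<ge> 0" using D L by simp
      hence "real N \<le> D * L + 3" unfolding N_def by linarith
      also have "\<dots> \<le> D * L + 3 * L" using L by simp
      finally show ?thesis by (simp add: distrib_right)
    qed
    have Npos: "real N > 0" using N2 by simp
    have rate: "real n \<ge> c0 * L powr (\<tau> + 1) * ln (real n)"
    proof (cases "m = 0")
      case True
      have "c0 * L powr (\<tau> + 1) * ln (real n) \<le> 1 * ln (real n)"
        using c0 True n2 by (intro mult_right_mono) (auto simp: L_def)
      also have "\<dots> \<le> real n" using ln_le_minus_one[of "real n"] n2 by simp
      finally show ?thesis .
    next
      case False
      have "L powr (\<tau> + 1) \<le> (2 * real m) powr (\<tau> + 1)"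
        using False tau by (intro powr_mono2) (auto simp: L_def)
      also have "\<dots> = 2 powr (\<tau> + 1) * real m powr (\<tau> + 1)" by (simp add: powr_mult)
      finally have "c0 * L powr (\<tau> + 1) \<le> (c0 * 2 powr (\<tau> + 1)) * real m powr (\<tau> + 1)"
        using c0 by simp
      also have "\<dots> \<le> c * real m powr (\<tau> + 1)" using c0 by (intro mult_right_mono) auto
      finally have "c0 * L powr (\<tau> + 1) * ln (real n) \<le> c * real m powr (\<tau> + 1) * ln (real n)"
        using n2 by (intro mult_right_mono) auto
      thus ?thesis using nc unfolding tau2 by simp
    qed
    have zone: "real n * q \<ge> \<kappa> * real k powr \<tau> * ln (real n)"
      if k: "k \<in> {1..<N}" and q: "q \<ge> c3 * ((real k / real N) powr (2 * a + 1) / real N)" and a: "a \<le> \<gamma>" for k q a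
    proof -
      \<comment> \<open>As k / N <= 1, a smaller exponent gives a larger power: the endpoint with
        the smaller parameter is the harmless one.\<close>
      have "(real k / N) powr \<tau> \<le> (real k / N) powr (2 * a + 1)"
        using k a unfolding \<tau>_def by (intro powr_mono') auto
      hence "c3 * ((real k / N) powr \<tau> / N) \<le> q"
        by (intro order_trans[OF _ q] mult_left_mono divide_right_mono) (use c3 in auto)
      also have "(real k / N) powr \<tau> / N = real k powr \<tau> / N powr (\<tau> + 1)"
        using Npos by (simp add: powr_divide powr_add)
      finally have 1: "c3 * (real k powr \<tau> / N powr (\<tau> + 1)) \<le> q" .
      have "N powr (\<tau> + 1) \<le> ((D + 3) * L) powr (\<tau> + 1)" using NU tau by (intro powr_mono2) auto
      also have "\<dots> = (D + 3) powr (\<tau> + 1) * L powr (\<tau> + 1)" using D L by (simp add: powr_mult)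
      finally have "real k powr \<tau> / ((D + 3) powr (\<tau> + 1) * L powr (\<tau> + 1)) \<le> real k powr \<tau> / N powr (\<tau> + 1)"
        using Npos D L by (intro divide_left_mono) (auto intro!: mult_pos_pos)
      hence 2: "c3 * (real k powr \<tau> / ((D + 3) powr (\<tau> + 1) * L powr (\<tau> + 1))) \<le> q"
        using c3 by (intro order_trans[OF _ 1] mult_left_mono) auto
      have "\<kappa> * real k powr \<tau> * ln (real n)
          = (c0 * L powr (\<tau> + 1) * ln (real n)) * (c3 * (real k powr \<tau> / ((D + 3) powr (\<tau> + 1) * L powr (\<tau> + 1))))"
        using L D by (simp add: \<kappa>_def)
      also have "\<dots> \<le> real n * q"
        using rate 2 c3 L by (intro mult_mono) auto
      finally show ?thesis .
    qed
    have sets_P: "B n A \<in> sets (P n)" if "A \<in> sets M" for A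
      unfolding B_def P_eq using that by measurable
    have A_sets: "A1 N k \<in> sets M" "A2 N k \<in> sets M" for k
      unfolding A1_def A2_def by (intro sets_M_I; simp)+
    have tail: "measure (P n) (B n A) \<le> exp (- (\<kappa> / 8) * ln (real n)) * exp (- (\<kappa> / 8 * ln 2) * real k powr \<tau>)"
      if A: "A \<in> sets M" and k: "k \<in> {1..<N}" and q: "real n * prob A \<ge> \<kappa> * real k powr \<tau> * ln (real n)" for A k
    proof -
      have "measure (P n) (B n A) \<le> exp (- (real n * prob A / 4))"
        unfolding B_def P_eq by (rule binomial_lower_tail[OF A])
      \<comment> \<open>The exponent (kappa / 4) k^tau ln n is halved: k^tau >= 1 gives the power
        n^(-kappa/8), and ln n >= ln 2 gives a summable term in k free of n.\<close>
      also have "\<dots> \<le> exp (- (\<kappa> / 8) * ln (real n) + - (\<kappa> / 8 * ln 2) * real k powr \<tau>)"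
      proof -
        have k1: "real k powr \<tau> \<ge> 1" using k tau by (intro ge_one_powr_ge_zero) auto
        have "\<kappa> / 8 * (ln (real n) * 1) \<le> \<kappa> / 8 * (ln (real n) * real k powr \<tau>)"
          using k1 kap n2 by (intro mult_left_mono) auto
        moreover have "\<kappa> / 8 * (ln 2 * real k powr \<tau>) \<le> \<kappa> / 8 * (ln (real n) * real k powr \<tau>)"
          using kap ln_n by (intro mult_left_mono mult_right_mono) auto
        moreover have "\<kappa> * real k powr \<tau> * ln (real n) = 8 * (\<kappa> / 8 * (ln (real n) * real k powr \<tau>))" by simp
        ultimately have "\<kappa> / 8 * ln (real n) + \<kappa> / 8 * ln 2 * real k powr \<tau> \<le> real n * prob A / 4"
          using q unfolding mult.assoc by linarith
        thus ?thesis by simp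
      qed
      finally show ?thesis by (simp only: exp_add)
    qed
    define T where "T = (\<lambda>k. exp (- (\<kappa> / 8) * ln (real n)) * exp (- (\<kappa> / 8 * ln 2) * real k powr \<tau>))"
    have t1: "measure (P n) (B n (A1 N k)) \<le> T k" and t2: "measure (P n) (B n (A2 N k)) \<le> T k" if k: "k \<in> {1..<N}" for k
    proof -
      have "c3 * ((real k / real N) powr (2 * \<alpha> + 1) / real N) \<le> prob (A1 N k)"
        using mult_right_mono[of c3 c1 "(real k / real N) powr (2 * \<alpha> + 1) / real N"] c3 z1[of k N] k
        by simp
      hence "\<kappa> * real k powr \<tau> * ln (real n) \<le> real n * prob (A1 N k)"
        using gam by (intro zone[OF k, of \<alpha>]) auto
      thus "measure (P n) (B n (A1 N k)) \<le> T k"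
        unfolding T_def by (intro tail A_sets k)
      have "c3 * ((real k / real N) powr (2 * \<beta> + 1) / real N) \<le> prob (A2 N k)"
        using mult_right_mono[of c3 c2 "(real k / real N) powr (2 * \<beta> + 1) / real N"] c3 z2[of k N] k
        by simp
      hence "\<kappa> * real k powr \<tau> * ln (real n) \<le> real n * prob (A2 N k)"
        using gam by (intro zone[OF k, of \<beta>]) auto
      thus "measure (P n) (B n (A2 N k)) \<le> T k"
        unfolding T_def by (intro tail A_sets k)
    qed
    have Tsum: "(\<Sum>k=1..<N. T k) \<le> S / real n powr (\<kappa> / 8)"
    proof -
      have "(\<Sum>k=1..<N. T k) = exp (- (\<kappa> / 8) * ln (real n)) * (\<Sum>k=1..<N. exp (- (\<kappa> / 8 * ln 2) * real k powr \<tau>))"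
        unfolding T_def by (rule sum_distrib_left[symmetric])
      also have "\<dots> \<le> exp (- (\<kappa> / 8) * ln (real n)) * S"
        unfolding S_def by (intro mult_left_mono sum_le_suminf summ) auto
      also have "exp (- (\<kappa> / 8) * ln (real n)) = 1 / real n powr (\<kappa> / 8)"
        using n2 by (simp add: powr_def exp_minus inverse_eq_divide)
      finally show ?thesis by simp
    qed
    define bad where "bad = (\<Union>k\<in>{1..<N}. B n (A1 N k)) \<union> (\<Union>k\<in>{1..<N}. B n (A2 N k))"
    have bad_sets: "bad \<in> sets (P n)" unfolding bad_def using sets_P A_sets by auto
    have "measure (P n) bad \<le> measure (P n) (\<Union>k\<in>{1..<N}. B n (A1 N k)) + measure (P n) (\<Union>k\<in>{1..<N}. B n (A2 N k))"
      unfolding bad_def by (intro measure_Un_le sets.finite_UN) (auto intro: sets_P A_sets)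
    also have "\<dots> \<le> (\<Sum>k=1..<N. measure (P n) (B n (A1 N k))) + (\<Sum>k=1..<N. measure (P n) (B n (A2 N k)))"
      by (intro add_mono measure_UNION_le) (auto intro: sets_P A_sets)
    also have "\<dots> \<le> (\<Sum>k=1..<N. T k) + (\<Sum>k=1..<N. T k)" by (intro add_mono sum_mono t1 t2)
    also have "\<dots> \<le> 2 * S / real n powr (\<kappa> / 8)" using Tsum by simp
    also have "\<dots> \<le> (2 * S + 1) / real n powr (\<kappa> / 8)" by (intro divide_right_mono) auto
    finally have bad: "measure (P n) bad \<le> (2 * S + 1) / real n powr (\<kappa> / 8)" .
    show ?thesis
    proof (intro bexI[of _ "space (P n) - bad"] conjI ballI)
      show "space (P n) - bad \<in> sets (P n)" using bad_sets by auto
      show "1 - (2 * S + 1) / real n powr (\<kappa> / 8) \<le> measure (P n) (space (P n) - bad)"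
        using bad by (simp add: P.prob_compl[OF bad_sets])
      fix x assume x: "x \<in> space (P n) - bad"
      show "cond_number M m n x \<le> ereal K"
        by (rule cond[rule_format, OF mn N2 ND]) (use x in \<open>auto simp: bad_def B_def not_le\<close>)
    qed
  qed
  show ?thesis
    unfolding ls_stable_def
    by (rule exI[of _ K], rule conjI[OF K], rule exI[of _ "2 * S + 1"], rule conjI, use S0 in simp,
        rule exI[of _ "\<kappa> / 8"], rule conjI, use kap in simp) (use main in auto)
qed

end

section \<open>Necessity of the sampling rate\<close>

lemma jordan_sin_ge:
  fixes y :: real
  assumes "0 \<le> y" "y \<le> pi / 2"
  shows "2 / pi * y \<le> sin y"
proof -
  \<comment> \<open>The sine is concave on this interval and lies above its chord from 0 to
    pi/2.\<close>
  have conv: "convex_on {0..pi} (\<lambda>x. - sin x)"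
    by (rule f''_ge0_imp_convex[where f' = "\<lambda>x. - cos x" and f'' = sin])
       (auto intro!: derivative_eq_intros sin_ge_zero)
  have "- sin ((1 - 2 / pi * y) *\<^sub>R 0 + (2 / pi * y) *\<^sub>R (pi / 2))
      \<le> (1 - 2 / pi * y) * (- sin 0) + (2 / pi * y) * (- sin (pi / 2))"
    by (rule convex_onD[OF conv]) (use assms in \<open>auto simp: field_simps\<close>)
  thus ?thesis by simp
qed

text \<open>The Fejer kernel as a polynomial in \<open>cos t\<close>, see \<open>fejer_cos\<close>.\<close>

fun fejer :: "nat \<Rightarrow> real poly" where
  "fejer 0 = 0"
| "fejer (Suc 0) = 1"
| "fejer (Suc (Suc k)) = [:2:] + [:0, 2:] * fejer (Suc k) - fejer k"

lemma degree_fejer: "degree (fejer k) \<le> k"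
proof (induction k rule: fejer.induct)
  case (3 k)
  have "degree ([:0, 2:] * fejer (Suc k)) \<le> 1 + Suc k"
    by (rule order_trans[OF degree_mult_le]) (use 3 in auto)
  thus ?case using 3 unfolding fejer.simps by (intro degree_diff_le degree_add_le) auto
qed auto

text \<open>For cos t different from 1 the value at cos t is (sin (k t / 2) / sin (t / 2))^2. The
  recursion of \<open>fejer\<close> is that of 1 - cos (k t), from cos ((k + 2) t) + cos (k t) = 2
  cos t cos ((k + 1) t).\<close>

lemma fejer_cos: "(1 - cos t) * poly (fejer k) (cos t) = 1 - cos (real k * t)"
proof (induction k rule: fejer.induct)
  case (3 k)
  have A: "cos (real (Suc (Suc k)) * t) = 2 * cos t * cos (real (Suc k) * t) - cos (real k * t)"
  proof -
    have "cos (real (Suc k) * t + t) + cos (real (Suc k) * t - t) = 2 * cos t * cos (real (Suc k) * t)"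
      by (simp add: cos_add cos_diff)
    moreover have "real (Suc k) * t + t = real (Suc (Suc k)) * t" "real (Suc k) * t - t = real k * t"
      by (simp_all add: algebra_simps)
    ultimately show ?thesis by simp
  qed
  have B: "(1 - cos t) * poly (fejer (Suc (Suc k))) (cos t)
      = 2 * (1 - cos t) + 2 * cos t * ((1 - cos t) * poly (fejer (Suc k)) (cos t))
        - (1 - cos t) * poly (fejer k) (cos t)"
    by (simp add: algebra_simps)
  show ?case unfolding B 3 A by (simp add: algebra_simps)
qed auto

lemma fejer_upper:
  assumes "x \<in> {-1..<1}"
  shows "0 \<le> poly (fejer k) x" "poly (fejer k) x \<le> 2 / (1 - x)"
proof -
  have x: "cos (arccos x) = x" using assms by (intro cos_arccos) auto
  have e: "(1 - x) * poly (fejer k) x = 1 - cos (real k * arccos x)"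
    using fejer_cos[of "arccos x" k] unfolding x .
  have "0 \<le> (1 - x) * poly (fejer k) x" unfolding e by simp
  thus "0 \<le> poly (fejer k) x" using assms by (simp add: zero_le_mult_iff)
  have "(1 - x) * poly (fejer k) x \<le> 2" unfolding e using cos_ge_minus_one[of "real k * arccos x"] by linarith
  thus "poly (fejer k) x \<le> 2 / (1 - x)" using assms by (simp add: field_simps)
qed

text \<open>With x = cos t, the assumption forces k t <= pi, where 1 - cos (k t) >= 2 (k t)^2 /
  pi^2, while 1 - x <= t^2 / 2. The quotient is at least 4 k^2 / pi^2, and pi < 4 gives k^2 /
  4.\<close>

lemma fejer_lower:
  assumes x: "x < 1" "1 - x \<le> 1 / (real k)\<^sup>2" and k: "k \<ge> 1"
  shows "(real k)\<^sup>2 / 4 \<le> poly (fejer k) x"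
proof -
  define t where "t = arccos x"
  have k2: "1 / (real k)\<^sup>2 \<le> 1" using k by simp
  have x1: "-1 \<le> x" using x k2 by linarith
  have ct: "cos t = x" unfolding t_def using x1 x by (intro cos_arccos) auto
  have t: "0 \<le> t" "t \<le> pi" unfolding t_def using x1 x by (auto intro: arccos_lbound arccos_ubound)
  have half: "1 - cos y = 2 * (sin (y / 2))\<^sup>2" for y :: real
    using cos_double_sin[of "y / 2"] by simp
  have jor: "2 * y\<^sup>2 / pi\<^sup>2 \<le> 1 - cos y" if "0 \<le> y" "y \<le> pi" for y
  proof -
    have "(2 / pi * (y / 2))\<^sup>2 \<le> (sin (y / 2))\<^sup>2"
      using that by (intro power_mono jordan_sin_ge) auto
    thus ?thesis unfolding half by (simp add: power_divide power_mult_distrib)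
  qed
  have "2 * t\<^sup>2 / pi\<^sup>2 \<le> 1 / (real k)\<^sup>2" using jor[OF t] x ct by linarith
  hence "2 * (t * real k)\<^sup>2 \<le> pi\<^sup>2" using k by (simp add: field_simps power_mult_distrib)
  moreover have "(t * real k)\<^sup>2 \<le> 2 * (t * real k)\<^sup>2" by simp
  ultimately have "(t * real k)\<^sup>2 \<le> pi\<^sup>2" by linarith
  hence kt: "real k * t \<le> pi" using t by (simp add: mult.commute power2_le_iff_abs_le)
  have xt: "1 - x \<le> t\<^sup>2 / 2"
  proof -
    have "(sin (t / 2))\<^sup>2 \<le> (t / 2)\<^sup>2"
      using abs_sin_x_le_abs_x[of "t / 2"] abs_le_square_iff by blast
    thus ?thesis using half[of t] ct by (simp add: power_divide)
  qed
  have pi4: "pi\<^sup>2 \<le> 16"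
    using pi_less_4 power_mono[of pi 4 2] by simp
  have "(1 - x) * ((real k)\<^sup>2 / 4) = 2 * (2 * (1 - x)) * (real k)\<^sup>2 / 16" by simp
  also have "\<dots> \<le> 2 * (2 * (1 - x)) * (real k)\<^sup>2 / pi\<^sup>2"
    using pi4 x by (intro divide_left_mono) auto
  also have "\<dots> \<le> 2 * t\<^sup>2 * (real k)\<^sup>2 / pi\<^sup>2"
    using xt by (intro divide_right_mono mult_right_mono mult_left_mono) auto
  also have "\<dots> = 2 * (real k * t)\<^sup>2 / pi\<^sup>2" by (simp add: power_mult_distrib)
  also have "\<dots> \<le> 1 - cos (real k * t)" using kt t by (intro jor) auto
  also have "\<dots> = (1 - x) * poly (fejer k) x" using fejer_cos[of t k] unfolding ct by simp
  finally show ?thesis using x by simp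
qed

section \<open>Polynomials whose mass concentrates near an endpoint\<close>

context jacobi
begin

lemma cap_mass:
  "\<exists>C>0. \<forall>h. 0 < h \<longrightarrow> h \<le> 1 \<longrightarrow> prob ({1 - h<..1} \<inter> {-1..1}) \<le> C * h powr (\<alpha> + 1)"
proof -
  define C where "C = 2 powr \<bar>\<beta>\<bar> / (Z * (\<alpha> + 1))"
  have C: "C > 0" using Z_pos al by (simp add: C_def)
  show ?thesis
  proof (rule exI[of _ C], intro conjI C allI impI)
    fix h :: real assume h: "0 < h" "h \<le> 1"
    have "((\<lambda>t. t powr \<alpha>) has_integral h powr (\<alpha> + 1) / (\<alpha> + 1)) (cbox 0 h)"
      using has_integral_powr_from_0[of \<alpha> h] al h by simp
    from has_integral_affinity[OF this, of "-1" 1]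
    have "((\<lambda>x. (1 - x) powr \<alpha>) has_integral h powr (\<alpha> + 1) / (\<alpha> + 1)) ((\<lambda>x. 1 - x) ` {0..h})"
      by simp
    also have "(\<lambda>x. 1 - x) ` {0..h} = {1 - h..1}"
      by (force simp: image_iff intro: bexI[of _ "1 - _"])
    finally have "((\<lambda>x. 2 powr \<bar>\<beta>\<bar> / Z * (1 - x) powr \<alpha>) has_integral 2 powr \<bar>\<beta>\<bar> / Z * (h powr (\<alpha> + 1) / (\<alpha> + 1))) {1 - h..1}"
      by (rule has_integral_mult_right)
    hence I: "(\<integral>\<^sup>+x. ennreal (2 powr \<bar>\<beta>\<bar> / Z * (1 - x) powr \<alpha>) * indicator {1 - h..1} x \<partial>lborel)
        = ennreal (C * h powr (\<alpha> + 1))"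
      using Z_pos by (subst nn_integral_has_integral_lebesgue') (auto simp: C_def)
    have "emeasure M ({1 - h<..1} \<inter> {-1..1}) = (\<integral>\<^sup>+x. indicator ({1 - h<..1} \<inter> {-1..1}) x \<partial>M)"
      using sets_M_I[of "{1 - h<..1}"] by simp
    also have "\<dots> = (\<integral>\<^sup>+x. ennreal (w x / Z) * indicator ({1 - h<..1} \<inter> {-1..1}) x * indicator {-1..1} x \<partial>lborel)"
      by (rule nn_M) auto
    also have "\<dots> \<le> (\<integral>\<^sup>+x. ennreal (2 powr \<bar>\<beta>\<bar> / Z * (1 - x) powr \<alpha>) * indicator {1 - h..1} x \<partial>lborel)"
    proof (intro nn_integral_mono)
      fix x :: real
      show "ennreal (w x / Z) * indicator ({1 - h<..1} \<inter> {-1..1}) x * indicator {-1..1} x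
          \<le> ennreal (2 powr \<bar>\<beta>\<bar> / Z * (1 - x) powr \<alpha>) * indicator {1 - h..1} x"
        using w_right_bounds(2)[of x] h Z_pos
        by (auto simp: indicator_def intro!: ennreal_leI divide_right_mono)
    qed
    also note I
    finally show "prob ({1 - h<..1} \<inter> {-1..1}) \<le> C * h powr (\<alpha> + 1)"
      using C unfolding emeasure_eq_measure by (subst (asm) ennreal_le_iff) auto
  qed
qed

text \<open>The exponent is set so that multiplication by (1 - x)^alpha leaves (1 - x)^(-s-1), whose
  integral up to distance h from 1 is of order h^(-s).\<close>

lemma tail_integral:
  fixes s :: real
  assumes s: "s > 0"
  shows "\<exists>C>0. \<forall>h. 0 < h \<longrightarrow> h \<le> 1 \<longrightarrow>
     (\<integral>\<^sup>+x. ennreal ((1 - x) powr (- (s + \<alpha> + 1))) * indicator (- {1 - h<..}) x \<partial>M) \<le> ennreal (C * h powr (- s))"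
proof -
  \<comment> \<open>The summand 1 covers [-1,0), where the power is at most 1, hence the integral at
    most 1 <= h^(-s).\<close>
  define C where "C = 2 powr \<bar>\<beta>\<bar> / (Z * s) + 1"
  have C: "C > 0" unfolding C_def using Z_pos s by (intro add_nonneg_pos) auto
  show ?thesis
  proof (rule exI[of _ C], intro conjI C allI impI)
    fix h :: real assume h: "0 < h" "h \<le> 1"
    let ?f = "\<lambda>x. (1 - x) powr (- (s + \<alpha> + 1))"
    have "((\<lambda>x. 2 powr \<bar>\<beta>\<bar> / Z * (1 - x) powr (- s - 1)) has_integral
        2 powr \<bar>\<beta>\<bar> / Z * ((1 - (1 - h)) powr (- s) / s) - 2 powr \<bar>\<beta>\<bar> / Z * ((1 - 0) powr (- s) / s)) {0..1 - h}"
    proof (rule fundamental_theorem_of_calculus)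
      fix x assume x: "x \<in> {0..1 - h}"
      have "((\<lambda>x. 2 powr \<bar>\<beta>\<bar> / Z * ((1 - x) powr (- s) / s)) has_real_derivative
          2 powr \<bar>\<beta>\<bar> / Z * (1 - x) powr (- s - 1)) (at x)"
        using x h s Z_pos by (auto intro!: derivative_eq_intros)
      thus "((\<lambda>x. 2 powr \<bar>\<beta>\<bar> / Z * ((1 - x) powr (- s) / s)) has_vector_derivative
          2 powr \<bar>\<beta>\<bar> / Z * (1 - x) powr (- s - 1)) (at x within {0..1 - h})"
        by (simp add: has_real_derivative_iff_has_vector_derivative has_vector_derivative_at_within)
    qed (use h in simp)
    hence I: "(\<integral>\<^sup>+x. ennreal (2 powr \<bar>\<beta>\<bar> / Z * (1 - x) powr (- s - 1)) * indicator {0..1 - h} x \<partial>lborel)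
        = ennreal (2 powr \<bar>\<beta>\<bar> / Z * ((1 - (1 - h)) powr (- s) / s) - 2 powr \<bar>\<beta>\<bar> / Z * ((1 - 0) powr (- s) / s))"
      using Z_pos by (subst nn_integral_has_integral_lebesgue') auto
    have "(\<integral>\<^sup>+x. ennreal (?f x) * indicator (- {1 - h<..}) x \<partial>M)
        = (\<integral>\<^sup>+x. ennreal (w x / Z) * (ennreal (?f x) * indicator (- {1 - h<..}) x) * indicator {-1..1} x \<partial>lborel)"
      by (rule nn_M) measurable
    also have "\<dots> \<le> (\<integral>\<^sup>+x. ennreal (2 powr \<bar>\<beta>\<bar> / Z * (1 - x) powr (- s - 1)) * indicator {0..1 - h} x
          + ennreal (w x / Z) * 1 * indicator {-1..1} x \<partial>lborel)"
    proof (intro nn_integral_mono)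
      fix x :: real
      consider "x \<in> {0..1 - h}" | "x \<in> {-1..<0}" | "x \<notin> {-1..1 - h}" by fastforce
      thus "ennreal (w x / Z) * (ennreal (?f x) * indicator (- {1 - h<..}) x) * indicator {-1..1} x
          \<le> ennreal (2 powr \<bar>\<beta>\<bar> / Z * (1 - x) powr (- s - 1)) * indicator {0..1 - h} x
          + ennreal (w x / Z) * 1 * indicator {-1..1} x"
      proof cases
        case 1
        have "w x / Z * ?f x \<le> (2 powr \<bar>\<beta>\<bar> * (1 - x) powr \<alpha>) / Z * ?f x"
          using w_right_bounds(2)[of x] 1 h Z_pos by (intro mult_right_mono divide_right_mono) auto
        also have "\<dots> = 2 powr \<bar>\<beta>\<bar> / Z * ((1 - x) powr \<alpha> * ?f x)" by simp
        also have "(1 - x) powr \<alpha> * ?f x = (1 - x) powr (- s - 1)" by (simp flip: powr_add)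
        finally have "ennreal (w x / Z * ?f x) \<le> ennreal (2 powr \<bar>\<beta>\<bar> / Z * (1 - x) powr (- s - 1))"
          by (rule ennreal_leI)
        moreover have "ennreal (w x / Z) * ennreal (?f x) = ennreal (w x / Z * ?f x)"
          using Z_pos w_nonneg[of x] by (subst ennreal_mult[symmetric]) auto
        ultimately show ?thesis using 1 h by (auto simp: indicator_def intro: order_trans)
      next
        case 2
        have "?f x \<le> 1 powr (- (s + \<alpha> + 1))" using 2 s al by (intro powr_mono2') auto
        hence "ennreal (w x / Z) * ennreal (?f x) \<le> ennreal (w x / Z) * 1"
          by (intro mult_left_mono) (auto simp: ennreal_le_1)
        thus ?thesis using 2 h by (auto simp: indicator_def)
      next
        case 3
        thus ?thesis by (auto simp: indicator_def)
      qed
    qed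
    also have "\<dots> = (\<integral>\<^sup>+x. ennreal (2 powr \<bar>\<beta>\<bar> / Z * (1 - x) powr (- s - 1)) * indicator {0..1 - h} x \<partial>lborel)
        + (\<integral>\<^sup>+x. ennreal (w x / Z) * 1 * indicator {-1..1} x \<partial>lborel)"
      by (rule nn_integral_add) measurable
    also have "(\<integral>\<^sup>+x. ennreal (w x / Z) * 1 * indicator {-1..1} x \<partial>lborel) = (\<integral>\<^sup>+x. 1 \<partial>M)"
      by (rule nn_M[symmetric]) auto
    also have "\<dots> = ennreal 1" by (simp add: emeasure_space_1)
    also have "(\<integral>\<^sup>+x. ennreal (2 powr \<bar>\<beta>\<bar> / Z * (1 - x) powr (- s - 1)) * indicator {0..1 - h} x \<partial>lborel)
        \<le> ennreal (2 powr \<bar>\<beta>\<bar> / (Z * s) * h powr (- s))"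
      unfolding I using Z_pos s by (intro ennreal_leI) auto
    also have "ennreal (2 powr \<bar>\<beta>\<bar> / (Z * s) * h powr (- s)) + ennreal 1
        \<le> ennreal (2 powr \<bar>\<beta>\<bar> / (Z * s) * h powr (- s)) + ennreal (1 * h powr (- s))"
    proof -
      have "1 powr (- s) \<le> h powr (- s)" using h s by (intro powr_mono2') auto
      thus ?thesis by (intro add_left_mono ennreal_leI) auto
    qed
    also have "\<dots> = ennreal (C * h powr (- s))"
      using Z_pos s by (subst ennreal_plus[symmetric]) (auto simp: C_def distrib_right)
    finally show "(\<integral>\<^sup>+x. ennreal (?f x) * indicator (- {1 - h<..}) x \<partial>M) \<le> ennreal (C * h powr (- s))" by simp
  qed
qed

text \<open>All but a fraction epsilon of the mass of p^2 lies in a set J of probability at most B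
  m^(-2 (1 + g)), where B may depend on epsilon but not on m. The exponent g is left open so that
  the endpoint realizing gamma can be chosen at the end.\<close>

definition peaked :: "real \<Rightarrow> bool" where
  "peaked g \<longleftrightarrow> (\<forall>\<epsilon>>0. \<exists>B>0. \<exists>m0. \<forall>m\<ge>m0. \<exists>(p::real poly) J. degree p \<le> m \<and> J \<in> sets borel \<and>
     measure M (J \<inter> {-1..1}) * real m powr (2 * (1 + g)) \<le> B \<and>
     (\<integral>\<^sup>+x. ennreal ((poly p x)\<^sup>2) \<partial>M) > 0 \<and>
     (\<integral>\<^sup>+x. ennreal ((poly p x)\<^sup>2) * indicator (- J) x \<partial>M) \<le> ennreal \<epsilon> * (\<integral>\<^sup>+x. ennreal ((poly p x)\<^sup>2) \<partial>M))"

text \<open>For p = F^r, with F the Fejer polynomial of index k = m div r, p^2 is at least of order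
  k^(4r) within distance 1 / k^2 of 1 and at most (2 / (1 - x))^(2r) away from 1. Beyond distance A
  / k^2 only a fraction of order A^(-s) of the mass remains, so A is taken large.\<close>

lemma peaked_right: "peaked \<alpha>"
  unfolding peaked_def
proof (intro allI impI)
  fix \<epsilon> :: real assume eps: "\<epsilon> > 0"
  obtain r :: nat where r: "2 * real r > \<alpha> + 1" "r \<ge> 1"
  proof -
    obtain r :: nat where "real r > (\<bar>\<alpha>\<bar> + 1)" using reals_Archimedean2 by blast
    thus ?thesis using that[of r] by auto
  qed
  \<comment> \<open>The decay exponent of the tail; its positivity is what r was chosen for.\<close>
  define s where "s = 2 * real r - (\<alpha> + 1)"
  have s: "s > 0" using r by (simp add: s_def)
  obtain C1 where C1: "C1 > 0" and tail: "\<And>h. 0 < h \<Longrightarrow> h \<le> 1 \<Longrightarrow>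
     (\<integral>\<^sup>+x. ennreal ((1 - x) powr (- (s + \<alpha> + 1))) * indicator (- {1 - h<..}) x \<partial>M) \<le> ennreal (C1 * h powr (- s))"
    using tail_integral[OF s] by blast
  obtain C2 where C2: "C2 > 0" and cap: "\<And>h. 0 < h \<Longrightarrow> h \<le> 1 \<Longrightarrow> prob ({1 - h<..1} \<inter> {-1..1}) \<le> C2 * h powr (\<alpha> + 1)"
    using cap_mass by blast
  obtain c1 where c1: "c1 > 0" and zone: "\<And>N k. 1 \<le> k \<Longrightarrow> k < N \<Longrightarrow>
     c1 * ((real k / real N) powr (2 * \<alpha> + 1) / real N)
       \<le> prob ({1 - (real (Suc k) / real N)\<^sup>2<..1 - (real k / real N)\<^sup>2} \<inter> {-1..1})"
    using zone_mass by blast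
  define c4 where "c4 = (1/4) ^ (2 * r) * (c1 * 2 powr (- (2 * \<alpha> + 2)))"
  have c4: "c4 > 0" using c1 by (simp add: c4_def)
  \<comment> \<open>The admissible size of A^(-s): epsilon times the constant \<open>c4\<close> of
    the lower bound on the whole integral, divided by the constant of the tail bound.\<close>
  define \<delta> where "\<delta> = \<epsilon> * c4 / (2 ^ (2 * r) * C1)"
  have del: "\<delta> > 0" unfolding \<delta>_def using eps c4 C1 by simp
  obtain A where A: "A \<ge> 1" "A powr (- s) \<le> \<delta>"
  proof -
    have "((\<lambda>A::real. A powr (- s)) \<longlongrightarrow> 0) at_top" using s by real_asymp
    hence "eventually (\<lambda>A. A powr (- s) < \<delta>) at_top" using del by (rule order_tendstoD)
    moreover have "eventually (\<lambda>A::real. A \<ge> 1) at_top" by (rule eventually_ge_at_top)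
    ultimately have "eventually (\<lambda>A. A powr (- s) < \<delta> \<and> A \<ge> 1) at_top" by eventually_elim auto
    then obtain A where "A powr (- s) < \<delta> \<and> A \<ge> 1" using eventually_happens by fastforce
    thus ?thesis using that[of A] by auto
  qed
  define B where "B = C2 * A powr (\<alpha> + 1) * (2 * real r) powr (2 * \<alpha> + 2)"
  have B: "B > 0" unfolding B_def using C2 A r by simp
  \<comment> \<open>Ensures k >= A >= 1, so that the cap radius A / k^2 is at most 1.\<close>
  define m0 where "m0 = r * nat \<lceil>A\<rceil>"
  show "\<exists>B>0. \<exists>m0. \<forall>m\<ge>m0. \<exists>(p::real poly) J. degree p \<le> m \<and> J \<in> sets borel \<and>
     measure M (J \<inter> {-1..1}) * real m powr (2 * (1 + \<alpha>)) \<le> B \<and>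
     (\<integral>\<^sup>+x. ennreal ((poly p x)\<^sup>2) \<partial>M) > 0 \<and>
     (\<integral>\<^sup>+x. ennreal ((poly p x)\<^sup>2) * indicator (- J) x \<partial>M) \<le> ennreal \<epsilon> * (\<integral>\<^sup>+x. ennreal ((poly p x)\<^sup>2) \<partial>M)"
  proof (rule exI[of _ B], rule conjI[OF B], rule exI[of _ m0], intro allI impI)
    fix m assume m: "m \<ge> m0"
    define k where "k = m div r"
    have "m0 div r \<le> k" unfolding k_def using m by (rule div_le_mono)
    hence kA: "real k \<ge> A" unfolding m0_def using r by simp
    hence k1: "real k \<ge> 1" using A by linarith
    have kr: "k * r \<le> m" by (simp add: k_def)
    have km: "real m \<le> 2 * real r * real k"
    proof -
      have "m = k * r + m mod r" by (simp add: k_def)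
      moreover have "m mod r < r" using r by simp
      moreover have "r * 1 \<le> r * k" using k1 by (intro mult_le_mono2) simp
      moreover have "2 * r * k = k * r + r * k" by (simp add: mult.commute)
      ultimately have "m \<le> 2 * r * k" by linarith
      thus ?thesis by (metis of_nat_le_iff of_nat_mult of_nat_numeral)
    qed
    define h where "h = A / (real k)\<^sup>2"
    have h0: "h > 0" using A k1 by (simp add: h_def)
    have h1: "h \<le> 1"
    proof -
      have "A * 1 \<le> real k * real k" using kA k1 A by (intro mult_mono) auto
      thus ?thesis using k1 by (simp add: h_def power2_eq_square)
    qed
    have hp: "h powr a = A powr a * real k powr (- (2 * a))" for a
    proof -
      have "(real k)\<^sup>2 powr a = real k powr (2 * a)"
        using k1 by (simp add: powr_powr flip: powr_numeral)
      thus ?thesis unfolding h_def using A k1 by (simp add: powr_divide powr_minus_divide)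
    qed
    define p where "p = fejer k ^ r"
    define I where "I = (\<integral>\<^sup>+x. ennreal ((poly p x)\<^sup>2) \<partial>M)"
    have psq: "(poly p x)\<^sup>2 = poly (fejer k) x ^ (2 * r)" for x
      by (simp add: p_def poly_power mult.commute flip: power_mult)
    have deg: "degree p \<le> m"
      unfolding p_def using degree_power_le[of "fejer k" r] degree_fejer[of k] kr
      by (meson le_trans mult_le_mono1)
    have low: "ennreal (c4 * real k powr (2 * s)) \<le> I"
    proof -
      \<comment> \<open>Zone 1 for N = 2 k: the points whose distance from 1 lies between 1 / (4
        k^2) and 1 / k^2, where \<open>fejer_lower\<close> applies.\<close>
      let ?Zn = "{1 - (real (Suc 1) / real (2 * k))\<^sup>2<..1 - (real 1 / real (2 * k))\<^sup>2} \<inter> {-1..1}"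
      have zn: "?Zn \<in> sets M" by (rule sets_M_I) simp
      have z: "c1 * ((real 1 / real (2 * k)) powr (2 * \<alpha> + 1) / real (2 * k)) \<le> prob ?Zn"
        using zone[of 1 "2 * k"] k1 by simp
      have pz: "((real k)\<^sup>2 / 4) ^ (2 * r) \<le> (poly p x)\<^sup>2" if "x \<in> ?Zn" for x
      proof -
        have "0 < (real 1 / real (2 * k))\<^sup>2" using k1 by simp
        hence "x < 1" using that by (simp only: Int_iff greaterThanAtMost_iff) linarith
        moreover have "1 - x \<le> 1 / (real k)\<^sup>2" using that by (auto simp: power_divide)
        ultimately have "(real k)\<^sup>2 / 4 \<le> poly (fejer k) x" using k1 by (intro fejer_lower) auto
        thus ?thesis unfolding psq by (intro power_mono) auto
      qed
      have "c4 * real k powr (2 * s) = ((real k)\<^sup>2 / 4) ^ (2 * r) * (c1 * ((real 1 / real (2 * k)) powr (2 * \<alpha> + 1) / real (2 * k)))"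
      proof -
        have "((real k)\<^sup>2 / 4) ^ (2 * r) = (1/4) ^ (2 * r) * real k powr (4 * real r)"
          using k1 by (simp add: power_divide powr_realpow[symmetric] powr_powr flip: power_mult powr_numeral)
        moreover have "(real 1 / real (2 * k)) powr (2 * \<alpha> + 1) / real (2 * k) = 2 powr (- (2 * \<alpha> + 2)) * real k powr (- (2 * \<alpha> + 2))"
        proof -
          have "(real 1 / real (2 * k)) powr (2 * \<alpha> + 1) / real (2 * k) = (2 * real k) powr (- (2 * \<alpha> + 1)) * (2 * real k) powr (-1)"
          proof -
            have "(real 1 / real (2 * k)) powr (2 * \<alpha> + 1) = (2 * real k) powr (- (2 * \<alpha> + 1))"
              using k1 by (simp only: powr_minus_divide) (simp add: powr_divide)
            moreover have "(2 * real k) powr (-1) = 1 / real (2 * k)"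
              using k1 by (simp only: powr_minus_divide) simp
            ultimately show ?thesis by simp
          qed
          also have "\<dots> = (2 * real k) powr (- (2 * \<alpha> + 2))"
            unfolding powr_add[symmetric] by (simp add: algebra_simps)
          finally show ?thesis by (simp add: powr_mult)
        qed
        moreover have "real k powr (2 * s) = real k powr (4 * real r) * real k powr (- (2 * \<alpha> + 2))"
          unfolding powr_add[symmetric] by (simp add: s_def algebra_simps)
        ultimately show ?thesis by (simp add: c4_def)
      qed
      also have "\<dots> \<le> ((real k)\<^sup>2 / 4) ^ (2 * r) * prob ?Zn" using z by (intro mult_left_mono) auto
      also have "ennreal \<dots> = ennreal (((real k)\<^sup>2 / 4) ^ (2 * r)) * emeasure M ?Zn"
        unfolding emeasure_eq_measure by (simp add: ennreal_mult)
      also have "\<dots> = (\<integral>\<^sup>+x. ennreal (((real k)\<^sup>2 / 4) ^ (2 * r)) * indicator ?Zn x \<partial>M)"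
        using zn by (rule nn_integral_cmult_indicator[symmetric])
      also have "\<dots> \<le> I"
        unfolding I_def
      proof (intro nn_integral_mono)
        fix x
        show "ennreal (((real k)\<^sup>2 / 4) ^ (2 * r)) * indicator ?Zn x \<le> ennreal ((poly p x)\<^sup>2)"
          using pz[of x] by (cases "x \<in> ?Zn") (auto intro!: ennreal_leI)
      qed
      finally show ?thesis by (simp add: ennreal_leI)
    qed
    have up: "(\<integral>\<^sup>+x. ennreal ((poly p x)\<^sup>2) * indicator (- {1 - h<..}) x \<partial>M) \<le> ennreal (2 ^ (2 * r) * (C1 * h powr (- s)))"
    proof -
      have "(\<integral>\<^sup>+x. ennreal ((poly p x)\<^sup>2) * indicator (- {1 - h<..}) x \<partial>M)
          \<le> (\<integral>\<^sup>+x. ennreal (2 ^ (2 * r)) * (ennreal ((1 - x) powr (- (s + \<alpha> + 1))) * indicator (- {1 - h<..}) x) \<partial>M)"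
      proof (intro nn_integral_mono)
        fix x assume "x \<in> space M"
        hence x: "x \<ge> -1" by (simp add: space_M)
        show "ennreal ((poly p x)\<^sup>2) * indicator (- {1 - h<..}) x
            \<le> ennreal (2 ^ (2 * r)) * (ennreal ((1 - x) powr (- (s + \<alpha> + 1))) * indicator (- {1 - h<..}) x)"
        proof (cases "x \<le> 1 - h")
          case True
          hence x1: "x \<in> {-1..<1}" using x h0 by auto
          have "(poly p x)\<^sup>2 \<le> (2 / (1 - x)) ^ (2 * r)"
            unfolding psq using fejer_upper[OF x1] by (intro power_mono)
          also have "\<dots> = 2 ^ (2 * r) * (1 - x) powr (- (s + \<alpha> + 1))"
          proof -
            have "(1 - x) ^ (2 * r) = (1 - x) powr (s + \<alpha> + 1)"
              using x1 by (subst powr_realpow[symmetric]) (auto simp: s_def)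
            thus ?thesis by (simp only: power_divide powr_minus_divide times_divide_eq_right mult_1_right)
          qed
          finally show ?thesis using True
            by (auto simp: indicator_def ennreal_mult[symmetric] intro!: ennreal_leI)
        qed (auto simp: indicator_def)
      qed
      also have "\<dots> = ennreal (2 ^ (2 * r)) * (\<integral>\<^sup>+x. ennreal ((1 - x) powr (- (s + \<alpha> + 1))) * indicator (- {1 - h<..}) x \<partial>M)"
        by (intro nn_integral_cmult borel_M) measurable
      also have "\<dots> \<le> ennreal (2 ^ (2 * r)) * ennreal (C1 * h powr (- s))"
        using tail[OF h0 h1] by (intro mult_left_mono) auto
      finally show ?thesis using C1 by (simp add: ennreal_mult)
    qed
    have "(\<integral>\<^sup>+x. ennreal ((poly p x)\<^sup>2) * indicator (- {1 - h<..}) x \<partial>M) \<le> ennreal \<epsilon> * I"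
    proof -
      have "2 ^ (2 * r) * (C1 * h powr (- s)) = 2 ^ (2 * r) * C1 * A powr (- s) * real k powr (2 * s)"
        by (simp add: hp)
      also have "\<dots> \<le> 2 ^ (2 * r) * C1 * \<delta> * real k powr (2 * s)"
        using A C1 by (intro mult_right_mono mult_left_mono) auto
      also have "\<dots> = \<epsilon> * (c4 * real k powr (2 * s))" using C1 by (simp add: \<delta>_def)
      finally have "(\<integral>\<^sup>+x. ennreal ((poly p x)\<^sup>2) * indicator (- {1 - h<..}) x \<partial>M) \<le> ennreal (\<epsilon> * (c4 * real k powr (2 * s)))"
        by (intro order_trans[OF up] ennreal_leI)
      also have "\<dots> = ennreal \<epsilon> * ennreal (c4 * real k powr (2 * s))" using eps c4 by (simp add: ennreal_mult)
      also have "\<dots> \<le> ennreal \<epsilon> * I" by (intro mult_left_mono low) auto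
      finally show ?thesis .
    qed
    moreover have "I > 0"
    proof -
      have "c4 * real k powr (2 * s) > 0" using c4 k1 by simp
      hence "0 < ennreal (c4 * real k powr (2 * s))" by simp
      thus ?thesis using low by (rule less_le_trans)
    qed
    moreover have "measure M ({1 - h<..} \<inter> {-1..1}) * real m powr (2 * (1 + \<alpha>)) \<le> B"
    proof -
      have "{1 - h<..} \<inter> {-1..1} = {1 - h<..1} \<inter> {-1..1}" by auto
      hence "measure M ({1 - h<..} \<inter> {-1..1}) * real m powr (2 * (1 + \<alpha>))
          \<le> (C2 * h powr (\<alpha> + 1)) * (2 * real r * real k) powr (2 * (1 + \<alpha>))"
        using cap[OF h0 h1] C2 km al by (intro mult_mono powr_mono2) auto
      also have "\<dots> = (C2 * A powr (\<alpha> + 1) * (2 * real r) powr (2 * \<alpha> + 2)) * (real k powr (- (2 * (\<alpha> + 1))) * real k powr (2 * (1 + \<alpha>)))"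
        unfolding hp by (simp add: powr_mult algebra_simps)
      also have "real k powr (- (2 * (\<alpha> + 1))) * real k powr (2 * (1 + \<alpha>)) = 1"
        using k1 by (simp flip: powr_add)
      finally show ?thesis by (simp add: B_def)
    qed
    ultimately show "\<exists>(p::real poly) J. degree p \<le> m \<and> J \<in> sets borel \<and>
       measure M (J \<inter> {-1..1}) * real m powr (2 * (1 + \<alpha>)) \<le> B \<and>
       (\<integral>\<^sup>+x. ennreal ((poly p x)\<^sup>2) \<partial>M) > 0 \<and>
       (\<integral>\<^sup>+x. ennreal ((poly p x)\<^sup>2) * indicator (- J) x \<partial>M) \<le> ennreal \<epsilon> * (\<integral>\<^sup>+x. ennreal ((poly p x)\<^sup>2) \<partial>M)"
      unfolding I_def using deg by (intro exI[of _ p] exI[of _ "{1 - h<..}"]) auto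
  qed
qed

lemma peaked_left: "peaked \<beta>"
  unfolding peaked_def
proof (intro allI impI)
  interpret r: jacobi \<beta> \<alpha> by (rule flip)
  fix \<epsilon> :: real assume eps: "\<epsilon> > 0"
  obtain B m0 where B: "B > 0" and H: "\<And>m. m \<ge> m0 \<Longrightarrow> \<exists>(p::real poly) J. degree p \<le> m \<and> J \<in> sets borel \<and>
     measure r.M (J \<inter> {-1..1}) * real m powr (2 * (1 + \<beta>)) \<le> B \<and>
     (\<integral>\<^sup>+x. ennreal ((poly p x)\<^sup>2) \<partial>r.M) > 0 \<and>
     (\<integral>\<^sup>+x. ennreal ((poly p x)\<^sup>2) * indicator (- J) x \<partial>r.M) \<le> ennreal \<epsilon> * (\<integral>\<^sup>+x. ennreal ((poly p x)\<^sup>2) \<partial>r.M)"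
    using r.peaked_right eps unfolding r.peaked_def by blast
  show "\<exists>B>0. \<exists>m0. \<forall>m\<ge>m0. \<exists>(p::real poly) J. degree p \<le> m \<and> J \<in> sets borel \<and>
     measure M (J \<inter> {-1..1}) * real m powr (2 * (1 + \<beta>)) \<le> B \<and>
     (\<integral>\<^sup>+x. ennreal ((poly p x)\<^sup>2) \<partial>M) > 0 \<and>
     (\<integral>\<^sup>+x. ennreal ((poly p x)\<^sup>2) * indicator (- J) x \<partial>M) \<le> ennreal \<epsilon> * (\<integral>\<^sup>+x. ennreal ((poly p x)\<^sup>2) \<partial>M)"
  proof (rule exI[of _ B], rule conjI[OF B], rule exI[of _ m0], intro allI impI)
    fix m assume "m \<ge> m0"
    from H[OF this] obtain p :: "real poly" and J where p: "degree p \<le> m" and J: "J \<in> sets borel"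
      and mass: "measure r.M (J \<inter> {-1..1}) * real m powr (2 * (1 + \<beta>)) \<le> B"
      and pos: "(\<integral>\<^sup>+x. ennreal ((poly p x)\<^sup>2) \<partial>r.M) > 0"
      and tail: "(\<integral>\<^sup>+x. ennreal ((poly p x)\<^sup>2) * indicator (- J) x \<partial>r.M) \<le> ennreal \<epsilon> * (\<integral>\<^sup>+x. ennreal ((poly p x)\<^sup>2) \<partial>r.M)"
      by blast
    let ?p = "pcompose p [:0, -1:]" and ?J = "uminus -` J"
    have "degree ?p \<le> m" using p by (simp add: degree_pcompose)
    moreover have "?J \<in> sets borel" using J measurable_sets[of uminus borel borel J] by simp
    moreover have "measure M (?J \<inter> {-1..1}) = measure r.M (J \<inter> {-1..1})"
      unfolding measure_def reflect_emeasure[OF J] ..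
    moreover have "(\<integral>\<^sup>+x. ennreal ((poly p x)\<^sup>2) \<partial>r.M) = (\<integral>\<^sup>+x. ennreal ((poly ?p x)\<^sup>2) \<partial>M)"
      by (subst reflect_nn) (auto simp: poly_pcompose intro!: borel_measurable_continuous_onI continuous_intros)
    moreover have "(\<integral>\<^sup>+x. ennreal ((poly p x)\<^sup>2) * indicator (- J) x \<partial>r.M) = (\<integral>\<^sup>+x. ennreal ((poly ?p x)\<^sup>2) * indicator (- ?J) x \<partial>M)"
    proof (subst reflect_nn)
      have [measurable]: "J \<in> sets borel" "poly p \<in> borel_measurable borel"
        using J by (auto intro!: borel_measurable_continuous_onI continuous_intros)
      show "(\<lambda>x. ennreal ((poly p x)\<^sup>2) * indicator (- J) x) \<in> borel_measurable borel"
        using borel_comp[OF J] by measurable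
    qed (auto simp: poly_pcompose indicator_def intro!: nn_integral_cong)
    ultimately show "\<exists>(p::real poly) J. degree p \<le> m \<and> J \<in> sets borel \<and>
       measure M (J \<inter> {-1..1}) * real m powr (2 * (1 + \<beta>)) \<le> B \<and>
       (\<integral>\<^sup>+x. ennreal ((poly p x)\<^sup>2) \<partial>M) > 0 \<and>
       (\<integral>\<^sup>+x. ennreal ((poly p x)\<^sup>2) * indicator (- J) x \<partial>M) \<le> ennreal \<epsilon> * (\<integral>\<^sup>+x. ennreal ((poly p x)\<^sup>2) \<partial>M)"
      using mass pos tail by (intro exI[of _ ?p] exI[of _ ?J]) simp
  qed
qed


section \<open>Coordinates of the sample space and the absence of ties\<close>

lemma distr_component: "i \<in> {1..n} \<Longrightarrow> distr (P n) M (\<lambda>x. x i) = M"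
  unfolding P_eq by (rule distr_PiM_component) (rule prob_M)

lemma component_measurable [measurable]: "i \<in> {1..n} \<Longrightarrow> (\<lambda>x. x i) \<in> P n \<rightarrow>\<^sub>M M"
  unfolding P_eq by measurable

lemma nn_integral_component:
  assumes i: "i \<in> {1..n}" and f: "f \<in> borel_measurable M"
  shows "(\<integral>\<^sup>+x. f (x i) \<partial>P n) = (\<integral>\<^sup>+t. f t \<partial>M)"
  using nn_integral_distr[OF component_measurable[OF i], of f] f by (simp only: distr_component[OF i])

lemma some_sample_in_le:
  assumes A: "A \<in> sets M"
  shows "measure (P n) (\<Union>i\<in>{1..n}. {x \<in> space (P n). x i \<in> A}) \<le> real n * prob A"
    and "(\<Union>i\<in>{1..n}. {x \<in> space (P n). x i \<in> A}) \<in> sets (P n)"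
proof -
  have s: "{x \<in> space (P n). x i \<in> A} \<in> sets (P n)" if "i \<in> {1..n}" for i
    using measurable_sets[OF component_measurable[OF that] A] by (simp add: vimage_def Int_def conj_commute)
  have m: "measure (P n) {x \<in> space (P n). x i \<in> A} = prob A" if "i \<in> {1..n}" for i
  proof -
    have "prob A = measure (distr (P n) M (\<lambda>x. x i)) A" by (simp only: distr_component[OF that])
    also have "\<dots> = measure (P n) ((\<lambda>x. x i) -` A \<inter> space (P n))"
      by (rule measure_distr[OF component_measurable[OF that] A])
    also have "(\<lambda>x. x i) -` A \<inter> space (P n) = {x \<in> space (P n). x i \<in> A}" by auto
    finally show ?thesis by simp
  qed
  have "measure (P n) (\<Union>i\<in>{1..n}. {x \<in> space (P n). x i \<in> A}) \<le> (\<Sum>i=1..n. measure (P n) {x \<in> space (P n). x i \<in> A})"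
    by (rule measure_UNION_le) (use s in auto)
  also have "\<dots> = real n * prob A" using m by simp
  finally show "measure (P n) (\<Union>i\<in>{1..n}. {x \<in> space (P n). x i \<in> A}) \<le> real n * prob A" .
  show "(\<Union>i\<in>{1..n}. {x \<in> space (P n). x i \<in> A}) \<in> sets (P n)" using s by auto
qed

lemma emeasure_singleton: "emeasure M ({a} \<inter> {-1..1}) = 0"
proof -
  have "emeasure M ({a} \<inter> {-1..1}) = (\<integral>\<^sup>+x. indicator ({a} \<inter> {-1..1}) x \<partial>M)"
    using sets_M_I[of "{a}"] by simp
  also have "\<dots> = (\<integral>\<^sup>+x. ennreal (w x / Z) * indicator ({a} \<inter> {-1..1}) x * indicator {-1..1} x \<partial>lborel)"
    by (rule nn_M) auto
  also have "\<dots> = (\<integral>\<^sup>+(x::real). 0 \<partial>lborel)"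
  proof (rule nn_integral_cong_AE)
    have "AE x in lborel. x \<noteq> a" by (rule AE_lborel_singleton)
    thus "AE x in lborel. ennreal (w x / Z) * indicator ({a} \<inter> {-1..1}) x * indicator {-1..1} x = 0"
      by eventually_elim (auto simp: indicator_def)
  qed
  finally show ?thesis by simp
qed

text \<open>Integrating out coordinate i with the others fixed leaves the mass of the single point x
  j, which is 0. Distinct samples are what \<open>cond_number_ge\<close> needs.\<close>

lemma ties_null:
  assumes ij: "i \<in> {1..n}" "j \<in> {1..n}" "i \<noteq> j"
  shows "{x \<in> space (P n). x i = x j} \<in> sets (P n)" "emeasure (P n) {x \<in> space (P n). x i = x j} = 0"
proof -
  interpret PP: product_prob_space "\<lambda>_::nat. M" "{1..n}" by unfold_locales
  have b: "(\<lambda>x. x k) \<in> borel_measurable (P n)" if "k \<in> {1..n}" for k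
    using measurable_compose[OF component_measurable[OF that] id_M] .
  note [measurable] = b[OF ij(1)] b[OF ij(2)]
  show T: "{x \<in> space (P n). x i = x j} \<in> sets (P n)" by measurable
  define I where "I = {1..n} - {i}"
  have I: "insert i I = {1..n}" "finite I" "i \<notin> I" using ij by (auto simp: I_def)
  have Pi: "P n = Pi\<^sub>M (insert i I) (\<lambda>_. M)" by (simp add: P_eq I(1))
  let ?f = "\<lambda>x. indicator {x \<in> space (P n). x i = x j} x :: ennreal"
  have "emeasure (P n) {x \<in> space (P n). x i = x j} = (\<integral>\<^sup>+x. ?f x \<partial>P n)"
    using T by simp
  also have "\<dots> = (\<integral>\<^sup>+x. (\<integral>\<^sup>+y. ?f (x(i := y)) \<partial>M) \<partial>Pi\<^sub>M I (\<lambda>_. M))"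
    unfolding Pi by (rule PP.product_nn_integral_insert) (use I T in \<open>auto simp: Pi\<close>)
  also have "\<dots> \<le> (\<integral>\<^sup>+x. (\<integral>\<^sup>+y. indicator ({x j} \<inter> {-1..1}) y \<partial>M) \<partial>Pi\<^sub>M I (\<lambda>_. M))"
    using ij by (intro nn_integral_mono) (auto simp: indicator_def space_M)
  also have "\<dots> = 0"
    using emeasure_singleton sets_M_I[of "{_}"] by simp
  finally show "emeasure (P n) {x \<in> space (P n). x i = x j} = 0" by simp
qed

lemma samples_distinct: "AE x in P n. inj_on x {1..n}"
proof -
  have "AE x in P n. x i \<noteq> x j" if "i \<in> {1..n}" "j \<in> {1..n}" "i \<noteq> j" for i j
    by (rule AE_I[OF _ ties_null(2)[OF that] ties_null(1)[OF that]]) auto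
  hence "AE x in P n. \<forall>i\<in>{1..n}. \<forall>j\<in>{1..n} - {i}. x i \<noteq> x j"
    by (intro AE_finite_allI) auto
  thus ?thesis by eventually_elim (auto simp: inj_on_def)
qed

text \<open>Otherwise, with probability above 1/2, no sample falls into J, the sum of p^2 over the
  samples outside J stays below four times the bound on its mean, and the samples are distinct.
  Since E has probability at least 1/2, it contains such a sample; there the squared empirical norm
  is below I / (2 K^2), contradicting the bound K on the condition number.\<close>

lemma sampling_rate_necessary_bound:
  assumes K: "K > 0" and mn: "m < n"
    and E: "E \<in> sets (P n)" "measure (P n) E \<ge> 1/2" "\<And>x. x \<in> E \<Longrightarrow> cond_number M m n x \<le> ereal K"
    and p: "degree p \<le> m" and J: "J \<in> sets borel"
    and pos: "(\<integral>\<^sup>+x. ennreal ((poly p x)\<^sup>2) \<partial>M) > 0"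
    and tail: "(\<integral>\<^sup>+x. ennreal ((poly p x)\<^sup>2) * indicator (- J) x \<partial>M)
      \<le> ennreal (1 / (8 * K\<^sup>2)) * (\<integral>\<^sup>+x. ennreal ((poly p x)\<^sup>2) \<partial>M)"
  shows "real n * prob (J \<inter> {-1..1}) \<ge> 1/4"
proof (rule ccontr)
  assume "\<not> real n * prob (J \<inter> {-1..1}) \<ge> 1/4"
  hence small: "real n * prob (J \<inter> {-1..1}) < 1/4" by simp
  interpret P: prob_space "P n" by (rule prob_P)
  have n: "n > 0" using mn by simp
  define I where "I = (LINT x|M. (poly p x)\<^sup>2)"
  have II: "(\<integral>\<^sup>+x. ennreal ((poly p x)\<^sup>2) \<partial>M) = ennreal I"
    unfolding I_def by (intro nn_integral_eq_integral integrable_M continuous_intros) auto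
  have I: "I > 0" using pos unfolding II by simp
  have p0: "p \<noteq> 0" using I by (auto simp: I_def)
  have [measurable]: "J \<in> sets borel" "poly p \<in> borel_measurable borel"
    using J by (auto intro!: borel_measurable_continuous_onI continuous_intros)
  define f where "f = (\<lambda>t. ennreal ((poly p t)\<^sup>2) * indicator (- J) t)"
  have f_meas: "f \<in> borel_measurable M" unfolding f_def by (intro borel_M) measurable
  define bad1 where "bad1 = (\<Union>i\<in>{1..n}. {x \<in> space (P n). x i \<in> J \<inter> {-1..1}})"
  have JM: "J \<inter> {-1..1} \<in> sets M" by (rule sets_M_I[OF J])
  have bad1: "measure (P n) bad1 < 1/4" "bad1 \<in> sets (P n)"
    unfolding bad1_def using some_sample_in_le[OF JM, of n] small by auto
  \<comment> \<open>1 / c = n I / (2 K^2) is four times the bound n I / (8 K^2) on the expected sum,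
    so Markov's inequality gives 1/4.\<close>
  define c where "c = 2 * K\<^sup>2 / (real n * I)"
  have c: "c > 0" using K n I by (simp add: c_def)
  define bad2 where "bad2 = {x \<in> space (P n). 1 \<le> ennreal c * (\<Sum>i=1..n. f (x i))}"
  have fi: "(\<lambda>x. f (x i)) \<in> borel_measurable (P n)" if "i \<in> {1..n}" for i
    by (rule measurable_compose[OF component_measurable[OF that] f_meas])
  have sum_meas: "(\<lambda>x. \<Sum>i=1..n. f (x i)) \<in> borel_measurable (P n)"
    using fi by (intro borel_measurable_sum) auto
  have bad2_sets: "bad2 \<in> sets (P n)" unfolding bad2_def using sum_meas by measurable
  have "emeasure (P n) bad2 \<le> ennreal c * (\<integral>\<^sup>+x. (\<Sum>i=1..n. f (x i)) * indicator (space (P n)) x \<partial>P n)"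
    unfolding bad2_def by (rule nn_integral_Markov_inequality) (use sum_meas in auto)
  also have "(\<integral>\<^sup>+x. (\<Sum>i=1..n. f (x i)) * indicator (space (P n)) x \<partial>P n) = (\<integral>\<^sup>+x. (\<Sum>i=1..n. f (x i)) \<partial>P n)"
    by (intro nn_integral_cong) auto
  also have "\<dots> = (\<Sum>i=1..n. (\<integral>\<^sup>+x. f (x i) \<partial>P n))"
    using fi by (intro nn_integral_sum) auto
  also have "\<dots> = (\<Sum>i=1..n. (\<integral>\<^sup>+t. f t \<partial>M))"
    by (intro sum.cong refl nn_integral_component f_meas)
  also have "\<dots> = ennreal (real n) * (\<integral>\<^sup>+t. f t \<partial>M)" by (simp add: ennreal_of_nat_eq_real_of_nat)
  also have "ennreal c * \<dots> \<le> ennreal c * (ennreal (real n) * (ennreal (1 / (8 * K\<^sup>2)) * ennreal I))"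
    using tail unfolding II f_def by (intro mult_left_mono) auto
  also have "\<dots> = ennreal (c * (real n * (1 / (8 * K\<^sup>2) * I)))"
    using c I by (simp add: ennreal_mult[symmetric])
  also have "c * (real n * (1 / (8 * K\<^sup>2) * I)) = 1/4"
    using K n I by (simp add: c_def field_simps)
  finally have bad2: "measure (P n) bad2 \<le> 1/4"
    unfolding P.emeasure_eq_measure by (subst (asm) ennreal_le_iff) auto
  obtain Nl where Nl: "Nl \<in> null_sets (P n)" "{x \<in> space (P n). \<not> inj_on x {1..n}} \<subseteq> Nl"
    using samples_distinct[of n] by (auto simp: eventually_ae_filter)
  have "measure (P n) (bad1 \<union> bad2 \<union> Nl) < 1/2"
  proof -
    have "measure (P n) (bad1 \<union> bad2 \<union> Nl) \<le> measure (P n) (bad1 \<union> bad2) + measure (P n) Nl"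
      using bad1 bad2_sets Nl by (intro measure_Un_le) auto
    also have "\<dots> \<le> measure (P n) bad1 + measure (P n) bad2 + 0"
      using bad1 bad2_sets Nl by (intro add_mono measure_Un_le) (auto simp: measure_eq_0_null_sets)
    finally show ?thesis using bad1 bad2 by linarith
  qed
  hence "\<not> E \<subseteq> bad1 \<union> bad2 \<union> Nl"
    using E(2) P.finite_measure_mono[of E "bad1 \<union> bad2 \<union> Nl"] bad1 bad2_sets Nl by force
  then obtain x where x: "x \<in> E" "x \<notin> bad1" "x \<notin> bad2" "x \<notin> Nl" by blast
  have xs: "x \<in> space (P n)" using x(1) E(1) sets.sets_into_space by blast
  have xi: "x i \<in> {-1..1}" if "i \<in> {1..n}" for i
    using measurable_space[OF component_measurable[OF that] xs] by (simp add: space_M)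
  have inj: "inj_on x {1..n}" using x(4) Nl(2) xs by blast
  have "f (x i) = ennreal ((poly p (x i))\<^sup>2)" if "i \<in> {1..n}" for i
    using x(2) xs xi[OF that] that by (auto simp: f_def bad1_def)
  hence "(\<Sum>i=1..n. f (x i)) = (\<Sum>i=1..n. ennreal ((poly p (x i))\<^sup>2))" by (intro sum.cong) auto
  also have "\<dots> = ennreal (\<Sum>i=1..n. (poly p (x i))\<^sup>2)" by (rule sum_ennreal) auto
  finally have "ennreal (c * (\<Sum>i=1..n. (poly p (x i))\<^sup>2)) < 1"
    using x(3) xs c by (simp add: bad2_def not_le ennreal_mult sum_nonneg)
  hence "c * (\<Sum>i=1..n. (poly p (x i))\<^sup>2) < 1"
    by (simp add: ennreal_less_one_iff)
  moreover have "(\<Sum>i=1..n. (poly p (x i))\<^sup>2) = real n * (emp_norm n x (poly p))\<^sup>2"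
    unfolding emp_norm_sq emp_form_def using n by (simp add: power2_eq_square)
  ultimately have "c * (real n * (emp_norm n x (poly p))\<^sup>2) < 1" by simp
  hence e2: "2 * (K\<^sup>2 * (emp_norm n x (poly p))\<^sup>2) < I"
    using n I by (simp add: c_def divide_less_eq)
  have "ereal (L2_norm M (poly p) / emp_norm n x (poly p)) \<le> ereal K"
    using cond_number_ge[OF inj mn p p0, of M] E(3)[OF x(1)] by (rule order_trans)
  moreover have "emp_norm n x (poly p) > 0"
    using emp_norm_poly_eq_0[OF inj mn p] p0 emp_norm_nonneg[of n x "poly p"] by (auto simp: less_le)
  ultimately have "L2_norm M (poly p) \<le> K * emp_norm n x (poly p)" by (simp add: divide_le_eq)
  hence "(L2_norm M (poly p))\<^sup>2 \<le> (K * emp_norm n x (poly p))\<^sup>2"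
    by (intro power_mono) (auto simp: L2_norm_def)
  hence "I \<le> K\<^sup>2 * (emp_norm n x (poly p))\<^sup>2"
    by (simp add: L2_norm_def I_def power_mult_distrib)
  thus False using e2 I by linarith
qed

text \<open>For large n, high probability means at least 1/2; then 1/4 <= n * prob J and prob J <= B
  m^(-2 (1 + g)) give the rate with the constant 1 / (4 B).\<close>

lemma sampling_rate_necessary:
  assumes pk: "peaked g" and g: "g > -1"
    and R: "\<forall>(m, n)\<in>R. m < n" and st: "ls_stable \<alpha> \<beta> R"
  shows "\<exists>c>0. \<forall>(m, n)\<in>R. real n \<ge> c * real m powr (2 * (1 + g))"
proof -
  obtain K C s where K: "K > 0" and C: "C > 0" and s: "s > 0" and S: "\<And>m n. (m, n) \<in> R \<Longrightarrow>
      \<exists>E \<in> sets (P n). measure (P n) E \<ge> 1 - C / real n powr s \<and> (\<forall>x\<in>E. cond_number M m n x \<le> ereal K)"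
    using st unfolding ls_stable_def by fast
  have eps: "1 / (8 * K\<^sup>2) > 0" using K by simp
  obtain B m0 where B: "B > 0" and pk': "\<And>m. m \<ge> m0 \<Longrightarrow> \<exists>(p::real poly) J. degree p \<le> m \<and> J \<in> sets borel \<and>
     measure M (J \<inter> {-1..1}) * real m powr (2 * (1 + g)) \<le> B \<and>
     (\<integral>\<^sup>+x. ennreal ((poly p x)\<^sup>2) \<partial>M) > 0 \<and>
     (\<integral>\<^sup>+x. ennreal ((poly p x)\<^sup>2) * indicator (- J) x \<partial>M) \<le> ennreal (1 / (8 * K\<^sup>2)) * (\<integral>\<^sup>+x. ennreal ((poly p x)\<^sup>2) \<partial>M)"
    using pk[unfolded peaked_def, rule_format, OF eps] by blast
  have "((\<lambda>n. C / real n powr s) \<longlongrightarrow> 0) sequentially" using s by real_asymp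
  hence "eventually (\<lambda>n. C / real n powr s < 1/2) sequentially" by (rule order_tendstoD) simp
  then obtain n0 where n0: "\<And>n. n \<ge> n0 \<Longrightarrow> C / real n powr s < 1/2" by (auto simp: eventually_sequentially)
  \<comment> \<open>If m < m0 or n < n0, then m < n implies m <= N; the second entry of c makes the
    claimed bound at most 1 <= n for these pairs.\<close>
  define N where "N = real (max m0 n0) + 1"
  have N: "N > 0" by (simp add: N_def)
  define c where "c = min (1 / (4 * B)) (1 / N powr (2 * (1 + g)))"
  have c: "c > 0" using B N by (simp add: c_def)
  have "real n \<ge> c * real m powr (2 * (1 + g))" if mn: "(m, n) \<in> R" for m n
  proof (cases "m \<ge> m0 \<and> n \<ge> n0")
    case True
    have lt: "m < n" using R mn by auto
    obtain E where E: "E \<in> sets (P n)" "measure (P n) E \<ge> 1 - C / real n powr s"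
      "\<And>x. x \<in> E \<Longrightarrow> cond_number M m n x \<le> ereal K" using S[OF mn] by blast
    have E2: "measure (P n) E \<ge> 1/2" using E(2) n0[of n] True by linarith
    obtain p :: "real poly" and J where p: "degree p \<le> m" and J: "J \<in> sets borel"
      and mass: "measure M (J \<inter> {-1..1}) * real m powr (2 * (1 + g)) \<le> B"
      and pos: "(\<integral>\<^sup>+x. ennreal ((poly p x)\<^sup>2) \<partial>M) > 0"
      and tail: "(\<integral>\<^sup>+x. ennreal ((poly p x)\<^sup>2) * indicator (- J) x \<partial>M) \<le> ennreal (1 / (8 * K\<^sup>2)) * (\<integral>\<^sup>+x. ennreal ((poly p x)\<^sup>2) \<partial>M)"
      using pk' True by blast
    have "1/4 \<le> real n * prob (J \<inter> {-1..1})"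
      by (rule sampling_rate_necessary_bound[OF K lt E(1) E2 E(3) p J pos tail])
    hence "1/4 * real m powr (2 * (1 + g)) \<le> real n * prob (J \<inter> {-1..1}) * real m powr (2 * (1 + g))"
      by (intro mult_right_mono) auto
    also have "\<dots> \<le> real n * B" using mass mult_left_mono[OF mass, of "real n"] by (simp add: mult.assoc)
    finally have "1 / (4 * B) * real m powr (2 * (1 + g)) \<le> real n" using B by (simp add: field_simps)
    moreover have "c * real m powr (2 * (1 + g)) \<le> 1 / (4 * B) * real m powr (2 * (1 + g))"
      by (intro mult_right_mono) (auto simp: c_def)
    ultimately show ?thesis by linarith
  next
    case False
    have lt: "m < n" using R mn by auto
    have "real m \<le> N" using False lt by (auto simp: N_def)
    hence "real m powr (2 * (1 + g)) \<le> N powr (2 * (1 + g))" using g by (intro powr_mono2) auto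
    hence "c * real m powr (2 * (1 + g)) \<le> 1 / N powr (2 * (1 + g)) * N powr (2 * (1 + g))"
      using c by (intro mult_mono) (auto simp: c_def)
    also have "\<dots> = 1" using N by simp
    also have "\<dots> \<le> real n" using lt by simp
    finally show ?thesis .
  qed
  thus ?thesis using c by (intro exI[of _ c]) auto
qed

end

theorem corollary1p1:
  fixes \<alpha> \<beta> \<gamma> :: real
  assumes "\<alpha> > -1" and "\<beta> > -1" and "\<gamma> = max \<alpha> \<beta>" and "\<gamma> > -1/2"
  shows "(\<forall>c>0. ls_stable \<alpha> \<beta>
            {(m, n). m < n \<and> real n \<ge> c * real m powr (2 * (1 + \<gamma>)) * ln (real n)})
       \<and> (\<forall>R. (\<forall>(m, n)\<in>R. m < n) \<longrightarrow> ls_stable \<alpha> \<beta> R \<longrightarrow>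
            (\<exists>c>0. \<forall>(m, n)\<in>R. real n \<ge> c * real m powr (2 * (1 + \<gamma>))))"
proof -
  interpret jacobi \<alpha> \<beta> using assms by unfold_locales
  have "peaked \<gamma>" using peaked_right peaked_left assms(3) by (simp add: max_def)
  thus ?thesis
    using sampling_rate_sufficient[OF assms(3,4)] sampling_rate_necessary[of \<gamma>] assms(4) by force
qed

end
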